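(* For every integer $n\ge 1$ one has $$\#(C,K)(n)=S_n=\#(C,E)(n),$$ where $\#(C,K)(n)$ is the number of subcategories of $\mathcal A_n$ that are closed under cokernels and kernels, $\#(C,E)(n)$ is the number of subcategories of $\mathcal A_n$ that are closed under cokernels and extensions, and $S_n$ is the $n$-th large Schröder number.
   Context: The $\mathbb F_2$-linear category $\mathcal I_n$ of intervals of type $n$ has as objects the pairs of integers $[a,b]$ with $1\le a\le b\le n$. For $x=[a,b]$, $y=[c,d]$ set $\operatorname{Hom}_{\mathcal I_n}(x,y)=\mathbb F_2$ if $a\le c\le b\le d$ (with non-zero element denoted $\alpha_{xy}$), and $\{0\}$ otherwise. Composition: $\alpha_{yz}\circ\alpha_{xy}=\alpha_{xz}$ when $x=[a,b]$, $y=[c,d]$, $z=[e,f]$ and $a\le c\le e\le b\le d\le f$; all other compositions are zero. The category $\mathcal A_n$ of multisets of intervals of type $n$ has as objects the finite multisets $\oplus_{i=1}^r x_i$ of objects of $\mathcal I_n$ (including the empty one), morphisms $\operatorname{Hom}_{\mathcal A_n}(\oplus_i x_i,\oplus_j y_j)=\bigoplus_{i,j}\operatorname{Hom}_{\mathcal I_n}(x_i,y_j)$, and composition given by matrix multiplication. It is an abelian category, equivalent to the category of finite dimensional contravariant $\mathbb F_2$-linear representations of the quiver $1\to 2\to\cdots\to n$, and its indecomposable objects are the intervals. The subcategories being counted are full subcategories $\mathcal A\subseteq\mathcal A_n$ closed under finite direct sums and direct summands (so each is determined by the set of intervals it contains). Closed under cokernels (C), resp. kernels (K), means that for every morphism of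 $\mathcal A$ its cokernel, resp. kernel, taken in $\mathcal A_n$ belongs to $\mathcal A$. Closed under extensions (E) means that for every exact sequence $0\to X\to Y\to Z\to 0$ in $\mathcal A_n$ with $X,Z\in\mathcal A$ also $Y\in\mathcal A$. The $n$-th large Schröder number is $S_n=\sum_{i=0}^n\frac{1}{i+1}\binom{n}{i}\binom{n+i}{i}$; equivalently, $S_0=1$ and $S_n=S_{n-1}+\sum_{k=0}^{n-1}S_kS_{n-1-k}$ for $n\ge 1$. *)

theory Defs
  imports Complex_Main "HOL-Library.Multiset" "HOL-Library.Z2"
begin

type_synonym interval = "nat \<times> nat"

definition intervals :: "nat \<Rightarrow> interval set" where
  "intervals n = {(a, b). 1 \<le> a \<and> a \<le> b \<and> b \<le> n}"

text \<open>Every morphism space is either the field with two elements or zero. A morphism is represented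
  by its coefficient with respect to the basis element \<open>\<alpha>\<^sub>x\<^sub>y\<close>.\<close>

fun hom_int :: "interval \<Rightarrow> interval \<Rightarrow> bit set" where
  "hom_int (a, b) (c, d) = (if a \<le> c \<and> c \<le> b \<and> b \<le> d then UNIV else {0})"

text \<open>\<open>comp_int x y z g f\<close> is the composite of \<open>f : x \<rightarrow> y\<close> followed by \<open>g : y \<rightarrow> z\<close>.\<close>

fun comp_int :: "interval \<Rightarrow> interval \<Rightarrow> interval \<Rightarrow> bit \<Rightarrow> bit \<Rightarrow> bit" where
  "comp_int (a, b) (c, d) (e, f) \<psi> \<phi> =
     (if a \<le> c \<and> c \<le> e \<and> e \<le> b \<and> b \<le> d \<and> d \<le> f then \<psi> * \<phi> else 0)"

definition obj :: "nat \<Rightarrow> interval multiset set" where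
  "obj n = {M. set_mset M \<subseteq> intervals n}"

text \<open>The summands of a multiset \<open>M\<close> are indexed by the pairs \<open>(x, i)\<close> with \<open>i < count M x\<close>; the
  index \<open>(x, i)\<close> stands for the \<open>i\<close>-th copy of \<open>x\<close>.\<close>

definition idx :: "interval multiset \<Rightarrow> (interval \<times> nat) set" where
  "idx M = {(x, i). i < count M x}"

text \<open>Morphisms are matrices. They vanish outside of the relevant index sets, so that equality of
  morphisms is equality of functions.\<close>

type_synonym mor = "interval \<times> nat \<Rightarrow> interval \<times> nat \<Rightarrow> bit"

definition hom :: "interval multiset \<Rightarrow> interval multiset \<Rightarrow> mor set" where
  "hom M N = {f. \<forall>p q. f p q \<in>
     (if p \<in> idx M \<and> q \<in> idx N then hom_int (fst p) (fst q) else {0})}"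

text \<open>In \<open>mcomp N g f\<close> the object \<open>N\<close> is the target of \<open>f\<close> and the source of \<open>g\<close>.\<close>

definition mcomp :: "interval multiset \<Rightarrow> mor \<Rightarrow> mor \<Rightarrow> mor" where
  "mcomp N g f = (\<lambda>p r. \<Sum>q\<in>idx N. comp_int (fst p) (fst q) (fst r) (g q r) (f p q))"

definition mid :: "interval multiset \<Rightarrow> mor" where
  "mid M = (\<lambda>p q. if p = q \<and> p \<in> idx M then 1 else 0)"

definition mzero :: mor where
  "mzero = (\<lambda>p q. 0)"

definition isomorphic :: "interval multiset \<Rightarrow> interval multiset \<Rightarrow> bool" where
  "isomorphic M N \<longleftrightarrow>
     (\<exists>f\<in>hom M N. \<exists>g\<in>hom N M. mcomp N g f = mid M \<and> mcomp M f g = mid N)"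

text \<open>\<open>is_kernel n M N f K k\<close>: the morphism \<open>k : K \<rightarrow> M\<close> is a kernel of \<open>f : M \<rightarrow> N\<close>.\<close>

definition is_kernel ::
  "nat \<Rightarrow> interval multiset \<Rightarrow> interval multiset \<Rightarrow> mor \<Rightarrow> interval multiset \<Rightarrow> mor \<Rightarrow> bool" where
  "is_kernel n M N f K k \<longleftrightarrow>
     M \<in> obj n \<and> N \<in> obj n \<and> f \<in> hom M N \<and>
     K \<in> obj n \<and> k \<in> hom K M \<and> mcomp M f k = mzero \<and>
     (\<forall>L\<in>obj n. \<forall>h\<in>hom L M. mcomp M f h = mzero \<longrightarrow>
        (\<exists>!u. u \<in> hom L K \<and> mcomp K k u = h))"

text \<open>\<open>is_cokernel n M N f C c\<close>: the morphism \<open>c : N \<rightarrow> C\<close> is a cokernel of \<open>f : M \<rightarrow> N\<close>.\<close>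

definition is_cokernel ::
  "nat \<Rightarrow> interval multiset \<Rightarrow> interval multiset \<Rightarrow> mor \<Rightarrow> interval multiset \<Rightarrow> mor \<Rightarrow> bool" where
  "is_cokernel n M N f C c \<longleftrightarrow>
     M \<in> obj n \<and> N \<in> obj n \<and> f \<in> hom M N \<and>
     C \<in> obj n \<and> c \<in> hom N C \<and> mcomp N c f = mzero \<and>
     (\<forall>L\<in>obj n. \<forall>h\<in>hom N L. mcomp N h f = mzero \<longrightarrow>
        (\<exists>!u. u \<in> hom C L \<and> mcomp C u c = h))"

definition short_exact ::
  "nat \<Rightarrow> interval multiset \<Rightarrow> mor \<Rightarrow> interval multiset \<Rightarrow> mor \<Rightarrow> interval multiset \<Rightarrow> bool" where
  "short_exact n X f Y g Z \<longleftrightarrow> is_kernel n Y Z g X f \<and> is_cokernel n X Y f Z g"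

text \<open>A full subcategory is given by its set of objects. The direct sum of two multisets is their
  sum, and the zero object (the empty direct sum) is the empty multiset. Since \<open>Z\<close> may be empty,
  the last condition includes closure under isomorphism.\<close>

definition subcategory :: "nat \<Rightarrow> interval multiset set \<Rightarrow> bool" where
  "subcategory n \<A> \<longleftrightarrow>
     \<A> \<subseteq> obj n \<and>
     {#} \<in> \<A> \<and> (\<forall>X\<in>\<A>. \<forall>Y\<in>\<A>. X + Y \<in> \<A>) \<and>
     (\<forall>Y\<in>\<A>. \<forall>X\<in>obj n. \<forall>Z\<in>obj n. isomorphic Y (X + Z) \<longrightarrow> X \<in> \<A>)"

definition closed_cokernels :: "nat \<Rightarrow> interval multiset set \<Rightarrow> bool" where
  "closed_cokernels n \<A> \<longleftrightarrow>
     (\<forall>M\<in>\<A>. \<forall>N\<in>\<A>. \<forall>f\<in>hom M N. \<forall>C c. is_cokernel n M N f C c \<longrightarrow> C \<in> \<A>)"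

definition closed_kernels :: "nat \<Rightarrow> interval multiset set \<Rightarrow> bool" where
  "closed_kernels n \<A> \<longleftrightarrow>
     (\<forall>M\<in>\<A>. \<forall>N\<in>\<A>. \<forall>f\<in>hom M N. \<forall>K k. is_kernel n M N f K k \<longrightarrow> K \<in> \<A>)"

definition closed_extensions :: "nat \<Rightarrow> interval multiset set \<Rightarrow> bool" where
  "closed_extensions n \<A> \<longleftrightarrow>
     (\<forall>X\<in>\<A>. \<forall>Z\<in>\<A>. \<forall>Y f g. short_exact n X f Y g Z \<longrightarrow> Y \<in> \<A>)"

definition num_CK :: "nat \<Rightarrow> nat" where
  "num_CK n = card {\<A>. subcategory n \<A> \<and> closed_cokernels n \<A> \<and> closed_kernels n \<A>}"

definition num_CE :: "nat \<Rightarrow> nat" where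
  "num_CE n = card {\<A>. subcategory n \<A> \<and> closed_cokernels n \<A> \<and> closed_extensions n \<A>}"

definition schroeder :: "nat \<Rightarrow> real" where
  "schroeder n = (\<Sum>i=0..n. 1 / (real i + 1) * real (n choose i) * real ((n + i) choose i))"

end

theory Submission
  imports Defs "HOL-Computational_Algebra.Formal_Power_Series"
begin

text \<open>A subcategory closed under sums and summands is determined by the set \<open>S\<close> of its intervals. The proof
finds the sets that belong to the two kinds of subcategories and counts both kinds with the same
generating tree.

Closure under cokernels, kernels and extensions forces, respectively, for \<open>[a,b], [c,d] \<in> S\<close>:
\<^item> \<open>coker_stable\<close>: if \<open>a \<le> c \<le> b < d\<close> then \<open>[b+1,d] \<in> S\<close>;
\<^item> \<open>ker_stable\<close>: if \<open>a < c \<le> b \<le> d\<close> then \<open>[a,c-1] \<in> S\<close>;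
\<^item> \<open>ext_stable\<close>: if \<open>a < c \<le> b+1\<close> and \<open>b < d\<close> then \<open>[a,d] \<in> S\<close>, and \<open>[c,b] \<in> S\<close> if \<open>c \<le> b\<close>.

These are the cokernels, the kernels and the middle terms that come from two single intervals. The
converse is the main point. For cokernels, the cokernel of a map with several source intervals is
obtained by dividing out one source interval after the other (\<open>coker_family_insert\<close>). The cokernel of
a map out of one interval \<open>[a,b]\<close> can be written down (\<open>coker_family_single\<close>): apart from target
intervals it contains only intervals \<open>[b+1,d]\<close>, and \<open>[c',d]\<close> for a target interval \<open>[c',d']\<close> nested
in a target interval \<open>[c,d]\<close>. The latter lie in \<open>S\<close> as soon as \<open>S\<close> is \<open>ker_stable\<close> or
\<open>ext_stable\<close> as well (\<open>nest_stable_if_ker_stable\<close>, \<open>nest_stable_if_ext_stable\<close>). Reversing the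
order of \<open>{1..n}\<close> turns kernels into cokernels. For an extension, one looks at a single summand
\<open>[a,b]\<close> of the middle term: factoring its quotients \<open>[m,b]\<close> and its subobjects \<open>[a,m]\<close> through the
outer terms yields enough intervals of \<open>S\<close> to build \<open>[a,b]\<close> (\<open>summand_of_extension\<close>).

To count, the interval \<open>[a,b]\<close> is drawn as an edge from \<open>a-1\<close> to \<open>b\<close> on the points \<open>0,...,n\<close>, and the
points are inserted from right to left. For both kinds of edge sets, the nonempty sets of edges that
can be attached to a new leftmost point correspond to certain admissible vertices. If there are \<open>v\<close>
of them, then attaching nothing leads to \<open>v+1\<close> admissible vertices, and attaching edges leads to
\<open>2,...,v+1\<close> admissible vertices, each number occurring once (\<open>card_cok_ext_edges\<close>,
\<open>card_cok_ker_edges\<close>). Hence both counts are the size of a level of the same tree. The generating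
function of the levels below a node with \<open>v+1\<close> admissible vertices is \<open>S / (1 - x S)^v\<close>, where
\<open>S = 1 + x S + x S^2\<close> is the generating function of the large Schroeder numbers
(\<open>descendants_schroeder\<close>).\<close>

section \<open>Direct sums of intervals and their cokernels\<close>

text \<open>The condition under which the morphism space from \<open>x\<close> to \<open>y\<close> is nonzero. A pair whose first component
exceeds the second one is related to nothing on either side, so it behaves like a zero object. Such
pairs serve as labels of vanishing cokernels.\<close>

definition arrow :: "interval \<Rightarrow> interval \<Rightarrow> bool" where
  "arrow x y \<longleftrightarrow> fst x \<le> fst y \<and> fst y \<le> snd x \<and> snd x \<le> snd y"

lemma hom_int_iff: "t \<in> hom_int x y \<longleftrightarrow> (t \<noteq> 0 \<longrightarrow> arrow x y)"
  by (cases x; cases y) (auto simp: arrow_def)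

lemma comp_int_eq:
  "comp_int x y z g f = (if arrow x y \<and> arrow y z \<and> arrow x z then g * f else 0)"
  by (cases x; cases y; cases z) (auto simp: arrow_def)

lemma comp_int_0 [simp]: "comp_int x y z 0 f = 0" "comp_int x y z g 0 = 0"
  by (simp_all add: comp_int_eq)

lemma comp_int_add:
  "comp_int x y z (g + g') f = comp_int x y z g f + comp_int x y z g' f"
  "comp_int x y z t (f + f') = comp_int x y z t f + comp_int x y z t f'"
  unfolding comp_int_eq
  by (cases "arrow x y \<and> arrow y z \<and> arrow x z"; 
      simp only: if_P if_not_P ring_distribs add_0_left not_False_eq_True)+

lemma comp_int_sum:
  "comp_int x y z (\<Sum>j\<in>J. g j) f = (\<Sum>j\<in>J. comp_int x y z (g j) f)"
  "comp_int x y z t (\<Sum>j\<in>J. f' j) = (\<Sum>j\<in>J. comp_int x y z t (f' j))"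
  by (induction J rule: infinite_finite_induct) (simp_all only: sum.infinite sum.empty sum.insert comp_int_0 comp_int_add not_False_eq_True)

lemma comp_int_of_bool:
  "comp_int x y z g f = of_bool (arrow x y \<and> arrow y z \<and> arrow x z \<and> g = 1 \<and> f = 1)"
  unfolding comp_int_eq by (cases g; cases f) auto

text \<open>Both sides are nonzero exactly if all coefficients are 1, the left ends and the right ends increase
along the path, and the last left end does not exceed the first right end.\<close>

lemma comp_int_assoc:
  "comp_int w y z h (comp_int w x y g f) = comp_int w x z (comp_int x y z h g) f"
  unfolding comp_int_of_bool of_bool_eq_iff of_bool_eq_1_iff by (auto simp: arrow_def)

text \<open>The composite of a map \<open>v\<close> from the interval \<open>x\<close> into the direct sum of the intervals \<open>m j\<close>, for
\<open>j \<in> J\<close>, with a map \<open>h\<close> from this sum to the interval \<open>z\<close>. Direct sums are indexed by arbitrary sets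
here, so that a cokernel can be given on the same index set as the target of its map.\<close>

definition dot :: "'a set \<Rightarrow> ('a \<Rightarrow> interval) \<Rightarrow> interval \<Rightarrow> interval \<Rightarrow> ('a \<Rightarrow> bit) \<Rightarrow> ('a \<Rightarrow> bit) \<Rightarrow> bit" where
  "dot J m x z h v = (\<Sum>j\<in>J. comp_int x (m j) z (h j) (v j))"

lemma dot_assoc:
  "dot K k x z u (\<lambda>\<kappa>. dot J m x (k \<kappa>) (\<lambda>j. c j \<kappa>) v)
     = dot J m x z (\<lambda>j. dot K k (m j) z u (c j)) v"
  unfolding dot_def comp_int_sum comp_int_assoc by (rule sum.swap)

lemma dot_eq_1E:
  assumes "dot J m x z h v = 1"
  obtains j where "j \<in> J" "h j = 1" "v j = 1" "arrow x (m j)" "arrow (m j) z" "arrow x z"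
proof -
  have "\<exists>j\<in>J. comp_int x (m j) z (h j) (v j) \<noteq> 0"
    using assms unfolding dot_def by (metis (no_types, lifting) sum.neutral zero_neq_one)
  thus ?thesis using that by (auto simp: comp_int_of_bool)
qed

lemma dot_eq_1D: "dot J m x z h v = 1 \<Longrightarrow> arrow x z"
  by (rule dot_eq_1E)

lemma dot_cong:
  assumes "\<And>j. j \<in> J \<Longrightarrow> m j = m' j" "\<And>j. j \<in> J \<Longrightarrow> h j = h' j" "\<And>j. j \<in> J \<Longrightarrow> v j = v' j"
  shows "dot J m x z h v = dot J m' x z h' v'"
  unfolding dot_def using assms by (intro sum.cong) auto

lemma dot_add: "dot J m x z (\<lambda>j. h j + h' j) v = dot J m x z h v + dot J m x z h' v"
  by (simp only: dot_def comp_int_add sum.distrib)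

text \<open>The maps from the direct sum of the \<open>k i\<close> to \<open>z\<close>. They vanish outside of \<open>K\<close>, which makes equality of
maps equality of functions.\<close>

definition vecs :: "'a set \<Rightarrow> ('a \<Rightarrow> interval) \<Rightarrow> interval \<Rightarrow> ('a \<Rightarrow> bit) set" where
  "vecs K k z = {u. \<forall>i. u i = 1 \<longrightarrow> i \<in> K \<and> arrow (k i) z}"

text \<open>The map \<open>c\<close> to the sum of the \<open>k \<kappa>\<close> is a cokernel of the matrix \<open>f\<close>. The universal property is
tested on single intervals \<open>z\<close> only, because a map into a direct sum is a tuple of such maps.\<close>

definition coker_family where
  "coker_family I l J m f K k c \<longleftrightarrow>
     (\<forall>\<kappa>. (\<lambda>j. c j \<kappa>) \<in> vecs J m (k \<kappa>)) \<and> (\<forall>j \<kappa>. c j \<kappa> = 1 \<longrightarrow> \<kappa> \<in> K) \<and>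
     (\<forall>i\<in>I. \<forall>\<kappa>\<in>K. dot J m (l i) (k \<kappa>) (\<lambda>j. c j \<kappa>) (f i) = 0) \<and>
     (\<forall>z. \<forall>h\<in>vecs J m z. (\<forall>i\<in>I. dot J m (l i) z h (f i) = 0) \<longrightarrow>
        (\<exists>!u. u \<in> vecs K k z \<and> (\<forall>j\<in>J. h j = dot K k (m j) z u (c j))))"

lemma coker_family_factor:
  assumes "coker_family I l J m f K k c" "h \<in> vecs J m z"
    and "\<And>i. i \<in> I \<Longrightarrow> dot J m (l i) z h (f i) = 0"
  shows "\<exists>!u. u \<in> vecs K k z \<and> (\<forall>j\<in>J. h j = dot K k (m j) z u (c j))"
  using assms unfolding coker_family_def by blast

text \<open>Dividing by the images of all sources can be done in two steps: first divide by the images of the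
sources in \<open>I\<close>, then by the image of the source \<open>i\<close> in that quotient.\<close>

lemma coker_family_insert:
  assumes 1: "coker_family I l J m f K k c"
    and 2: "coker_family {i} l K k (\<lambda>_ \<kappa>. dot J m (l i) (k \<kappa>) (\<lambda>j. c j \<kappa>) (f i)) K' k' c'"
  shows "coker_family (insert i I) l J m f K' k'
           (\<lambda>j \<kappa>'. if j \<in> J then dot K k (m j) (k' \<kappa>') (\<lambda>\<kappa>. c' \<kappa> \<kappa>') (c j) else 0)"
    (is "coker_family _ _ _ _ _ _ _ ?c")
proof -
  have dd: "dot J m x z (\<lambda>j. if j \<in> J then h j else 0) v = dot J m x z h v" for x z h v
    by (rule dot_cong) auto
  have assoc: "dot J m x z (\<lambda>j. dot K' k' (m j) z u (?c j)) v
     = dot J m x z (\<lambda>j. dot K k (m j) z (\<lambda>\<kappa>. dot K' k' (k \<kappa>) z u (c' \<kappa>)) (c j)) v" for x z u v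
    by (rule dot_cong) (simp_all add: dot_assoc)
  show ?thesis
    unfolding coker_family_def
  proof (intro conjI allI ballI impI)
    fix \<kappa> show "(\<lambda>j. ?c j \<kappa>) \<in> vecs J m (k' \<kappa>)"
      by (auto simp: vecs_def dest: dot_eq_1D)
  next
    fix j \<kappa> assume "?c j \<kappa> = 1"
    thus "\<kappa> \<in> K'" using 2 unfolding coker_family_def
      by (auto split: if_splits elim: dot_eq_1E)
  next
    fix i' \<kappa> assume i': "i' \<in> insert i I" and \<kappa>: "\<kappa> \<in> K'"
    have eq: "dot J m (l i') (k' \<kappa>) (\<lambda>j. ?c j \<kappa>) (f i') =
       dot K k (l i') (k' \<kappa>) (\<lambda>\<kappa>'. c' \<kappa>' \<kappa>) (\<lambda>\<kappa>. dot J m (l i') (k \<kappa>) (\<lambda>j. c j \<kappa>) (f i'))"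
      by (simp add: dd dot_assoc)
    show "dot J m (l i') (k' \<kappa>) (\<lambda>j. ?c j \<kappa>) (f i') = 0"
    proof (cases "i' = i")
      case True
      thus ?thesis using 2 \<kappa> unfolding eq coker_family_def by auto
    next
      case False
      hence "i' \<in> I" using i' by auto
      hence "\<And>\<kappa>. \<kappa> \<in> K \<Longrightarrow> dot J m (l i') (k \<kappa>) (\<lambda>j. c j \<kappa>) (f i') = 0"
        using 1 unfolding coker_family_def by auto
      thus ?thesis unfolding eq by (simp add: dot_def[of K])
    qed
  next
    fix z h assume h: "h \<in> vecs J m z" and 0: "\<forall>i'\<in>insert i I. dot J m (l i') z h (f i') = 0"
    have "\<exists>!u. u \<in> vecs K k z \<and> (\<forall>j\<in>J. h j = dot K k (m j) z u (c j))"
      by (rule coker_family_factor[OF 1 h]) (use 0 in auto)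
    then obtain u where u: "u \<in> vecs K k z" "\<And>j. j \<in> J \<Longrightarrow> h j = dot K k (m j) z u (c j)"
      and uu: "\<And>u'. u' \<in> vecs K k z \<Longrightarrow> (\<And>j. j \<in> J \<Longrightarrow> h j = dot K k (m j) z u' (c j)) \<Longrightarrow> u' = u"
      by metis
    have "dot K k (l i) z u (\<lambda>\<kappa>. dot J m (l i) (k \<kappa>) (\<lambda>j. c j \<kappa>) (f i)) = dot J m (l i) z h (f i)"
      unfolding dot_assoc by (rule dot_cong) (use u in auto)
    hence "\<exists>!w. w \<in> vecs K' k' z \<and> (\<forall>\<kappa>\<in>K. u \<kappa> = dot K' k' (k \<kappa>) z w (c' \<kappa>))"
      by (intro coker_family_factor[OF 2 u(1)]) (use 0 in simp)
    then obtain w where w: "w \<in> vecs K' k' z" "\<And>\<kappa>. \<kappa> \<in> K \<Longrightarrow> u \<kappa> = dot K' k' (k \<kappa>) z w (c' \<kappa>)"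
      and ww: "\<And>w'. w' \<in> vecs K' k' z \<Longrightarrow> (\<And>\<kappa>. \<kappa> \<in> K \<Longrightarrow> u \<kappa> = dot K' k' (k \<kappa>) z w' (c' \<kappa>)) \<Longrightarrow> w' = w"
      by metis
    have c: "dot K' k' (m j) z w (?c j) = dot K k (m j) z (\<lambda>\<kappa>. dot K' k' (k \<kappa>) z w (c' \<kappa>)) (c j)"
      if "j \<in> J" for j w using that by (simp add: dot_assoc)
    show "\<exists>!w. w \<in> vecs K' k' z \<and> (\<forall>j\<in>J. h j = dot K' k' (m j) z w (?c j))"
    proof (rule ex1I[of _ w], intro conjI ballI w(1))
      fix j assume j: "j \<in> J"
      show "h j = dot K' k' (m j) z w (?c j)"
        unfolding u(2)[OF j] c[OF j] by (rule dot_cong) (use w in auto)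
    next
      fix w' assume w': "w' \<in> vecs K' k' z \<and> (\<forall>j\<in>J. h j = dot K' k' (m j) z w' (?c j))"
      define u' where "u' = (\<lambda>\<kappa>. if \<kappa> \<in> K then dot K' k' (k \<kappa>) z w' (c' \<kappa>) else 0)"
      have "u' = u"
      proof (rule uu)
        show "u' \<in> vecs K k z" by (auto simp: vecs_def u'_def dest: dot_eq_1D)
        fix j assume j: "j \<in> J"
        hence "h j = dot K' k' (m j) z w' (?c j)" using w' by auto
        thus "h j = dot K k (m j) z u' (c j)"
          unfolding c[OF j] by (simp add: u'_def cong: dot_cong)
      qed
      thus "w' = w" using w' by (intro ww) (auto simp: u'_def)
    qed
  qed
qed

lemma dot_insert:
  "finite J \<Longrightarrow> q \<notin> J \<Longrightarrow>
   dot (insert q J) m x z h v = comp_int x (m q) z (h q) (v q) + dot J m x z h v"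
  by (simp add: dot_def)

lemma dot_zero: "(\<And>j. j \<in> J \<Longrightarrow> h j = 0 \<or> v j = 0) \<Longrightarrow> dot J m x z h v = 0"
  unfolding dot_def by (rule sum.neutral) force

text \<open>The effect of one more target interval \<open>m q\<close> on the cokernel of a map \<open>v\<close> out of a single interval.
The cokernel gains one summand \<open>y\<close>, a quotient of \<open>m q\<close>, onto which \<open>m q\<close> maps canonically and the
other targets by \<open>r\<close>. The hypothesis \<open>kill\<close> says that this map vanishes on the image of \<open>v\<close>. The
hypothesis \<open>ext\<close> says that a map on the enlarged target which vanishes on the image of \<open>v\<close> and is
nonzero on \<open>m q\<close> factors there through \<open>y\<close>. Subtracting the part that factors through \<open>y\<close> leaves a
map on the old target, to which the old cokernel applies.\<close>

lemma coker_family_extend: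
  fixes r :: "'a \<Rightarrow> bit"
  assumes fin: "finite J" and q: "q \<notin> J"
    and IH: "coker_family {i} l J m (\<lambda>_. v) J w c"
    and r: "r \<in> vecs J m y"
    and kill: "dot J m (l i) y r v = comp_int (l i) (m q) y 1 (v q)"
    and quot: "\<And>z. arrow y z \<Longrightarrow> arrow (m q) y \<and> arrow (m q) z"
    and ext: "\<And>z h. h \<in> vecs J m z \<Longrightarrow> arrow (m q) z \<Longrightarrow>
                dot J m (l i) z h v = comp_int (l i) (m q) z 1 (v q) \<Longrightarrow> arrow y z"
  shows "coker_family {i} l (insert q J) m (\<lambda>_. v) (insert q J) (w(q := y))
           (\<lambda>j \<kappa>. if \<kappa> = q then if j = q then of_bool (arrow (m q) y) else r j
                  else if j = q then 0 else c j \<kappa>)"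
    (is "coker_family _ _ _ _ _ _ ?w ?c")
proof -
  have two: "a + b = 0 \<longleftrightarrow> a = b" for a b :: bit by (cases a; cases b) auto
  have cin: "c j \<kappa> = 1 \<Longrightarrow> \<kappa> \<in> J \<and> j \<in> J \<and> arrow (m j) (w \<kappa>)" for j \<kappa>
    using IH unfolding coker_family_def vecs_def by auto
  have c'q: "dot (insert q J) ?w (m q) z u (?c q) = u q" if "u \<in> vecs (insert q J) ?w z" for u z
  proof -
    have "dot J ?w (m q) z u (?c q) = 0" by (rule dot_zero) (use q in auto)
    moreover have "comp_int (m q) y z (u q) (of_bool (arrow (m q) y)) = u q"
      using that quot[of z] by (cases "u q = 0") (auto simp: comp_int_eq vecs_def)
    ultimately show ?thesis using fin q by (simp add: dot_insert)
  qed
  have c'j: "dot (insert q J) ?w (m j) z u (?c j)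
      = comp_int (m j) y z (u q) (r j) + dot J w (m j) z (u(q := 0)) (c j)" if "j \<in> J" for u z j
  proof -
    have "dot J ?w (m j) z u (?c j) = dot J w (m j) z (u(q := 0)) (c j)"
      by (rule dot_cong) (use q that in auto)
    thus ?thesis using fin q that by (auto simp: dot_insert)
  qed
  show ?thesis
    unfolding coker_family_def
  proof (intro conjI allI ballI impI)
    fix \<kappa> show "(\<lambda>j. ?c j \<kappa>) \<in> vecs (insert q J) m (?w \<kappa>)"
      using cin r by (auto simp: vecs_def)
  next
    fix j \<kappa> assume "?c j \<kappa> = 1"
    thus "\<kappa> \<in> insert q J" using cin by (auto split: if_splits)
  next
    fix i' \<kappa> assume i': "i' \<in> {i}" and \<kappa>: "\<kappa> \<in> insert q J"
    show "dot (insert q J) m (l i') (?w \<kappa>) (\<lambda>j. ?c j \<kappa>) v = 0"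
    proof (cases "\<kappa> = q")
      case True
      have "dot J m (l i) y (\<lambda>j. ?c j q) v = dot J m (l i) y r v"
        by (rule dot_cong) (use q in auto)
      moreover have "comp_int (l i) (m q) y (of_bool (arrow (m q) y)) (v q) = comp_int (l i) (m q) y 1 (v q)"
        by (auto simp: comp_int_eq)
      ultimately show ?thesis using True i' kill fin q by (simp add: dot_insert two)
    next
      case False
      have "dot J m (l i) (w \<kappa>) (\<lambda>j. ?c j \<kappa>) v = dot J m (l i) (w \<kappa>) (\<lambda>j. c j \<kappa>) v"
        by (rule dot_cong) (use q False in auto)
      moreover have "\<dots> = 0"
        using IH False \<kappa> unfolding coker_family_def by auto
      ultimately show ?thesis using False i' fin q by (simp add: dot_insert)
    qed
  next
    fix z h assume h: "h \<in> vecs (insert q J) m z"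
      and 0: "\<forall>i'\<in>{i}. dot (insert q J) m (l i') z h v = 0"
    define h' where "h' = h(q := 0)"
    have h': "h' \<in> vecs J m z" using h by (auto simp: vecs_def h'_def)
    have h0: "dot J m (l i) z h' v = comp_int (l i) (m q) z (h q) (v q)"
    proof -
      have "dot J m (l i) z h' v = dot J m (l i) z h v" 
        by (rule dot_cong) (use q in \<open>auto simp: h'_def\<close>)
      moreover have "comp_int (l i) (m q) z (h q) (v q) + dot J m (l i) z h v = 0"
        using 0 unfolding dot_insert[OF fin q] by blast
      ultimately show ?thesis unfolding two by metis
    qed
    have yz: "arrow y z" if "h q = 1"
      by (rule ext[OF h']) (use h that h0 in \<open>auto simp: vecs_def\<close>)
    have hq: "comp_int (m q) y z (h q) 1 = h q"
      using yz quot[of z] by (cases "h q = 0") (auto simp: comp_int_eq)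
    \<comment> \<open>The correction of \<open>h\<close> on the old target by the part that factors through \<open>y\<close>.\<close>
    define g where "g = (\<lambda>j. h' j + comp_int (m j) y z (h q) (r j))"
    have g: "g \<in> vecs J m z"
    proof -
      have "h' j = 1 \<or> comp_int (m j) y z (h q) (r j) = 1" if "g j = 1" for j
        using that unfolding g_def by (cases "h' j") simp_all
      thus ?thesis using h' r unfolding vecs_def comp_int_of_bool by fastforce
    qed
    have "dot J m (l i) z g v = 0"
    proof -
      have "dot J m (l i) z (\<lambda>j. comp_int (m j) y z (h q) (r j)) v
          = comp_int (l i) y z (h q) (dot J m (l i) y r v)"
        by (simp add: dot_def comp_int_sum comp_int_assoc)
      also have "\<dots> = comp_int (l i) (m q) z (h q) (v q)"
        by (simp only: kill comp_int_assoc hq)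
      finally show ?thesis unfolding g_def dot_add h0 by (simp only: two)
    qed
    hence "\<exists>!u. u \<in> vecs J w z \<and> (\<forall>j\<in>J. g j = dot J w (m j) z u (c j))"
      by (intro coker_family_factor[OF IH g]) simp
    then obtain u where u: "u \<in> vecs J w z" "\<And>j. j \<in> J \<Longrightarrow> g j = dot J w (m j) z u (c j)"
      and uu: "\<And>u'. u' \<in> vecs J w z \<Longrightarrow> (\<And>j. j \<in> J \<Longrightarrow> g j = dot J w (m j) z u' (c j)) \<Longrightarrow> u' = u"
      by metis
    have gh: "g j = t \<longleftrightarrow> h j = comp_int (m j) y z (h q) (r j) + t" if "j \<in> J" for j t
      using q that unfolding g_def h'_def
      by (cases "h j"; cases "comp_int (m j) y z (h q) (r j)"; cases t) auto
    have uq: "u q = 0" using u q by (auto simp: vecs_def)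
    show "\<exists>!u. u \<in> vecs (insert q J) ?w z \<and>
        (\<forall>j\<in>insert q J. h j = dot (insert q J) ?w (m j) z u (?c j))"
    proof (rule ex1I[of _ "u(q := h q)"], intro conjI ballI)
      show *: "u(q := h q) \<in> vecs (insert q J) ?w z"
        using u yz by (auto simp: vecs_def)
      fix j assume "j \<in> insert q J"
      then consider "j = q" | "j \<in> J" by auto
      thus "h j = dot (insert q J) ?w (m j) z (u(q := h q)) (?c j)"
      proof cases
        case 1
        show ?thesis unfolding 1 c'q[OF *] by simp
      next
        case 2
        have "u(q := 0) = u" using uq by auto
        thus ?thesis using u(2)[OF 2] unfolding c'j[OF 2] gh[OF 2] by (simp only: fun_upd_same fun_upd_upd)
      qed
    next
      fix u' assume u': "u' \<in> vecs (insert q J) ?w z \<and>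
        (\<forall>j\<in>insert q J. h j = dot (insert q J) ?w (m j) z u' (?c j))"
      hence "h q = dot (insert q J) ?w (m q) z u' (?c q)" by (elim conjE bspec) (rule insertI1)
      hence q': "u' q = h q" unfolding c'q[OF conjunct1[OF u']] by (rule sym)
      have "u'(q := 0) = u"
      proof (rule uu)
        show "u'(q := 0) \<in> vecs J w z" using u' by (auto simp: vecs_def)
        fix j assume j: "j \<in> J"
        hence "h j = dot (insert q J) ?w (m j) z u' (?c j)" using u' by auto
        thus "g j = dot J w (m j) z (u'(q := 0)) (c j)"
          unfolding c'j[OF j] gh[OF j] q' .
      qed
      thus "u' = u(q := h q)" using q' by (metis fun_upd_triv fun_upd_upd)
    qed
  qed
qed

text \<open>The target intervals are added in the order of their right ends. Let \<open>[c,d]\<close> be the newest one, with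
a nonzero component. If no earlier component is nonzero, then the image of \<open>[a,b]\<close> in \<open>[c,d]\<close> is
divided out and \<open>[b+1,d]\<close> remains. Otherwise let \<open>[c',d']\<close> be an earlier target with nonzero component
and smallest left end. Adding the map from \<open>[c',d']\<close> cancels the image of \<open>[a,b]\<close> in the quotient
\<open>[max c c',d]\<close> of \<open>[c,d]\<close>, and this quotient is the new summand.\<close>

lemma coker_family_single:
  assumes fin: "finite J" and li: "l i = (a, b)"
    and v: "\<And>j. j \<in> J \<Longrightarrow> v j = 1 \<Longrightarrow> arrow (a, b) (m j)"
  shows "\<exists>w c. coker_family {i} l J m (\<lambda>_. v) J w c \<and>
     (\<forall>j\<in>J. w j = m j \<or> v j = 1 \<and> w j = (b + 1, snd (m j)) \<or>
        v j = 1 \<and> (\<exists>j'\<in>J. v j' = 1 \<and> fst (m j) < fst (m j') \<and> snd (m j') \<le> snd (m j) \<and>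
            w j = (fst (m j'), snd (m j))))"
  using fin v
proof (induction rule: finite_ranking_induct[where f = "\<lambda>j. snd (m j)"])
  case empty
  have "coker_family {i} l {} m (\<lambda>_. v) {} m (\<lambda>_ _. 0)"
    unfolding coker_family_def vecs_def dot_def by (auto intro!: ext)
  thus ?case by blast
next
  case (insert q J)
  obtain w c where wc: "coker_family {i} l J m (\<lambda>_. v) J w c"
    and w: "\<And>j. j \<in> J \<Longrightarrow> w j = m j \<or> v j = 1 \<and> w j = (b + 1, snd (m j)) \<or>
        v j = 1 \<and> (\<exists>j'\<in>J. v j' = 1 \<and> fst (m j) < fst (m j') \<and> snd (m j') \<le> snd (m j) \<and>
            w j = (fst (m j'), snd (m j)))"
    using insert.IH insert.prems by (metis insertCI)
  show ?case
  proof (cases "q \<in> J")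
    case True
    thus ?thesis using wc w by (auto simp: insert_absorb)
  next
    case q: False
    have ar: "arrow (a, b) (m j)" if "j \<in> insert q J" "v j = 1" for j
      using insert.prems that by blast
    have goal: ?thesis if c': "coker_family {i} l (insert q J) m (\<lambda>_. v) (insert q J) (w(q := y)) c'"
      and y: "y = m q \<or> v q = 1 \<and> y = (b + 1, snd (m q)) \<or>
        v q = 1 \<and> (\<exists>j'\<in>J. v j' = 1 \<and> fst (m q) < fst (m j') \<and> snd (m j') \<le> snd (m q) \<and>
            y = (fst (m j'), snd (m q)))" for y c'
    proof -
      have "(w(q := y)) j = m j \<or> v j = 1 \<and> (w(q := y)) j = (b + 1, snd (m j)) \<or>
        v j = 1 \<and> (\<exists>j'\<in>insert q J. v j' = 1 \<and> fst (m j) < fst (m j') \<and> snd (m j') \<le> snd (m j) \<and>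
            (w(q := y)) j = (fst (m j'), snd (m j)))" if "j \<in> insert q J" for j
        using y w[of j] that by (cases "j = q") auto
      thus ?thesis using c' by blast
    qed
    show ?thesis
    proof (cases "v q = 0")
      case True
      show ?thesis
        by (rule goal, rule coker_family_extend[OF insert.hyps(1) q wc, where y = "m q" and r = "\<lambda>_. 0"])
           (use True in \<open>auto simp: vecs_def dot_def arrow_def\<close>)
    next
      case vq: False
      hence vq1: "v q = 1" by simp
      obtain c1 d1 where mq: "m q = (c1, d1)" by (cases "m q")
      have q1: "a \<le> c1" "c1 \<le> b" "b \<le> d1"
        using ar[of q] vq mq by (auto simp: arrow_def)
      show ?thesis
      proof (cases "\<forall>j\<in>J. v j = 0")
        case True
        show ?thesis
        proof (rule goal, rule coker_family_extend[OF insert.hyps(1) q wc, where y = "(b + 1, d1)" and r = "\<lambda>_. 0"])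
          fix z h
          assume "arrow (m q) z" "dot J m (l i) z h v = comp_int (l i) (m q) z 1 (v q)"
          moreover have "dot J m (l i) z h v = 0" by (rule dot_zero) (use True in auto)
          ultimately show "arrow (b + 1, d1) z"
            using q1 by (auto simp: arrow_def comp_int_eq li mq vq1 split: if_splits)
        qed (use q1 in \<open>auto simp: vecs_def dot_def arrow_def mq li comp_int_eq vq\<close>)
      next
        case False
        define N where "N = {j \<in> J. v j = 1}"
        have N: "finite N" "N \<noteq> {}" using False insert.hyps by (auto simp: N_def)
        obtain p where p: "p \<in> N" "\<And>j. j \<in> N \<Longrightarrow> fst (m p) \<le> fst (m j)"
          using arg_min_if_finite[OF N, of "\<lambda>j. fst (m j)"] N
          by (metis arg_min_least)
        obtain c2 d2 where mp: "m p = (c2, d2)" by (cases "m p")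
        have pJ: "p \<in> J" "v p = 1" using p(1) by (auto simp: N_def)
        have p1: "a \<le> c2" "c2 \<le> b" "b \<le> d2"
          using ar[of p] pJ mp by (auto simp: arrow_def)
        have d: "d2 \<le> d1" using insert.hyps(2)[OF pJ(1)] mp mq by auto
        define y where "y = (max c1 c2, d1)"
        show ?thesis
        proof (rule goal, rule coker_family_extend[OF insert.hyps(1) q wc, where y = y and r = "\<lambda>j. of_bool (j = p)"])
          show "(\<lambda>j. of_bool (j = p)) \<in> vecs J m y"
            using pJ p1 q1 d mp by (auto simp: vecs_def y_def arrow_def)
          have "dot (insert p (J - {p})) m (l i) y (\<lambda>j. of_bool (j = p)) v =
             comp_int (l i) (m p) y 1 (v p) + dot (J - {p}) m (l i) y (\<lambda>j. of_bool (j = p)) v"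
            by (subst dot_insert) (use insert.hyps(1) in simp_all)
          hence "dot J m (l i) y (\<lambda>j. of_bool (j = p)) v =
             comp_int (l i) (m p) y 1 (v p) + dot (J - {p}) m (l i) y (\<lambda>j. of_bool (j = p)) v"
            using pJ by (simp only: insert_Diff)
          moreover have "dot (J - {p}) m (l i) y (\<lambda>j. of_bool (j = p)) v = 0"
            by (rule dot_zero) auto
          ultimately show "dot J m (l i) y (\<lambda>j. of_bool (j = p)) v = comp_int (l i) (m q) y 1 (v q)"
            using p1 q1 d by (auto simp: comp_int_eq li mp mq vq1 pJ y_def arrow_def)
        next
          fix z h
          assume h: "h \<in> vecs J m z" "arrow (m q) z"
            and eq: "dot J m (l i) z h v = comp_int (l i) (m q) z 1 (v q)"
          show "arrow y z"
          proof (rule ccontr)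
            assume n: "\<not> arrow y z"
            \<comment> \<open>No earlier target with a nonzero component maps to \<open>z\<close>, so nothing cancels the component at \<open>q\<close>.\<close>
            hence z: "fst z < c2" using h(2) by (auto simp: arrow_def mq y_def)
            hence "comp_int (l i) (m q) z 1 (v q) = 1"
              using h(2) p1 q1 by (auto simp: comp_int_eq li mq vq1 arrow_def)
            hence "dot J m (l i) z h v = 1" using eq by simp
            then obtain j where j: "j \<in> J" "v j = 1" "arrow (m j) z"
              by (auto elim: dot_eq_1E)
            hence "c2 \<le> fst (m j)" using p(2)[of j] mp by (auto simp: N_def)
            thus False using z j(3) by (auto simp: arrow_def)
          qed
        next
          show "y = m q \<or> v q = 1 \<and> y = (b + 1, snd (m q)) \<or>
            v q = 1 \<and> (\<exists>j'\<in>J. v j' = 1 \<and> fst (m q) < fst (m j') \<and> snd (m j') \<le> snd (m q) \<and>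
            y = (fst (m j'), snd (m q)))"
          proof (cases "c1 < c2")
            case True
            thus ?thesis using pJ vq d mp mq by (auto simp: y_def intro!: bexI[of _ p])
          qed (auto simp: y_def mq)
        qed (use q1 p1 in \<open>auto simp: arrow_def mq y_def\<close>)
      qed
    qed
  qed
qed

section \<open>Cokernels that stay in a set of intervals\<close>

(* Indices are pairs; splitting quantifiers over them would spoil the matching of facts. *)
declare split_paired_All [simp del]

lemma coker_family_1D:
  assumes "coker_family I l J m f K k c" "c j \<kappa> = 1"
  shows "j \<in> J" "\<kappa> \<in> K" "arrow (m j) (k \<kappa>)"
  using assms by (auto simp: coker_family_def vecs_def)

lemma coker_family_kill:
  assumes "coker_family I l J m f K k c" "i \<in> I" "\<kappa> \<in> K"
  shows "dot J m (l i) (k \<kappa>) (\<lambda>j. c j \<kappa>) (f i) = 0"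
  using assms by (auto simp: coker_family_def)

text \<open>The labels of zero objects that occur: in the formula \<open>[b+1,d]\<close> for a cokernel, \<open>b = d\<close> is possible.\<close>

definition degenerate :: "nat \<Rightarrow> interval set" where
  "degenerate n = {(b + 1, b) | b. b \<le> n}"

definition coker_stable :: "interval set \<Rightarrow> bool" where
  "coker_stable S \<longleftrightarrow> (\<forall>a b c d. (a, b) \<in> S \<longrightarrow> (c, d) \<in> S \<longrightarrow>
     a \<le> c \<longrightarrow> c \<le> b \<longrightarrow> b < d \<longrightarrow> (b + 1, d) \<in> S)"

text \<open>For nested \<open>[c',d'] \<subset> [c,d]\<close>, the cokernel of the map from \<open>[a,b]\<close> to the sum of both contains
\<open>[c',d]\<close>.\<close>

definition nest_stable :: "interval set \<Rightarrow> bool" where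
  "nest_stable S \<longleftrightarrow> (\<forall>a b c d c' d'. (a, b) \<in> S \<longrightarrow> (c, d) \<in> S \<longrightarrow> (c', d') \<in> S \<longrightarrow>
     a \<le> c \<longrightarrow> c < c' \<longrightarrow> c' \<le> b \<longrightarrow> b \<le> d' \<longrightarrow> d' < d \<longrightarrow> (c', d) \<in> S)"

lemma coker_family_exists:
  assumes "finite I" "finite J" and S: "S \<subseteq> intervals n" "coker_stable S" "nest_stable S"
    and l: "\<And>i. i \<in> I \<Longrightarrow> l i \<in> S" and m: "\<And>j. j \<in> J \<Longrightarrow> m j \<in> S"
    and f: "\<And>i j. i \<in> I \<Longrightarrow> j \<in> J \<Longrightarrow> f i j = 1 \<Longrightarrow> arrow (l i) (m j)"
  shows "\<exists>w c. coker_family I l J m f J w c \<and> (\<forall>j\<in>J. w j \<in> S \<union> degenerate n)"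
  using \<open>finite I\<close> l f
proof (induction I rule: finite_induct)
  case empty
  define c where "c = (\<lambda>j \<kappa>. of_bool (j \<in> J \<and> j = \<kappa> \<and> arrow (m j) (m j)) :: bit)"
  have d: "dot J m (m j) z u (c j) = u j" if "j \<in> J" "u \<in> vecs J m z" for j z u
  proof -
    have "dot (insert j (J - {j})) m (m j) z u (c j) =
      comp_int (m j) (m j) z (u j) (c j j) + dot (J - {j}) m (m j) z u (c j)"
      by (rule dot_insert) (use assms(2) in auto)
    moreover have "dot (J - {j}) m (m j) z u (c j) = 0"
      by (rule dot_zero) (auto simp: c_def)
    moreover have "comp_int (m j) (m j) z (u j) (c j j) = u j"
      using that by (cases "u j") (auto simp: comp_int_of_bool c_def vecs_def arrow_def)
    ultimately show ?thesis using that by (simp add: insert_absorb)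
  qed
  have "coker_family {} l J m f J m c"
    unfolding coker_family_def
  proof (intro conjI allI ballI impI)
    fix z h assume h: "h \<in> vecs J m z"
    show "\<exists>!u. u \<in> vecs J m z \<and> (\<forall>j\<in>J. h j = dot J m (m j) z u (c j))"
    proof (rule ex1I[of _ h])
      fix u assume u: "u \<in> vecs J m z \<and> (\<forall>j\<in>J. h j = dot J m (m j) z u (c j))"
      hence "\<And>j. j \<in> J \<Longrightarrow> h j = u j" using d by metis
      moreover have "h j = 0" "u j = 0" if "j \<notin> J" for j
        using u h that by (auto simp: vecs_def)
      ultimately show "u = h" by (metis ext)
    qed (use h d in auto)
  qed (auto simp: vecs_def c_def)
  thus ?case using m by blast
next
  case (insert i I)
  obtain w c where wc: "coker_family I l J m f J w c" and w: "\<And>j. j \<in> J \<Longrightarrow> w j \<in> S \<union> degenerate n"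
    using insert.IH insert.prems by (metis insertCI)
  obtain a b where li: "l i = (a, b)" by (cases "l i")
  have S': "(x, y) \<in> S \<Longrightarrow> x \<le> y \<and> y \<le> n" for x y
    using S(1) by (auto simp: intervals_def)
  have ab: "(a, b) \<in> S" using insert.prems(1)[of i] li by auto
  define v where "v = (\<lambda>\<kappa>. dot J m (l i) (w \<kappa>) (\<lambda>j. c j \<kappa>) (f i))"
  have v: "arrow (a, b) (w j)" if "v j = 1" for j
    using that li unfolding v_def by (auto dest: dot_eq_1D)
  obtain w' c' where wc': "coker_family {i} l J w (\<lambda>_. v) J w' c'"
    and w': "\<And>j. j \<in> J \<Longrightarrow> w' j = w j \<or> v j = 1 \<and> w' j = (b + 1, snd (w j)) \<or>
        v j = 1 \<and> (\<exists>j'\<in>J. v j' = 1 \<and> fst (w j) < fst (w j') \<and> snd (w j') \<le> snd (w j) \<and>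
            w' j = (fst (w j'), snd (w j)))"
    using coker_family_single[where l = l and i = i and v = v and m = w, OF assms(2) li v] by metis
  have wS: "w j \<in> S \<and> a \<le> fst (w j) \<and> fst (w j) \<le> b \<and> b \<le> snd (w j)" if "j \<in> J" "v j = 1" for j
    using w[OF that(1)] v[OF that(2)] by (auto simp: degenerate_def arrow_def)
  have "w' j \<in> S \<union> degenerate n" if j: "j \<in> J" for j
    using w'[OF j]
  proof (elim disjE conjE bexE)
    assume "w' j = w j" thus ?thesis using w[OF j] by simp
  next
    assume 1: "v j = 1" "w' j = (b + 1, snd (w j))"
    obtain c d where cd: "w j = (c, d)" by (cases "w j")
    have cd': "(c, d) \<in> S" "a \<le> c" "c \<le> b" "b \<le> d" using wS[OF j 1(1)] cd by auto
    show ?thesis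
    proof (cases "b = d")
      case True
      thus ?thesis using cd 1 S'[OF cd'(1)] by (auto simp: degenerate_def)
    next
      case False
      hence "(b + 1, d) \<in> S" using S(2) ab cd' unfolding coker_stable_def by (meson le_neq_implies_less)
      thus ?thesis using cd 1 by auto
    qed
  next
    fix j' assume 1: "v j = 1" and j': "j' \<in> J" "v j' = 1" "fst (w j) < fst (w j')" "snd (w j') \<le> snd (w j)"
      "w' j = (fst (w j'), snd (w j))"
    obtain c d where cd: "w j = (c, d)" by (cases "w j")
    obtain c' d' where cd': "w j' = (c', d')" by (cases "w j'")
    show ?thesis
    proof (cases "d' = d")
      case True
      thus ?thesis using j' cd cd' wS[OF j'(1,2)] by auto
    next
      case False
      have "(c', d) \<in> S" using S(3) ab wS[OF j 1] wS[OF j'(1,2)] j'(3,4) False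
        unfolding nest_stable_def cd cd' fst_conv snd_conv by (meson le_neq_implies_less)
      thus ?thesis using cd cd' j' by auto
    qed
  qed
  thus ?case using coker_family_insert[OF wc wc'[unfolded v_def]] by blast
qed

text \<open>All maps to and from degenerate labels vanish, so that these summands can be omitted.\<close>

lemma coker_family_reindex:
  assumes cok: "coker_family I l J m f K k c" and fin: "finite K"
    and phi: "bij_betw \<phi> K' {\<kappa> \<in> K. fst (k \<kappa>) \<le> snd (k \<kappa>)}"
  shows "coker_family I l J m f K' (k \<circ> \<phi>) (\<lambda>j p. if p \<in> K' then c j (\<phi> p) else 0)"
    (is "coker_family _ _ _ _ _ _ _ ?c")
proof -
  let ?K = "{\<kappa> \<in> K. fst (k \<kappa>) \<le> snd (k \<kappa>)}"
  have dK: "dot K k x z u v = dot K' (k \<circ> \<phi>) x z (u \<circ> \<phi>) (v \<circ> \<phi>)" for x z u v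
  proof -
    have "dot K k x z u v = dot ?K k x z u v"
      unfolding dot_def by (rule sum.mono_neutral_right) (use fin in \<open>auto simp: comp_int_eq arrow_def\<close>)
    also have "\<dots> = dot K' (k \<circ> \<phi>) x z (u \<circ> \<phi>) (v \<circ> \<phi>)"
      unfolding dot_def o_def by (rule sum.reindex_bij_betw[OF phi, symmetric])
    finally show ?thesis .
  qed
  have inj: "inj_on \<phi> K'" and im: "\<phi> ` K' = ?K" using phi by (auto simp: bij_betw_def)
  have pK: "\<phi> p \<in> K" if "p \<in> K'" for p using im that by auto
  show ?thesis
    unfolding coker_family_def
  proof (intro conjI allI ballI impI)
    fix p show "(\<lambda>j. ?c j p) \<in> vecs J m ((k \<circ> \<phi>) p)"
      using cok by (auto simp: coker_family_def vecs_def)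
  next
    fix i p assume "i \<in> I" "p \<in> K'"
    thus "dot J m (l i) ((k \<circ> \<phi>) p) (\<lambda>j. ?c j p) (f i) = 0"
      using cok pK by (auto simp: coker_family_def)
  next
    fix z h assume h: "h \<in> vecs J m z" "\<forall>i\<in>I. dot J m (l i) z h (f i) = 0"
    obtain u where u: "u \<in> vecs K k z" "\<And>j. j \<in> J \<Longrightarrow> h j = dot K k (m j) z u (c j)"
      and uu: "\<And>u'. u' \<in> vecs K k z \<Longrightarrow> (\<And>j. j \<in> J \<Longrightarrow> h j = dot K k (m j) z u' (c j)) \<Longrightarrow> u' = u"
      using coker_family_factor[OF cok h(1)] h(2) by metis
    have dc: "dot K' (k \<circ> \<phi>) x z w (?c j) = dot K' (k \<circ> \<phi>) x z w (c j \<circ> \<phi>)" for x w j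
      by (rule dot_cong) auto
    show "\<exists>!w. w \<in> vecs K' (k \<circ> \<phi>) z \<and> (\<forall>j\<in>J. h j = dot K' (k \<circ> \<phi>) (m j) z w (?c j))"
    proof (rule ex1I[of _ "\<lambda>p. if p \<in> K' then u (\<phi> p) else 0"], intro conjI ballI)
      show "(\<lambda>p. if p \<in> K' then u (\<phi> p) else 0) \<in> vecs K' (k \<circ> \<phi>) z"
        using u(1) by (auto simp: vecs_def)
      fix j assume "j \<in> J"
      hence "h j = dot K' (k \<circ> \<phi>) (m j) z (u \<circ> \<phi>) (c j \<circ> \<phi>)" using u(2) dK by metis
      also have "\<dots> = dot K' (k \<circ> \<phi>) (m j) z (\<lambda>p. if p \<in> K' then u (\<phi> p) else 0) (c j \<circ> \<phi>)"
        by (rule dot_cong) auto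
      finally show "h j = dot K' (k \<circ> \<phi>) (m j) z (\<lambda>p. if p \<in> K' then u (\<phi> p) else 0) (?c j)"
        unfolding dc .
    next
      fix w assume w: "w \<in> vecs K' (k \<circ> \<phi>) z \<and> (\<forall>j\<in>J. h j = dot K' (k \<circ> \<phi>) (m j) z w (?c j))"
      define u' where "u' = (\<lambda>\<kappa>. if \<kappa> \<in> ?K then w (inv_into K' \<phi> \<kappa>) else 0)"
      have wu: "w p = u' (\<phi> p)" if "p \<in> K'" for p
        using that inj im by (auto simp: u'_def)
      have "u' = u"
      proof (rule uu)
        have "inv_into K' \<phi> \<kappa> \<in> K' \<and> \<phi> (inv_into K' \<phi> \<kappa>) = \<kappa>" if "\<kappa> \<in> ?K" for \<kappa>
          using that im by (metis (no_types, lifting) f_inv_into_f inv_into_into)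
        thus "u' \<in> vecs K k z" using w by (force simp: vecs_def u'_def)
        fix j assume j: "j \<in> J"
        have "dot K k (m j) z u' (c j) = dot K' (k \<circ> \<phi>) (m j) z w (c j \<circ> \<phi>)"
          unfolding dK by (rule dot_cong) (auto simp: wu)
        thus "h j = dot K k (m j) z u' (c j)" using w j unfolding dc by metis
      qed
      thus "w = (\<lambda>p. if p \<in> K' then u (\<phi> p) else 0)"
        using wu w by (auto simp: vecs_def fun_eq_iff)
    qed
  qed (auto split: if_splits)
qed

lemma multiset_of_family:
  fixes k :: "'a \<Rightarrow> interval"
  assumes "finite K"
  shows "\<exists>C \<phi>. bij_betw \<phi> (idx C) K \<and> (\<forall>p\<in>idx C. k (\<phi> p) = fst p) \<and> set_mset C = k ` K"
proof -
  define C where "C = image_mset k (mset_set K)"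
  have cnt: "count C x = card {\<kappa> \<in> K. k \<kappa> = x}" for x
    using assms by (auto simp: C_def count_image_mset' intro!: arg_cong[where f = card])
  have "\<exists>h. bij_betw h {0..<count C x} {\<kappa> \<in> K. k \<kappa> = x}" for x
    unfolding cnt by (rule ex_bij_betw_nat_finite) (use assms in auto)
  then obtain h where h: "\<And>x. bij_betw (h x) {0..<count C x} {\<kappa> \<in> K. k \<kappa> = x}" by metis
  have "bij_betw (\<lambda>(x, i). h x i) (idx C) K"
    unfolding bij_betw_def
  proof
    have hk: "k (h x i) = x \<and> h x i \<in> K" if "i < count C x" for x i
      using bij_betwE[OF h[of x]] that by auto
    show "inj_on (\<lambda>(x, i). h x i) (idx C)"
    proof (rule inj_onI, clarify)
      fix x i y j assume "(x, i) \<in> idx C" "(y, j) \<in> idx C" and e: "h x i = h y j"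
      hence ij: "i < count C x" "j < count C y" by (auto simp: idx_def)
      hence "x = y" using hk e by metis
      thus "x = y \<and> i = j" using h[of x] e ij by (auto simp: bij_betw_def inj_on_def)
    qed
    show "(\<lambda>(x, i). h x i) ` idx C = K"
    proof
      show "(\<lambda>(x, i). h x i) ` idx C \<subseteq> K" using hk by (auto simp: idx_def)
      show "K \<subseteq> (\<lambda>(x, i). h x i) ` idx C"
      proof
        fix \<kappa> assume "\<kappa> \<in> K"
        hence "\<kappa> \<in> h (k \<kappa>) ` {0..<count C (k \<kappa>)}" using h[of "k \<kappa>"] by (auto simp: bij_betw_def)
        thus "\<kappa> \<in> (\<lambda>(x, i). h x i) ` idx C" by (force simp: idx_def)
      qed
    qed
  qed
  moreover have "\<forall>p\<in>idx C. k ((\<lambda>(x, i). h x i) p) = fst p"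
    using bij_betwE[OF h] by (force simp: idx_def)
  ultimately show ?thesis using assms by (intro exI conjI) (auto simp: C_def)
qed

section \<open>Kernels and cokernels in the category of multisets\<close>

lemma hom_iff: "f \<in> hom M N \<longleftrightarrow> (\<forall>p q. f p q = 1 \<longrightarrow> p \<in> idx M \<and> q \<in> idx N \<and> arrow (fst p) (fst q))"
proof -
  have "f p q \<in> (if p \<in> idx M \<and> q \<in> idx N then hom_int (fst p) (fst q) else {0}) \<longleftrightarrow>
      (f p q = 1 \<longrightarrow> p \<in> idx M \<and> q \<in> idx N \<and> arrow (fst p) (fst q))" for p q
    by (cases "f p q"; cases "p \<in> idx M"; cases "q \<in> idx N") (simp_all add: hom_int_iff)
  thus ?thesis unfolding hom_def by (simp only: mem_Collect_eq)
qed

lemma hom_1D: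
  assumes "f \<in> hom M N" "f p q = 1"
  shows "p \<in> idx M" "q \<in> idx N" "arrow (fst p) (fst q)"
  using assms unfolding hom_iff by blast+

lemma hom_0:
  assumes "f \<in> hom M N" "p \<notin> idx M \<or> q \<notin> idx N"
  shows "f p q = 0"
  using assms hom_1D[of f M N p q] by (cases "f p q") auto

lemma mcomp_dot: "mcomp N g f p r = dot (idx N) fst (fst p) (fst r) (\<lambda>q. g q r) (f p)"
  by (simp add: mcomp_def dot_def)

lemma is_cokernelI:
  assumes MN: "M \<in> obj n" "N \<in> obj n" and C: "C \<in> obj n" and f: "f \<in> hom M N"
    and cok: "coker_family (idx M) fst (idx N) fst f (idx C) fst c"
  shows "is_cokernel n M N f C c"
  unfolding is_cokernel_def
proof (intro conjI ballI impI MN C f)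
  show c: "c \<in> hom N C" using coker_family_1D[OF cok] unfolding hom_iff by blast
  show "mcomp N c f = mzero"
  proof (intro ext)
    fix p r
    show "mcomp N c f p r = mzero p r"
    proof (cases "p \<in> idx M \<and> r \<in> idx C")
      case True
      thus ?thesis using coker_family_kill[OF cok] by (simp add: mcomp_dot mzero_def)
    next
      case False
      have "mcomp N c f p r = 0"
        unfolding mcomp_dot by (rule dot_zero) (use False hom_0[OF c] hom_0[OF f] in blast)
      thus ?thesis by (simp add: mzero_def)
    qed
  qed
  fix L h assume L: "L \<in> obj n" and h: "h \<in> hom N L" and 0: "mcomp N h f = mzero"
  have "\<exists>!u. u \<in> vecs (idx C) fst (fst r) \<and>
      (\<forall>q\<in>idx N. h q r = dot (idx C) fst (fst q) (fst r) u (c q))" for r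
  proof (rule coker_family_factor[OF cok])
    show "(\<lambda>q. h q r) \<in> vecs (idx N) fst (fst r)" using hom_1D[OF h] by (auto simp: vecs_def)
    fix p show "dot (idx N) fst (fst p) (fst r) (\<lambda>q. h q r) (f p) = 0"
      using fun_cong[OF fun_cong[OF 0], of p r] by (simp add: mcomp_dot mzero_def)
  qed
  then obtain u where u: "\<And>r. u r \<in> vecs (idx C) fst (fst r)"
      "\<And>r q. q \<in> idx N \<Longrightarrow> h q r = dot (idx C) fst (fst q) (fst r) (u r) (c q)"
    and uu: "\<And>r w. w \<in> vecs (idx C) fst (fst r) \<Longrightarrow>
       (\<And>q. q \<in> idx N \<Longrightarrow> h q r = dot (idx C) fst (fst q) (fst r) w (c q)) \<Longrightarrow> w = u r"
    by metis
  have out: "mcomp C v c q r = 0" if "q \<notin> idx N \<or> r \<notin> idx L" "v \<in> hom C L" for v q r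
    unfolding mcomp_dot by (rule dot_zero) (use that hom_0[OF c] hom_0[OF that(2)] in blast)
  have u0: "u r = (\<lambda>_. 0)" if "r \<notin> idx L" for r
  proof (rule sym, rule uu)
    fix q have "h q r = 0" using hom_0[OF h] that by blast
    thus "h q r = dot (idx C) fst (fst q) (fst r) (\<lambda>_. 0) (c q)" by (simp add: dot_def)
  qed (simp add: vecs_def)
  show "\<exists>!u. u \<in> hom C L \<and> mcomp C u c = h"
  proof (rule ex1I[of _ "\<lambda>s r. u r s"], intro conjI ext)
    show uh: "(\<lambda>s r. u r s) \<in> hom C L"
      using u(1) u0 unfolding hom_iff vecs_def by (metis (mono_tags, lifting) mem_Collect_eq zero_neq_one)
    fix q r show "mcomp C (\<lambda>s r. u r s) c q r = h q r"
    proof (cases "q \<in> idx N")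
      case True
      thus ?thesis using u(2) by (simp add: mcomp_dot)
    next
      case False
      hence "h q r = 0" using hom_0[OF h] False by blast
      thus ?thesis using out uh False by simp
    qed
  next
    fix v assume v: "v \<in> hom C L \<and> mcomp C v c = h"
    have "(\<lambda>s. v s r) = u r" for r
    proof (rule uu)
      show "(\<lambda>s. v s r) \<in> vecs (idx C) fst (fst r)" using v by (auto simp: vecs_def dest: hom_1D)
      fix q show "h q r = dot (idx C) fst (fst q) (fst r) (\<lambda>s. v s r) (c q)"
        using v by (auto simp: mcomp_dot)
    qed
    thus "v = (\<lambda>s r. u r s)" by (metis (no_types))
  qed
qed

definition reflect :: "nat \<Rightarrow> interval \<Rightarrow> interval" where
  "reflect n x = (n + 1 - snd x, n + 1 - fst x)"

text \<open>The range on which \<open>reflect n\<close> is an involution that reverses arrows. It contains the intervals and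
the degenerate labels.\<close>

definition bounded_label :: "nat \<Rightarrow> interval \<Rightarrow> bool" where
  "bounded_label n x \<longleftrightarrow> fst x \<le> n + 1 \<and> snd x \<le> n + 1"

lemma arrow_reflect:
  "bounded_label n x \<Longrightarrow> bounded_label n y \<Longrightarrow> arrow (reflect n x) (reflect n y) = arrow y x"
  by (auto simp: arrow_def reflect_def bounded_label_def)

lemma dot_reflect:
  assumes "bounded_label n x" "bounded_label n z" "\<And>j. j \<in> J \<Longrightarrow> bounded_label n (m j)"
  shows "dot J (reflect n \<circ> m) (reflect n x) (reflect n z) h v = dot J m z x v h"
  unfolding dot_def
  by (rule sum.cong) (use assms in \<open>auto simp: comp_int_of_bool arrow_reflect of_bool_eq_iff\<close>)

lemma idx_label: "p \<in> idx M \<Longrightarrow> fst p \<in># M"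
  unfolding idx_def by (cases p) (simp add: count_inI)

lemma bounded_interval: "x \<in> intervals n \<Longrightarrow> bounded_label n x"
  by (auto simp: intervals_def bounded_label_def)

lemma bounded_idx: "M \<in> obj n \<Longrightarrow> p \<in> idx M \<Longrightarrow> bounded_label n (fst p)"
  unfolding obj_def by (blast intro: bounded_interval dest: idx_label)

text \<open>Reflected labels and transposed matrices turn the universal property of a kernel into that of a
cokernel.\<close>

lemma is_kernelI:
  assumes M: "M \<in> obj n" and N: "N \<in> obj n" and K: "K \<in> obj n" and f: "f \<in> hom M N"
    and cok: "coker_family (idx N) (reflect n \<circ> fst) (idx M) (reflect n \<circ> fst) (\<lambda>q p. f p q)
                (idx K) (reflect n \<circ> fst) (\<lambda>p s. k s p)"
  shows "is_kernel n M N f K k"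
  unfolding is_kernel_def
proof (intro conjI ballI impI M N K f)
  note bd = bounded_idx[OF M] bounded_idx[OF N] bounded_idx[OF K]
  show k: "k \<in> hom K M"
    unfolding hom_iff
  proof (intro allI impI conjI)
    fix s p assume 1: "k s p = 1"
    show *: "s \<in> idx K" "p \<in> idx M" using coker_family_1D[OF cok 1] by auto
    have "arrow (reflect n (fst p)) (reflect n (fst s))"
      using coker_family_1D[OF cok 1] by simp
    thus "arrow (fst s) (fst p)" using * by (simp add: bd arrow_reflect)
  qed
  show "mcomp M f k = mzero"
  proof (intro ext)
    fix s q
    show "mcomp M f k s q = mzero s q"
    proof (cases "s \<in> idx K \<and> q \<in> idx N")
      case True
      hence "dot (idx M) (reflect n \<circ> fst) (reflect n (fst q)) (reflect n (fst s)) (k s) (\<lambda>p. f p q) = 0"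
        using coker_family_kill[OF cok] by simp
      thus ?thesis using True by (simp add: bd mcomp_dot mzero_def dot_reflect)
    next
      case False
      have "mcomp M f k s q = 0"
        unfolding mcomp_dot by (rule dot_zero) (use False hom_0[OF k] hom_0[OF f] in blast)
      thus ?thesis by (simp add: mzero_def)
    qed
  qed
  fix L h assume L: "L \<in> obj n" and h: "h \<in> hom L M" and 0: "mcomp M f h = mzero"
  have ex: "\<exists>!u. u \<in> vecs (idx K) (reflect n \<circ> fst) (reflect n (fst r)) \<and>
      (\<forall>q\<in>idx M. h r q = dot (idx K) (reflect n \<circ> fst) ((reflect n \<circ> fst) q) (reflect n (fst r)) u (\<lambda>s. k s q))"
    if r: "r \<in> idx L" for r
  proof (rule coker_family_factor[OF cok])
    show "h r \<in> vecs (idx M) (reflect n \<circ> fst) (reflect n (fst r))"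
      unfolding vecs_def using hom_1D[OF h, of r] by (simp add: bd bounded_idx[OF L] arrow_reflect)
    fix p assume p: "p \<in> idx N"
    show "dot (idx M) (reflect n \<circ> fst) ((reflect n \<circ> fst) p) (reflect n (fst r)) (h r) (\<lambda>q. f q p) = 0"
      using fun_cong[OF fun_cong[OF 0], of r p] p r
      by (simp add: bd bounded_idx[OF L] mcomp_dot mzero_def dot_reflect)
  qed
  have "\<exists>!u. u \<in> vecs (idx K) (reflect n \<circ> fst) (reflect n (fst r)) \<and>
      (\<forall>q\<in>idx M. h r q = dot (idx K) fst (fst r) (fst q) (\<lambda>s. k s q) u)" if r: "r \<in> idx L" for r
    using ex[OF r] by (simp add: bd bounded_idx[OF L r] dot_reflect cong: conj_cong ball_cong)
  then obtain u where u: "\<And>r. r \<in> idx L \<Longrightarrow> u r \<in> vecs (idx K) (reflect n \<circ> fst) (reflect n (fst r))"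
      "\<And>r q. r \<in> idx L \<Longrightarrow> q \<in> idx M \<Longrightarrow> h r q = dot (idx K) fst (fst r) (fst q) (\<lambda>s. k s q) (u r)"
    and uu: "\<And>r w. r \<in> idx L \<Longrightarrow> w \<in> vecs (idx K) (reflect n \<circ> fst) (reflect n (fst r)) \<Longrightarrow>
       (\<And>q. q \<in> idx M \<Longrightarrow> h r q = dot (idx K) fst (fst r) (fst q) (\<lambda>s. k s q) w) \<Longrightarrow> w = u r"
    by metis
  have out: "mcomp K k v r q = 0" if "q \<notin> idx M \<or> r \<notin> idx L" "v \<in> hom L K" for v q r
    unfolding mcomp_dot by (rule dot_zero) (use that hom_0[OF k] hom_0[OF that(2)] in blast)
  define u' where "u' = (\<lambda>r s. if r \<in> idx L then u r s else 0)"
  show "\<exists>!u. u \<in> hom L K \<and> mcomp K k u = h"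
  proof (rule ex1I[of _ u'], intro conjI ext)
    show uh: "u' \<in> hom L K"
      unfolding hom_iff
    proof (intro allI impI)
      fix r s assume "u' r s = 1"
      hence r: "r \<in> idx L" and "u r s = 1" by (auto simp: u'_def split: if_splits)
      hence "s \<in> idx K" "arrow (reflect n (fst s)) (reflect n (fst r))" using u(1)[OF r] by (auto simp: vecs_def)
      thus "r \<in> idx L \<and> s \<in> idx K \<and> arrow (fst r) (fst s)"
        using r by (simp add: bd bounded_idx[OF L] arrow_reflect)
    qed
    fix r q show "mcomp K k u' r q = h r q"
    proof (cases "q \<in> idx M \<and> r \<in> idx L")
      case True
      thus ?thesis using u(2) by (simp add: mcomp_dot u'_def)
    next
      case False
      hence "h r q = 0" using hom_0[OF h] False by blast
      thus ?thesis using out uh False by simp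
    qed
  next
    fix v assume v: "v \<in> hom L K \<and> mcomp K k v = h"
    have "v r = u r" if r: "r \<in> idx L" for r
    proof (rule uu[OF r])
      show "v r \<in> vecs (idx K) (reflect n \<circ> fst) (reflect n (fst r))"
        unfolding vecs_def using hom_1D[OF conjunct1[OF v], of r] r by (simp add: bd bounded_idx[OF L] arrow_reflect)
      fix q show "h r q = dot (idx K) fst (fst r) (fst q) (\<lambda>s. k s q) (v r)"
        using v by (auto simp: mcomp_dot)
    qed
    moreover have "v r s = 0" if "r \<notin> idx L" for r s
      using v that hom_0 by blast
    ultimately show "v = u'" by (auto simp: u'_def fun_eq_iff)
  qed
qed

section \<open>Subcategories as sets of intervals\<close>

lemma idx_first: "x \<in># M \<Longrightarrow> (x, 0) \<in> idx M"
  by (simp add: idx_def)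

lemma idx_single: "idx {#x#} = {(x, 0)}"
  by (auto simp: idx_def split: if_splits)

lemma finite_idx: "finite (idx M)"
proof -
  have "idx M = (SIGMA x:set_mset M. {..<count M x})"
    by (auto simp: idx_def count_inI)
  thus ?thesis by simp
qed

lemma arrow_refl: "x \<in> intervals n \<Longrightarrow> arrow x x"
  by (auto simp: intervals_def arrow_def)

lemma arrow_antisym: "arrow x y \<Longrightarrow> arrow y x \<Longrightarrow> x = y"
  by (auto simp: arrow_def prod_eq_iff)

lemma mid_hom: "M \<in> obj n \<Longrightarrow> mid M \<in> hom M M"
  unfolding hom_iff mid_def obj_def by (auto intro: arrow_refl dest: idx_label split: if_splits)

lemma mcomp_assoc: "mcomp P h (mcomp N g f) = mcomp N (mcomp P h g) f"
  by (intro ext) (simp add: mcomp_dot dot_assoc mcomp_dot[abs_def])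

lemma mcomp_hom:
  assumes "f \<in> hom M N" "g \<in> hom N P"
  shows "mcomp N g f \<in> hom M P"
  unfolding hom_iff mcomp_dot
  by (intro allI impI) (auto elim!: dot_eq_1E dest: hom_1D[OF assms(1)] hom_1D[OF assms(2)])

lemma mcomp_mid_left:
  assumes N: "N \<in> obj n" and f: "f \<in> hom M N"
  shows "mcomp N (mid N) f = f"
proof (intro ext)
  fix p r
  have *: "comp_int (fst p) (fst q) (fst r) (mid N q r) (f p q) = (if q = r then f p r else 0)"
    if "q \<in> idx N" for q
    using that hom_1D[OF f, of p q] arrow_refl[of "fst q" n] N idx_label[OF that]
    by (cases "f p q") (auto simp: comp_int_of_bool mid_def obj_def)
  have "mcomp N (mid N) f p r = (\<Sum>q\<in>idx N. if q = r then f p r else 0)"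
    unfolding mcomp_def using * by (rule sum.cong[OF refl])
  also have "\<dots> = f p r"
    using finite_idx hom_0[OF f, of p r] by (simp add: sum.delta)
  finally show "mcomp N (mid N) f p r = f p r" .
qed

lemma mcomp_mid_right:
  assumes M: "M \<in> obj n" and f: "f \<in> hom M N"
  shows "mcomp M f (mid M) = f"
proof (intro ext)
  fix p r
  have *: "comp_int (fst p) (fst q) (fst r) (f q r) (mid M p q) = (if q = p then f p r else 0)"
    if "q \<in> idx M" for q
    using that hom_1D[OF f, of q r] arrow_refl[of "fst q" n] M idx_label[OF that]
    by (cases "f q r") (auto simp: comp_int_of_bool mid_def obj_def)
  have "mcomp M f (mid M) p r = (\<Sum>q\<in>idx M. if q = p then f p r else 0)"
    unfolding mcomp_def using * by (rule sum.cong[OF refl])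
  also have "\<dots> = f p r"
    using finite_idx hom_0[OF f, of p r] by (simp add: sum.delta)
  finally show "mcomp M f (mid M) p r = f p r" .
qed

text \<open>The part of the Krull-Schmidt theorem that the proof needs: the diagonal entry of an identity at a
summand \<open>x\<close> is a sum of composites \<open>x \<rightarrow> y \<rightarrow> x\<close>, and these are zero unless \<open>y = x\<close>.\<close>

lemma retract_support:
  assumes "mcomp N g f = mid M"
  shows "set_mset M \<subseteq> set_mset N"
proof
  fix x assume "x \<in># M"
  hence "(x, 0) \<in> idx M" by (rule idx_first)
  hence "dot (idx N) fst x x (\<lambda>q. g q (x, 0)) (f (x, 0)) = 1"
    using fun_cong[OF fun_cong[OF assms], of "(x, 0)" "(x, 0)"] by (simp add: mcomp_dot mid_def)
  then obtain q where "q \<in> idx N" "arrow x (fst q)" "arrow (fst q) x" by (rule dot_eq_1E)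
  thus "x \<in># N" using arrow_antisym idx_label by metis
qed

lemma cokernel_support:
  assumes 1: "is_cokernel n M N f C c" and 2: "is_cokernel n M N f C' c'"
  shows "set_mset C \<subseteq> set_mset C'"
proof -
  have C: "C \<in> obj n" "c \<in> hom N C" "mcomp N c f = mzero"
    and C': "C' \<in> obj n" "c' \<in> hom N C'" "mcomp N c' f = mzero"
    using assms by (auto simp: is_cokernel_def)
  have "\<exists>u. u \<in> hom C C' \<and> mcomp C u c = c'"
    using 1 C' unfolding is_cokernel_def by blast
  then obtain u where u: "u \<in> hom C C'" "mcomp C u c = c'" by blast
  have "\<exists>u. u \<in> hom C' C \<and> mcomp C' u c' = c"
    using 2 C unfolding is_cokernel_def by blast
  then obtain u' where u': "u' \<in> hom C' C" "mcomp C' u' c' = c" by blast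
  have "\<exists>!v. v \<in> hom C C \<and> mcomp C v c = c"
    using 1 C unfolding is_cokernel_def by blast
  moreover have "mcomp C' u' u \<in> hom C C" "mcomp C (mcomp C' u' u) c = c"
    using mcomp_hom[OF u(1) u'(1)] u u' by (simp_all flip: mcomp_assoc)
  moreover have "mid C \<in> hom C C" "mcomp C (mid C) c = c"
    using mid_hom mcomp_mid_left C by blast+
  ultimately have "mcomp C' u' u = mid C" by blast
  thus ?thesis by (rule retract_support)
qed

lemma kernel_support:
  assumes 1: "is_kernel n M N f K k" and 2: "is_kernel n M N f K' k'"
  shows "set_mset K \<subseteq> set_mset K'"
proof -
  have K: "K \<in> obj n" "k \<in> hom K M" "mcomp M f k = mzero"
    and K': "K' \<in> obj n" "k' \<in> hom K' M" "mcomp M f k' = mzero"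
    using assms by (auto simp: is_kernel_def)
  have "\<exists>u. u \<in> hom K' K \<and> mcomp K k u = k'"
    using 1 K' unfolding is_kernel_def by blast
  then obtain u where u: "u \<in> hom K' K" "mcomp K k u = k'" by blast
  have "\<exists>u. u \<in> hom K K' \<and> mcomp K' k' u = k"
    using 2 K unfolding is_kernel_def by blast
  then obtain u' where u': "u' \<in> hom K K'" "mcomp K' k' u' = k" by blast
  have "\<exists>!v. v \<in> hom K K \<and> mcomp K k v = k"
    using 1 K unfolding is_kernel_def by blast
  moreover have "mcomp K' u u' \<in> hom K K" "mcomp K k (mcomp K' u u') = k"
    using mcomp_hom[OF u'(1) u(1)] u u' by (simp_all add: mcomp_assoc)
  moreover have "mid K \<in> hom K K" "mcomp K k (mid K) = k"
    using mid_hom mcomp_mid_right K by blast+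
  ultimately have "mcomp K' u u' = mid K" by blast
  thus ?thesis by (rule retract_support)
qed

definition add_of :: "interval set \<Rightarrow> interval multiset set" where
  "add_of S = {M. set_mset M \<subseteq> S}"

lemma add_of_inject: "add_of S = add_of T \<longleftrightarrow> S = T"
proof
  assume "add_of S = add_of T"
  hence "{#x#} \<in> add_of S \<longleftrightarrow> {#x#} \<in> add_of T" for x by simp
  thus "S = T" by (auto simp: add_of_def)
qed simp

text \<open>A member of a subcategory splits off each of its intervals, and it is the sum of them. Conversely,
\<open>retract_support\<close> shows that isomorphic objects consist of the same intervals.\<close>

lemma subcategory_iff: "subcategory n \<A> \<longleftrightarrow> (\<exists>S\<subseteq>intervals n. \<A> = add_of S)"
proof
  assume sub: "subcategory n \<A>"
  define S where "S = {x. {#x#} \<in> \<A>}"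
  have SI: "S \<subseteq> intervals n"
    using sub by (auto simp: S_def subcategory_def obj_def)
  have "M \<in> add_of S" if M: "M \<in> \<A>" for M
  proof -
    have Mo: "M \<in> obj n" using sub M by (auto simp: subcategory_def)
    have "{#x#} \<in> \<A>" if x: "x \<in># M" for x
    proof -
      have "isomorphic M ({#x#} + (M - {#x#}))"
        unfolding isomorphic_def using x mid_hom[OF Mo] mcomp_mid_left[OF Mo mid_hom[OF Mo]] by auto
      moreover have "{#x#} \<in> obj n" "M - {#x#} \<in> obj n"
        using Mo x by (auto simp: obj_def dest: in_diffD)
      ultimately show ?thesis using sub M unfolding subcategory_def by blast
    qed
    thus ?thesis by (auto simp: add_of_def S_def)
  qed
  moreover have "set_mset M \<subseteq> S \<Longrightarrow> M \<in> \<A>" for M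
  proof (induction M)
    case empty
    show ?case using sub by (simp add: subcategory_def)
  next
    case (add x M)
    hence "M \<in> \<A>" "{#x#} \<in> \<A>" by (auto simp: S_def)
    hence "M + {#x#} \<in> \<A>" using sub unfolding subcategory_def by blast
    thus ?case by simp
  qed
  ultimately show "\<exists>S\<subseteq>intervals n. \<A> = add_of S" using SI unfolding add_of_def by blast
next
  assume "\<exists>S\<subseteq>intervals n. \<A> = add_of S"
  then obtain S where S: "S \<subseteq> intervals n" "\<A> = add_of S" by blast
  show "subcategory n \<A>"
    unfolding subcategory_def S(2)
  proof (intro conjI ballI impI)
    fix Y X Z assume "Y \<in> add_of S" "isomorphic Y (X + Z)"
    thus "X \<in> add_of S"
      unfolding isomorphic_def add_of_def using retract_support by fastforce
  qed (use S in \<open>auto simp: add_of_def obj_def\<close>)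
qed

lemma card_subcategories:
  assumes "\<And>S. S \<subseteq> intervals n \<Longrightarrow> Q (add_of S) \<longleftrightarrow> P S"
  shows "card {\<A>. subcategory n \<A> \<and> Q \<A>} = card {S. S \<subseteq> intervals n \<and> P S}"
proof -
  have "{\<A>. subcategory n \<A> \<and> Q \<A>} = add_of ` {S. S \<subseteq> intervals n \<and> P S}"
    using assms by (auto simp: subcategory_iff)
  moreover have "inj_on add_of {S. S \<subseteq> intervals n \<and> P S}"
    by (simp add: inj_on_def add_of_inject)
  ultimately show ?thesis by (simp add: card_image)
qed

section \<open>Closure under cokernels and kernels\<close>

lemma coker_family_relabel:
  assumes cok: "coker_family I l J m f K k c" and k: "\<And>\<kappa>. \<kappa> \<in> K \<Longrightarrow> k' \<kappa> = k \<kappa>"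
  shows "coker_family I l J m f K k' c"
proof -
  have v: "vecs K k' z = vecs K k z" for z
    using k by (auto simp: vecs_def)
  have d: "dot K k' x z u v = dot K k x z u v" for x z u v
    by (rule dot_cong) (use k in auto)
  have "(\<lambda>j. c j \<kappa>) \<in> vecs J m (k' \<kappa>)" for \<kappa>
    unfolding vecs_def mem_Collect_eq using coker_family_1D[OF cok] k by metis
  thus ?thesis using cok k unfolding coker_family_def v d by (simp cong: ball_cong)
qed

lemma is_cokernel_of_family:
  assumes MN: "M \<in> obj n" "N \<in> obj n" and f: "f \<in> hom M N"
    and cok: "coker_family (idx M) fst (idx N) fst f K w c" and fin: "finite K"
    and w: "\<And>\<kappa>. \<kappa> \<in> K \<Longrightarrow> w \<kappa> \<in> intervals n \<union> degenerate n"
  shows "\<exists>C c. is_cokernel n M N f C c \<and> set_mset C = w ` K - degenerate n"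
proof -
  let ?K = "{\<kappa> \<in> K. fst (w \<kappa>) \<le> snd (w \<kappa>)}"
  have "finite ?K" using fin by simp
  then obtain C \<phi> where C: "bij_betw \<phi> (idx C) ?K" "\<And>p. p \<in> idx C \<Longrightarrow> w (\<phi> p) = fst p"
    and sC: "set_mset C = w ` ?K" using multiset_of_family[of ?K w] by blast
  have "w ` ?K = w ` K - degenerate n"
    using w by (fastforce simp: degenerate_def intervals_def)
  hence set: "set_mset C = w ` K - degenerate n" using sC by simp
  have "w ` K - degenerate n \<subseteq> intervals n"
    using w by (intro subsetI) (metis Diff_iff UnE imageE)
  hence Co: "C \<in> obj n" using set by (simp add: obj_def)
  define c' where "c' = (\<lambda>j p. if p \<in> idx C then c j (\<phi> p) else 0)"
  have lab: "(w \<circ> \<phi>) p = fst p" if "p \<in> idx C" for p using C(2) that by simp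
  have "coker_family (idx M) fst (idx N) fst f (idx C) (w \<circ> \<phi>) c'"
    unfolding c'_def by (rule coker_family_reindex[OF cok fin C(1)])
  hence "coker_family (idx M) fst (idx N) fst f (idx C) fst c'"
    by (rule coker_family_relabel) (use lab in auto)
  thus ?thesis using is_cokernelI[OF MN Co f] set by blast
qed


lemma reflect_reflect: "bounded_label n x \<Longrightarrow> reflect n (reflect n x) = x"
  by (auto simp: reflect_def bounded_label_def prod_eq_iff)

lemma reflect_intervals: "x \<in> intervals n \<Longrightarrow> reflect n x \<in> intervals n"
  by (auto simp: reflect_def intervals_def)

lemma bounded_degenerate: "x \<in> degenerate n \<Longrightarrow> bounded_label n x"
  by (auto simp: bounded_label_def degenerate_def)

lemma is_kernel_of_family:
  assumes MN: "M \<in> obj n" "N \<in> obj n" and f: "f \<in> hom M N"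
    and cok: "coker_family (idx N) (reflect n \<circ> fst) (idx M) (reflect n \<circ> fst) (\<lambda>q p. f p q) K w c"
    and fin: "finite K"
    and w: "\<And>\<kappa>. \<kappa> \<in> K \<Longrightarrow> w \<kappa> \<in> intervals n \<union> degenerate n"
  shows "\<exists>L k. is_kernel n M N f L k \<and> set_mset L = reflect n ` (w ` K - degenerate n)"
proof -
  let ?K = "{\<kappa> \<in> K. fst (w \<kappa>) \<le> snd (w \<kappa>)}"
  have bd: "bounded_label n (w \<kappa>)" if "\<kappa> \<in> K" for \<kappa>
    using w[OF that] bounded_interval bounded_degenerate by blast
  have "finite ?K" using fin by simp
  then obtain L \<phi> where L: "bij_betw \<phi> (idx L) ?K" "\<And>p. p \<in> idx L \<Longrightarrow> reflect n (w (\<phi> p)) = fst p"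
    and sL: "set_mset L = (\<lambda>\<kappa>. reflect n (w \<kappa>)) ` ?K"
    using multiset_of_family[of ?K "\<lambda>\<kappa>. reflect n (w \<kappa>)"] by blast
  have "w ` ?K = w ` K - degenerate n"
    using w by (fastforce simp: degenerate_def intervals_def)
  hence set: "set_mset L = reflect n ` (w ` K - degenerate n)"
    using sL by (metis image_image)
  have "w ` K - degenerate n \<subseteq> intervals n"
    using w by (intro subsetI) (metis Diff_iff UnE imageE)
  hence Lo: "L \<in> obj n" unfolding obj_def mem_Collect_eq set
    by (intro image_subsetI reflect_intervals) (rule subsetD)
  define c' where "c' = (\<lambda>j p. if p \<in> idx L then c j (\<phi> p) else 0)"
  have lab: "(reflect n \<circ> fst) p = (w \<circ> \<phi>) p" if p: "p \<in> idx L" for p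
  proof -
    have "\<phi> p \<in> K" using bij_betwE[OF L(1)] p by blast
    thus ?thesis using L(2)[OF p] reflect_reflect[OF bd] by (metis comp_apply)
  qed
  have "coker_family (idx N) (reflect n \<circ> fst) (idx M) (reflect n \<circ> fst) (\<lambda>q p. f p q) (idx L) (w \<circ> \<phi>) c'"
    unfolding c'_def by (rule coker_family_reindex[OF cok fin L(1)])
  hence "coker_family (idx N) (reflect n \<circ> fst) (idx M) (reflect n \<circ> fst) (\<lambda>q p. f p q) (idx L) (reflect n \<circ> fst) c'"
    by (rule coker_family_relabel) (rule lab)
  hence "is_kernel n M N f L (\<lambda>s p. c' p s)" by (intro is_kernelI[OF MN Lo f])
  thus ?thesis using set by blast
qed

text \<open>Any cokernel has the same summands as the one constructed above, by uniqueness.\<close>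

lemma closed_cokernels_add_of:
  assumes S: "S \<subseteq> intervals n" "coker_stable S" "nest_stable S"
  shows "closed_cokernels n (add_of S)"
  unfolding closed_cokernels_def
proof (intro ballI allI impI)
  fix M N f C c
  assume M: "M \<in> add_of S" and N: "N \<in> add_of S" and f: "f \<in> hom M N" and C: "is_cokernel n M N f C c"
  have "M \<in> obj n" "N \<in> obj n" using C by (auto simp: is_cokernel_def)
  have lab: "fst p \<in> S" if "p \<in> idx M \<or> p \<in> idx N" for p
    using that M N idx_label unfolding add_of_def by blast
  obtain w c' where w: "coker_family (idx M) fst (idx N) fst f (idx N) w c'"
      "\<And>j. j \<in> idx N \<Longrightarrow> w j \<in> S \<union> degenerate n"
    using coker_family_exists[OF finite_idx finite_idx S, of M fst N fst f] lab hom_1D(3)[OF f] by metis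
  have "w j \<in> intervals n \<union> degenerate n" if "j \<in> idx N" for j
    using w(2)[OF that] S(1) by blast
  from is_cokernel_of_family[OF \<open>M \<in> obj n\<close> \<open>N \<in> obj n\<close> f w(1) finite_idx this]
  obtain C' c'' where "is_cokernel n M N f C' c''" "set_mset C' = w ` idx N - degenerate n" by blast
  thus "C \<in> add_of S" using cokernel_support[OF C] w(2) by (fastforce simp: add_of_def)
qed

lemma closed_kernels_add_of:
  assumes S: "S \<subseteq> intervals n" "coker_stable (reflect n ` S)" "nest_stable (reflect n ` S)"
  shows "closed_kernels n (add_of S)"
  unfolding closed_kernels_def
proof (intro ballI allI impI)
  fix M N f K k
  assume M: "M \<in> add_of S" and N: "N \<in> add_of S" and f: "f \<in> hom M N" and K: "is_kernel n M N f K k"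
  have MN: "M \<in> obj n" "N \<in> obj n" using K by (auto simp: is_kernel_def)
  have rS: "reflect n ` S \<subseteq> intervals n" using S(1) reflect_intervals by blast
  have lab: "(reflect n \<circ> fst) p \<in> reflect n ` S" if "p \<in> idx M \<or> p \<in> idx N" for p
    using that M N idx_label unfolding add_of_def by fastforce
  have ar: "arrow ((reflect n \<circ> fst) q) ((reflect n \<circ> fst) p)" if "q \<in> idx N" "p \<in> idx M" "f p q = 1" for p q
    using hom_1D(3)[OF f that(3)] that bounded_idx MN by (simp add: arrow_reflect bounded_idx[OF MN(1)] bounded_idx[OF MN(2)])
  obtain w c' where w: "coker_family (idx N) (reflect n \<circ> fst) (idx M) (reflect n \<circ> fst) (\<lambda>q p. f p q) (idx M) w c'"
      "\<And>j. j \<in> idx M \<Longrightarrow> w j \<in> reflect n ` S \<union> degenerate n"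
    using coker_family_exists[OF finite_idx finite_idx rS S(2,3), of N "reflect n \<circ> fst" M "reflect n \<circ> fst" "\<lambda>q p. f p q"]
      lab ar by metis
  have "w j \<in> intervals n \<union> degenerate n" if "j \<in> idx M" for j
    using w(2)[OF that] rS by blast
  from is_kernel_of_family[OF MN f w(1) finite_idx this]
  obtain K' k'' where K': "is_kernel n M N f K' k''" "set_mset K' = reflect n ` (w ` idx M - degenerate n)" by blast
  have "set_mset K' \<subseteq> S"
  proof
    fix x assume "x \<in># K'"
    then obtain y where y: "y \<in> w ` idx M - degenerate n" "x = reflect n y"
      unfolding K'(2) by blast
    hence "y \<in> reflect n ` S" using w(2) by blast
    then obtain s where "s \<in> S" "x = reflect n (reflect n s)"
      using y(2) by blast
    thus "x \<in> S" using S(1) reflect_reflect bounded_interval by (metis subsetD)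
  qed
  thus "K \<in> add_of S" using kernel_support[OF K K'(1)] by (auto simp: add_of_def)
qed

lemma coker_family_arrow:
  assumes a: "arrow (l i) (m q)" and f: "f i q = 1"
  shows "\<exists>w c. coker_family {i} l {q} m f {q} w c \<and> w q = (snd (l i) + 1, snd (m q))"
proof -
  let ?y = "(snd (l i) + 1, snd (m q))"
  have base: "coker_family {i} l {} m (\<lambda>_. f i) {} m (\<lambda>_ _. 0)"
    unfolding coker_family_def vecs_def dot_def by auto
  have "\<exists>c. coker_family {i} l (insert q {}) m (\<lambda>_. f i) (insert q {}) (m(q := ?y)) c"
    by (rule exI, rule coker_family_extend[where r = "\<lambda>_. 0", OF _ _ base])
       (use a f in \<open>auto simp: vecs_def dot_def comp_int_of_bool arrow_def\<close>)
  then obtain c where "coker_family {i} l {q} m (\<lambda>_. f i) {q} (m(q := ?y)) c" by blast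
  moreover have "coker_family {i} l {q} m f {q} w c \<longleftrightarrow> coker_family {i} l {q} m (\<lambda>_. f i) {q} w c" for w c
    unfolding coker_family_def by simp
  ultimately have "coker_family {i} l {q} m f {q} (m(q := ?y)) c" by simp
  thus ?thesis by fastforce
qed

definition the_arrow :: "interval \<Rightarrow> interval \<Rightarrow> mor" where
  "the_arrow x y = (\<lambda>p q. of_bool (p = (x, 0) \<and> q = (y, 0)))"

lemma the_arrow_hom: "arrow x y \<Longrightarrow> the_arrow x y \<in> hom {#x#} {#y#}"
  unfolding hom_iff the_arrow_def by (auto simp: idx_single)

lemma coker_stable_if_closed:
  assumes S: "S \<subseteq> intervals n" and cl: "closed_cokernels n (add_of S)"
  shows "coker_stable S"
  unfolding coker_stable_def
proof (intro allI impI)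
  fix a b c d assume x: "(a, b) \<in> S" and y: "(c, d) \<in> S" and le: "a \<le> c" "c \<le> b" "b < d"
  let ?x = "(a, b)" and ?y = "(c, d)"
  have xy: "?x \<in> intervals n" "?y \<in> intervals n" using S x y by auto
  have ar: "arrow ?x ?y" using le by (simp add: arrow_def)
  have o: "{#?x#} \<in> obj n" "{#?y#} \<in> obj n" using xy by (simp_all add: obj_def)
  obtain w c' where w: "coker_family {(?x, 0)} fst {(?y, 0)} fst (the_arrow ?x ?y) {(?y, 0::nat)} w c'" "w (?y, 0) = (b + 1, d)"
    using coker_family_arrow[of fst "(?x, 0)" fst "(?y, 0)" "the_arrow ?x ?y"] ar by (auto simp: the_arrow_def)
  have "\<exists>C c. is_cokernel n {#?x#} {#?y#} (the_arrow ?x ?y) C c \<and> set_mset C = w ` {(?y, 0)} - degenerate n"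
    by (rule is_cokernel_of_family[OF o the_arrow_hom[OF ar]])
       (use w xy le in \<open>auto simp: idx_single intervals_def\<close>)
  then obtain C c'' where C: "is_cokernel n {#?x#} {#?y#} (the_arrow ?x ?y) C c''" "set_mset C = {(b + 1, d)}"
    using w(2) le by (auto simp: degenerate_def)
  moreover have "{#?x#} \<in> add_of S" "{#?y#} \<in> add_of S" using x y by (simp_all add: add_of_def)
  ultimately have "C \<in> add_of S" using cl the_arrow_hom[OF ar] unfolding closed_cokernels_def by blast
  thus "(b + 1, d) \<in> S" using C(2) by (simp add: add_of_def)
qed

definition ker_stable :: "interval set \<Rightarrow> bool" where
  "ker_stable S \<longleftrightarrow> (\<forall>a b c d. (a, b) \<in> S \<longrightarrow> (c, d) \<in> S \<longrightarrow>
     a < c \<longrightarrow> c \<le> b \<longrightarrow> b \<le> d \<longrightarrow> (a, c - 1) \<in> S)"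

lemma ker_stable_if_closed:
  assumes S: "S \<subseteq> intervals n" and cl: "closed_kernels n (add_of S)"
  shows "ker_stable S"
  unfolding ker_stable_def
proof (intro allI impI)
  fix a b c d assume x: "(a, b) \<in> S" and y: "(c, d) \<in> S" and le: "a < c" "c \<le> b" "b \<le> d"
  let ?x = "(a, b)" and ?y = "(c, d)" and ?r = "reflect n \<circ> fst"
  have xy: "?x \<in> intervals n" "?y \<in> intervals n" using S x y by auto
  have bds: "1 \<le> a" "d \<le> n" using xy by (auto simp: intervals_def)
  have ar: "arrow ?x ?y" using le by (simp add: arrow_def)
  have o: "{#?x#} \<in> obj n" "{#?y#} \<in> obj n" using xy by (simp_all add: obj_def)
  have "arrow (?r (?y, 0)) (?r (?x, 0))"
    using ar xy bounded_interval by (simp add: arrow_reflect)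
  then obtain w c' where w: "coker_family {(?y, 0)} ?r {(?x, 0)} ?r (\<lambda>q p. the_arrow ?x ?y p q) {(?x, 0::nat)} w c'"
      "w (?x, 0) = (n + 1 - c + 1, n + 1 - a)"
    using coker_family_arrow[of ?r "(?y, 0)" ?r "(?x, 0)" "\<lambda>q p. the_arrow ?x ?y p q"]
    by (auto simp: the_arrow_def reflect_def)
  have "\<exists>C c. is_kernel n {#?x#} {#?y#} (the_arrow ?x ?y) C c \<and> set_mset C = reflect n ` (w ` {(?x, 0)} - degenerate n)"
    by (rule is_kernel_of_family[OF o the_arrow_hom[OF ar]])
       (use w xy le in \<open>auto simp: idx_single intervals_def\<close>)
  moreover have "reflect n ` (w ` {(?x, 0)} - degenerate n) = {(a, c - 1)}"
    using w(2) le bds by (auto simp: degenerate_def reflect_def)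
  ultimately obtain C c'' where C: "is_kernel n {#?x#} {#?y#} (the_arrow ?x ?y) C c''" "set_mset C = {(a, c - 1)}"
    by metis
  moreover have "{#?x#} \<in> add_of S" "{#?y#} \<in> add_of S" using x y by (simp_all add: add_of_def)
  ultimately have "C \<in> add_of S" using cl the_arrow_hom[OF ar] unfolding closed_kernels_def by blast
  thus "(a, c - 1) \<in> S" using C(2) by (simp add: add_of_def)
qed

definition ext_stable :: "interval set \<Rightarrow> bool" where
  "ext_stable S \<longleftrightarrow> (\<forall>a b c d. (a, b) \<in> S \<longrightarrow> (c, d) \<in> S \<longrightarrow> a < c \<longrightarrow> c \<le> b + 1 \<longrightarrow> b < d \<longrightarrow>
     (a, d) \<in> S \<and> (c \<le> b \<longrightarrow> (c, b) \<in> S))"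

lemma coker_stableD:
  "coker_stable S \<Longrightarrow> (a, b) \<in> S \<Longrightarrow> (c, d) \<in> S \<Longrightarrow> a \<le> c \<Longrightarrow> c \<le> b \<Longrightarrow> b < d \<Longrightarrow> (b + 1, d) \<in> S"
  unfolding coker_stable_def by blast

lemma ker_stableD:
  "ker_stable S \<Longrightarrow> (a, b) \<in> S \<Longrightarrow> (c, d) \<in> S \<Longrightarrow> a < c \<Longrightarrow> c \<le> b \<Longrightarrow> b \<le> d \<Longrightarrow> (a, c - 1) \<in> S"
  unfolding ker_stable_def by blast

lemma ext_stableD:
  assumes "ext_stable S" "(a, b) \<in> S" "(c, d) \<in> S" "a < c" "b < d"
  shows "c \<le> b + 1 \<Longrightarrow> (a, d) \<in> S" and "c \<le> b \<Longrightarrow> (c, b) \<in> S"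
  using assms(1)[unfolded ext_stable_def, rule_format, OF assms(2,3,4) _ assms(5)] by auto

text \<open>The intervals \<open>[a,c-1]\<close> (if \<open>a < c\<close>) and \<open>[a,c'-1]\<close> are kernels of maps out of \<open>[a,b]\<close>, then
\<open>[c,c'-1]\<close> is the cokernel of the map between them, and \<open>[c',d]\<close> is the cokernel of
\<open>[c,c'-1] \<rightarrow> [c,d]\<close>.\<close>

lemma nest_stable_if_ker_stable:
  assumes C: "coker_stable S" and K: "ker_stable S"
  shows "nest_stable S"
  unfolding nest_stable_def
proof (intro allI impI)
  fix a b c d c' d'
  assume S: "(a, b) \<in> S" "(c, d) \<in> S" "(c', d') \<in> S"
    and le: "a \<le> c" "c < c'" "c' \<le> b" "b \<le> d'" "d' < d"
  have 1: "(a, c' - 1) \<in> S"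
    using ker_stableD[OF K S(1,3)] le by simp
  have 2: "(c, c' - 1) \<in> S"
  proof (cases "a = c")
    case False
    hence "(a, c - 1) \<in> S"
      using ker_stableD[OF K S(1,2)] le by simp
    from coker_stableD[OF C this 1] show ?thesis using False le by simp
  qed (use 1 in simp)
  show "(c', d) \<in> S" using coker_stableD[OF C 2 S(2)] le by simp
qed

text \<open>The interval \<open>[b+1,d]\<close> is the cokernel of \<open>[a,b] \<rightarrow> [c,d]\<close>, and \<open>[c',d]\<close> is a summand of an extension
of it by \<open>[c',d']\<close>.\<close>

lemma nest_stable_if_ext_stable:
  assumes C: "coker_stable S" and E: "ext_stable S"
  shows "nest_stable S"
  unfolding nest_stable_def
proof (intro allI impI)
  fix a b c d c' d'
  assume S: "(a, b) \<in> S" "(c, d) \<in> S" "(c', d') \<in> S"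
    and le: "a \<le> c" "c < c'" "c' \<le> b" "b \<le> d'" "d' < d"
  have "(b + 1, d) \<in> S"
    using coker_stableD[OF C S(1,2)] le by simp
  from ext_stableD(1)[OF E S(3) this] show "(c', d) \<in> S" using le by simp
qed

lemma reflect_image_coker_ker:
  assumes S: "S \<subseteq> intervals n"
  shows "ker_stable S \<Longrightarrow> coker_stable (reflect n ` S)"
    and "coker_stable S \<Longrightarrow> ker_stable (reflect n ` S)"
proof -
  have in_iff: "(x, y) \<in> reflect n ` S \<longleftrightarrow> 1 \<le> x \<and> x \<le> y \<and> y \<le> n \<and> (n + 1 - y, n + 1 - x) \<in> S" for x y
  proof
    assume "(x, y) \<in> reflect n ` S"
    then obtain s where s: "s \<in> S" "(x, y) = reflect n s" by blast
    hence "(x, y) \<in> intervals n" "reflect n (x, y) = s"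
      using S reflect_intervals reflect_reflect bounded_interval by (metis subsetD)+
    thus "1 \<le> x \<and> x \<le> y \<and> y \<le> n \<and> (n + 1 - y, n + 1 - x) \<in> S"
      using s(1) by (auto simp: intervals_def reflect_def)
  next
    assume *: "1 \<le> x \<and> x \<le> y \<and> y \<le> n \<and> (n + 1 - y, n + 1 - x) \<in> S"
    hence "(x, y) = reflect n (n + 1 - y, n + 1 - x)" by (auto simp: reflect_def)
    thus "(x, y) \<in> reflect n ` S" using * by blast
  qed
  show "coker_stable (reflect n ` S)" if k: "ker_stable S"
    unfolding coker_stable_def
  proof (intro allI impI)
    fix a b c d assume 1: "(a, b) \<in> reflect n ` S" "(c, d) \<in> reflect n ` S" and le: "a \<le> c" "c \<le> b" "b < d"
    note 2 = 1[unfolded in_iff]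
    have "n + 1 - d < n + 1 - b" "n + 1 - b \<le> n + 1 - c" "n + 1 - c \<le> n + 1 - a" using le 2 by auto
    hence "(n + 1 - d, n + 1 - b - 1) \<in> S" using 2 ker_stableD[OF k] by blast
    moreover have "n + 1 - b - 1 = n + 1 - (b + 1)" by simp
    ultimately show "(b + 1, d) \<in> reflect n ` S" unfolding in_iff using 2 le by auto
  qed
  show "ker_stable (reflect n ` S)" if k: "coker_stable S"
    unfolding ker_stable_def
  proof (intro allI impI)
    fix a b c d assume 1: "(a, b) \<in> reflect n ` S" "(c, d) \<in> reflect n ` S" and le: "a < c" "c \<le> b" "b \<le> d"
    note 2 = 1[unfolded in_iff]
    have "n + 1 - d \<le> n + 1 - b" "n + 1 - b \<le> n + 1 - c" "n + 1 - c < n + 1 - a" using le 2 by auto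
    hence "(n + 1 - c + 1, n + 1 - a) \<in> S" using 2 coker_stableD[OF k] by blast
    moreover have "n + 1 - c + 1 = n + 1 - (c - 1)" using le 2 by auto
    ultimately show "(a, c - 1) \<in> reflect n ` S" unfolding in_iff using 2 le by auto
  qed
qed

lemma closed_cokernels_kernels_iff:
  assumes S: "S \<subseteq> intervals n"
  shows "closed_cokernels n (add_of S) \<and> closed_kernels n (add_of S) \<longleftrightarrow> coker_stable S \<and> ker_stable S"
proof
  assume "coker_stable S \<and> ker_stable S"
  thus "closed_cokernels n (add_of S) \<and> closed_kernels n (add_of S)"
    using closed_cokernels_add_of[OF S] closed_kernels_add_of[OF S] reflect_image_coker_ker[OF S]
      nest_stable_if_ker_stable by blast
qed (use coker_stable_if_closed[OF S] ker_stable_if_closed[OF S] in blast)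

section \<open>Closure under extensions\<close>

text \<open>The interval \<open>[a,b]\<close> stands for a summand of the middle term \<open>Y\<close> of an exact sequence
\<open>0 \<rightarrow> X \<rightarrow> Y \<rightarrow> Z \<rightarrow> 0\<close>, \<open>P\<close> for the intervals of \<open>X\<close> with a nonzero map to it, and \<open>Q\<close> for the intervals
of \<open>Z\<close> that receive a nonzero map from it. If the map from \<open>X\<close> to the quotient \<open>[m,b]\<close> vanishes, then
the projection to \<open>[m,b]\<close> factors through \<open>Z\<close>, which gives \<open>R\<close>; dually, \<open>L\<close> comes from the subobject
\<open>[a,m]\<close>.

Let \<open>r\<close> be the largest right end in \<open>P\<close> and \<open>s\<close> the smallest left end in \<open>Q\<close>. By \<open>L\<close>, there is an
interval in \<open>P\<close> that begins at \<open>a\<close> and reaches \<open>s - 1\<close>, and it is glued with the overlap \<open>[s,r]\<close> to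
\<open>[a,r]\<close>. By \<open>R\<close>, there is an interval in \<open>Q\<close> that ends at \<open>b\<close> and begins at \<open>r + 1\<close> or before, and
\<open>[a,r]\<close> is glued with it to \<open>[a,b]\<close>. The cases \<open>s = a\<close> and \<open>r = b\<close> have to be treated separately,
because then one of the two intervals need not exist.\<close>

lemma summand_of_extension:
  assumes E: "ext_stable S" and P: "P \<subseteq> S" and Q: "Q \<subseteq> S" and ab: "a \<le> b"
    and Pa: "\<And>x y. (x, y) \<in> P \<Longrightarrow> arrow (x, y) (a, b)"
    and Qa: "\<And>x y. (x, y) \<in> Q \<Longrightarrow> arrow (a, b) (x, y)"
    and R: "\<And>m. a \<le> m \<Longrightarrow> m \<le> b \<Longrightarrow> (\<And>x y. (x, y) \<in> P \<Longrightarrow> y < m) \<Longrightarrow> \<exists>x\<le>m. (x, b) \<in> Q"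
    and L: "\<And>m. a \<le> m \<Longrightarrow> m \<le> b \<Longrightarrow> (\<And>x y. (x, y) \<in> Q \<Longrightarrow> m < x) \<Longrightarrow> \<exists>y\<ge>m. (a, y) \<in> P"
  shows "(a, b) \<in> S"
proof (cases "P = {} \<or> Q = {}")
  case True
  thus ?thesis
  proof
    assume "P = {}"
    then obtain x where "x \<le> a" "(x, b) \<in> Q" using R[of a] ab by blast
    thus ?thesis using Qa Q by (force simp: arrow_def)
  next
    assume "Q = {}"
    then obtain y where "b \<le> y" "(a, y) \<in> P" using L[of b] ab by blast
    thus ?thesis using Pa P by (force simp: arrow_def)
  qed
next
  case False
  have e1: "(x, w) \<in> S" if "(x, y) \<in> S" "(z, w) \<in> S" "x < z" "z \<le> y + 1" "y < w" for x y z w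
    using ext_stableD(1)[OF E that(1,2,3,5,4)] .
  have e2: "(z, y) \<in> S" if "(x, y) \<in> S" "(z, w) \<in> S" "x < z" "z \<le> y" "y < w" for x y z w
    using ext_stableD(2)[OF E that(1,2,3,5,4)] .
  have finP: "finite (snd ` P)" 
    by (rule finite_subset[of _ "{..b}"]) (use Pa in \<open>force simp: arrow_def\<close>)+
  have finQ: "finite (fst ` Q)"
    by (rule finite_subset[of _ "{..b}"]) (use Qa in \<open>force simp: arrow_def\<close>)+
  define r where "r = Max (snd ` P)"
  define s where "s = Min (fst ` Q)"
  have "r \<in> snd ` P" unfolding r_def using finP False by (intro Max_in) auto
  then obtain a' where P1: "(a', r) \<in> P" by force
  have Pr: "y \<le> r" if "(x, y) \<in> P" for x y
    unfolding r_def using finP that by (intro Max_ge) force+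
  have "s \<in> fst ` Q" unfolding s_def using finQ False by (intro Min_in) auto
  then obtain d' where Q1: "(s, d') \<in> Q" by force
  have Qs: "s \<le> x" if "(x, y) \<in> Q" for x y
    unfolding s_def using finQ that by (intro Min_le) force+
  have P1': "a' \<le> a" "a \<le> r" "r \<le> b" using Pa[OF P1] by (auto simp: arrow_def)
  have Q1': "a \<le> s" "s \<le> b" "b \<le> d'" using Qa[OF Q1] by (auto simp: arrow_def)
  have PS: "(a', r) \<in> S" and QS: "(s, d') \<in> S" using P1 Q1 P Q by auto
  have "(a, r) \<in> S" "s \<le> r + 1"
    if sa: "a < s"
  proof -
    have "\<exists>y\<ge>s - 1. (a, y) \<in> P"
    proof (rule L)
      show "s - 1 < x" if "(x, y) \<in> Q" for x y using Qs[OF that] sa by simp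
    qed (use sa Q1' in auto)
    then obtain y where y: "s - 1 \<le> y" "(a, y) \<in> P" by blast
    have yr: "y \<le> r" using Pr y by auto
    show "s \<le> r + 1" using y yr by auto
    show "(a, r) \<in> S"
    proof (cases "y = r")
      case True thus ?thesis using y P by auto
    next
      case False
      hence "s \<le> r" using y yr by auto
      hence "(s, r) \<in> S"
      proof (cases "r < d'")
        case True thus ?thesis using e2[OF PS QS] sa P1' \<open>s \<le> r\<close> by auto
      next
        case False
        hence "r = d'" using P1' Q1' by auto
        thus ?thesis using QS by simp
      qed
      thus ?thesis using e1[of a y s r] y P sa False yr by auto
    qed
  qed
  moreover have "(a, r) \<in> S" if sa: "a = s" "r < b"
  proof (cases "a' = a")
    case True thus ?thesis using PS by simp
  next
    case False
    thus ?thesis using e2[OF PS QS] sa P1' Q1' by auto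
  qed
  moreover have "(a, b) \<in> S" if sa: "a = s" "r = b"
  proof (cases "a' = a")
    case True thus ?thesis using PS that by simp
  next
    case a': False
    show ?thesis
    proof (cases "b = d'")
      case True thus ?thesis using QS that by simp
    next
      case False
      thus ?thesis using e2[OF PS QS] a' sa P1' Q1' by auto
    qed
  qed
  ultimately have ar: "(a, r) \<in> S" if "r < b \<or> a < s"
    using that Q1' by (metis le_neq_implies_less)
  show ?thesis
  proof (cases "r = b")
    case True
    thus ?thesis using ar \<open>a = s \<Longrightarrow> r = b \<Longrightarrow> (a, b) \<in> S\<close> Q1' by (metis le_neq_implies_less)
  next
    case False
    hence rb: "r < b" using P1' by auto
    have "\<exists>x\<le>r + 1. (x, b) \<in> Q"
    proof (rule R)
      show "y < r + 1" if "(x, y) \<in> P" for x y using Pr[OF that] by simp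
    qed (use rb P1' in auto)
    then obtain x where x: "x \<le> r + 1" "(x, b) \<in> Q" by blast
    have "a \<le> x" using Qa[OF x(2)] by (auto simp: arrow_def)
    show ?thesis
    proof (cases "a = x")
      case True thus ?thesis using x Q by auto
    next
      case False
      thus ?thesis using e1[of a r x b] ar rb x Q \<open>a \<le> x\<close> by auto
    qed
  qed
qed

lemma short_exact_right:
  assumes ex: "short_exact n X f Y g Z" and q: "q \<in> idx Y" and y: "fst q = (a, b)"
    and m: "a \<le> m" "m \<le> b" and P: "\<And>p. f p q = 1 \<Longrightarrow> snd (fst p) < m"
  shows "\<exists>r\<in>idx Z. g q r = 1 \<and> snd (fst r) = b \<and> fst (fst r) \<le> m"
proof -
  have cok: "is_cokernel n X Y f Z g" using ex by (simp add: short_exact_def)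
  have Y: "Y \<in> obj n" using cok by (simp add: is_cokernel_def)
  have "(a, b) \<in> intervals n" using Y idx_label[OF q] y by (auto simp: obj_def)
  hence W: "{#(m, b)#} \<in> obj n" using m by (auto simp: obj_def intervals_def)
  define \<rho> :: mor where "\<rho> = (\<lambda>p s. of_bool (p = q \<and> s = ((m, b), 0)))"
  have h: "\<rho> \<in> hom Y {#(m, b)#}"
    unfolding hom_iff \<rho>_def using q y m by (auto simp: idx_single arrow_def)
  have "mcomp Y \<rho> f = mzero"
  proof (intro ext)
    fix p s
    have "mcomp Y \<rho> f p s \<noteq> 1"
    proof
      assume "mcomp Y \<rho> f p s = 1"
      then obtain q' where "\<rho> q' s = 1" "f p q' = 1" "arrow (fst p) (fst s)"
        unfolding mcomp_dot by (rule dot_eq_1E)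
      thus False using P[of p] by (auto simp: \<rho>_def arrow_def)
    qed
    thus "mcomp Y \<rho> f p s = mzero p s" by (simp add: mzero_def)
  qed
  then obtain u where u: "u \<in> hom Z {#(m, b)#}" "mcomp Z u g = \<rho>"
    using cok W h unfolding is_cokernel_def by blast
  have "mcomp Z u g q ((m, b), 0) = 1" using u by (simp add: \<rho>_def)
  then obtain r where "r \<in> idx Z" "g q r = 1" "arrow (fst q) (fst r)" "arrow (fst r) (m, b)"
    unfolding mcomp_dot by (auto elim: dot_eq_1E)
  thus ?thesis using y by (auto simp: arrow_def)
qed

lemma short_exact_left:
  assumes ex: "short_exact n X f Y g Z" and q: "q \<in> idx Y" and y: "fst q = (a, b)"
    and m: "a \<le> m" "m \<le> b" and Q: "\<And>r. g q r = 1 \<Longrightarrow> m < fst (fst r)"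
  shows "\<exists>p\<in>idx X. f p q = 1 \<and> fst (fst p) = a \<and> m \<le> snd (fst p)"
proof -
  have ker: "is_kernel n Y Z g X f" using ex by (simp add: short_exact_def)
  have Y: "Y \<in> obj n" using ker by (simp add: is_kernel_def)
  have "(a, b) \<in> intervals n" using Y idx_label[OF q] y by (auto simp: obj_def)
  hence W: "{#(a, m)#} \<in> obj n" using m by (auto simp: obj_def intervals_def)
  define \<iota> :: mor where "\<iota> = (\<lambda>s p. of_bool (p = q \<and> s = ((a, m), 0)))"
  have h: "\<iota> \<in> hom {#(a, m)#} Y"
    unfolding hom_iff \<iota>_def using q y m by (auto simp: idx_single arrow_def)
  have "mcomp Y g \<iota> = mzero"
  proof (intro ext)
    fix s r
    have "mcomp Y g \<iota> s r \<noteq> 1"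
    proof
      assume "mcomp Y g \<iota> s r = 1"
      then obtain q' where "\<iota> s q' = 1" "g q' r = 1" "arrow (fst s) (fst r)"
        unfolding mcomp_dot by (rule dot_eq_1E)
      thus False using Q[of r] by (auto simp: \<iota>_def arrow_def)
    qed
    thus "mcomp Y g \<iota> s r = mzero s r" by (simp add: mzero_def)
  qed
  then obtain u where u: "u \<in> hom {#(a, m)#} X" "mcomp X f u = \<iota>"
    using ker W h unfolding is_kernel_def by blast
  have "mcomp X f u ((a, m), 0) q = 1" using u by (simp add: \<iota>_def)
  then obtain p where "p \<in> idx X" "f p q = 1" "arrow (a, m) (fst p)" "arrow (fst p) (fst q)"
    unfolding mcomp_dot by (auto elim: dot_eq_1E)
  thus ?thesis using y by (auto simp: arrow_def)
qed

lemma closed_extensions_add_of: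
  assumes E: "ext_stable S"
  shows "closed_extensions n (add_of S)"
  unfolding closed_extensions_def
proof (intro ballI allI impI)
  fix X Z Y f g assume X: "X \<in> add_of S" and Z: "Z \<in> add_of S" and ex: "short_exact n X f Y g Z"
  have f: "f \<in> hom X Y" and g: "g \<in> hom Y Z" and Y: "Y \<in> obj n"
    using ex by (auto simp: short_exact_def is_cokernel_def)
  have "(a, b) \<in> S" if y: "(a, b) \<in># Y" for a b
  proof -
    let ?q = "((a, b), 0)"
    have q: "?q \<in> idx Y" using idx_first[OF y] .
    define P where "P = {fst p | p. f p ?q = 1}"
    define Q where "Q = {fst r | r. g ?q r = 1}"
    show ?thesis
    proof (rule summand_of_extension[OF E, of P Q])
      show "P \<subseteq> S" using hom_1D(1)[OF f] X idx_label unfolding P_def add_of_def by blast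
      show "Q \<subseteq> S" using hom_1D(2)[OF g] Z idx_label unfolding Q_def add_of_def by blast
      show "a \<le> b" using Y y by (auto simp: obj_def intervals_def)
      show "arrow (x, z) (a, b)" if "(x, z) \<in> P" for x z
        using that hom_1D(3)[OF f, of _ ?q] unfolding P_def by fastforce
      show "arrow (a, b) (x, z)" if "(x, z) \<in> Q" for x z
        using that hom_1D(3)[OF g, of ?q] unfolding Q_def by fastforce
    next
      fix m assume m: "a \<le> m" "m \<le> b" and *: "\<And>x y. (x, y) \<in> P \<Longrightarrow> y < m"
      have "snd (fst p) < m" if "f p ?q = 1" for p
      proof (rule *)
        show "(fst (fst p), snd (fst p)) \<in> P" using that unfolding P_def prod.collapse by blast
      qed
      then obtain r where "g ?q r = 1" "snd (fst r) = b" "fst (fst r) \<le> m"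
        using short_exact_right[OF ex q _ m] by (metis fst_conv)
      thus "\<exists>x\<le>m. (x, b) \<in> Q" unfolding Q_def by (metis (mono_tags, lifting) mem_Collect_eq prod.collapse)
    next
      fix m assume m: "a \<le> m" "m \<le> b" and *: "\<And>x y. (x, y) \<in> Q \<Longrightarrow> m < x"
      have "m < fst (fst r)" if "g ?q r = 1" for r
      proof (rule *)
        show "(fst (fst r), snd (fst r)) \<in> Q" using that unfolding Q_def prod.collapse by blast
      qed
      then obtain p where "f p ?q = 1" "fst (fst p) = a" "m \<le> snd (fst p)"
        using short_exact_left[OF ex q _ m] by (metis fst_conv)
      thus "\<exists>y\<ge>m. (a, y) \<in> P" unfolding P_def by (metis (mono_tags, lifting) mem_Collect_eq prod.collapse)
    qed
  qed
  thus "Y \<in> add_of S" unfolding add_of_def by auto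
qed


lemma dot_singleton: "dot {q} m x z h v = comp_int x (m q) z (h q) (v q)"
  by (simp add: dot_def)

text \<open>The second map of the sequence \<open>0 \<rightarrow> [a,b] \<rightarrow> [a,d] + [c,b] \<rightarrow> [c,d] \<rightarrow> 0\<close> is a cokernel of the first,
where \<open>[c,b]\<close> is omitted if \<open>c = b + 1\<close>. Reflection preserves the shape of this sequence, so that the
lemma also yields that the first map is a kernel of the second.\<close>

lemma coker_family_short_exact:
  assumes le: "a < c" "c \<le> b + 1" "b < d"
    and ne: "p \<noteq> q" and J: "J = insert p (if c \<le> b then {q} else {})"
    and m: "m p = (a, d)" "c \<le> b \<Longrightarrow> m q = (c, b)" and l: "l i = (a, b)" and k: "k \<kappa> = (c, d)"
    and f: "\<And>j. j \<in> J \<Longrightarrow> f i j = 1"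
    and cc: "\<And>j s. cc j s = of_bool (j \<in> J \<and> s = \<kappa>)"
  shows "coker_family {i} l J m f {\<kappa>} k cc"
proof -
  have mJ: "arrow (m j) (c, d)" if "j \<in> J" for j
    using that le m unfolding J by (auto simp: arrow_def split: if_splits)
  have two: "x + y = 0 \<longleftrightarrow> x = y" for x y :: bit by (cases x; cases y) auto
  have dJ: "dot J m (a, b) z h (f i) = 0 \<longleftrightarrow>
     (h p = 1 \<and> arrow (a, d) z \<and> arrow (a, b) z \<longleftrightarrow> c \<le> b \<and> h q = 1 \<and> arrow (c, b) z \<and> arrow (a, b) z)"
    for z h
  proof (cases "c \<le> b")
    case True
    have "dot J m (a, b) z h (f i) = comp_int (a, b) (m p) z (h p) (f i p) + comp_int (a, b) (m q) z (h q) (f i q)"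
      using True ne unfolding J by (simp add: dot_insert dot_singleton)
    moreover have "arrow (a, b) (a, d)" "arrow (a, b) (c, b)" using le True by (auto simp: arrow_def)
    moreover have "f i p = 1" "f i q = 1" using f True unfolding J by auto
    ultimately show ?thesis using True by (auto simp only: two comp_int_of_bool m of_bool_eq_iff)
  next
    case False
    hence "dot J m (a, b) z h (f i) = comp_int (a, b) (m p) z (h p) (f i p)"
      unfolding J by (simp add: dot_singleton)
    moreover have "a \<le> b" "f i p = 1" using le False f unfolding J by auto
    ultimately show ?thesis using False le by (auto simp: comp_int_of_bool m arrow_def)
  qed
  show ?thesis
    unfolding coker_family_def
  proof (intro conjI allI ballI impI)
    fix s show "(\<lambda>j. cc j s) \<in> vecs J m (k s)"
      using mJ k by (auto simp: vecs_def cc)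
  next
    fix i' s assume "i' \<in> {i}" "s \<in> {\<kappa>}"
    moreover have "dot J m (a, b) (c, d) (\<lambda>j. cc j \<kappa>) (f i) = 0"
      unfolding dJ using le J by (auto simp: cc arrow_def)
    ultimately show "dot J m (l i') (k s) (\<lambda>j. cc j s) (f i') = 0" using l k by simp
  next
    fix z h assume h: "h \<in> vecs J m z" and "\<forall>i'\<in>{i}. dot J m (l i') z h (f i') = 0"
    hence 0: "dot J m (a, b) z h (f i) = 0" using l by simp
    have H: "j \<in> J \<and> arrow (m j) z" if "h j = 1" for j
      using h that by (simp add: vecs_def)
    have h1: "arrow (a, d) z" if "h p = 1" using H[OF that] m(1) by simp
    have h2: "c \<le> b \<and> arrow (c, b) z" if "h q = 1"
    proof -
      have "c \<le> b" using H[OF that] ne unfolding J by (simp split: if_splits)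
      thus ?thesis using H[OF that] m(2) by simp
    qed
    have dk: "dot {\<kappa>} k (m j) z u (cc j) = of_bool (u \<kappa> = 1 \<and> arrow (m j) z \<and> arrow (c, d) z)"
      if "j \<in> J" for j u
      using that mJ[OF that] by (auto simp: dot_singleton comp_int_of_bool cc k)
    have bitI: "x = of_bool (x = 1)" for x :: bit by (cases x) auto
    show "\<exists>!u. u \<in> vecs {\<kappa>} k z \<and> (\<forall>j\<in>J. h j = dot {\<kappa>} k (m j) z u (cc j))"
    proof (rule ex1I, intro conjI ballI)
      let ?u = "\<lambda>s. if s = \<kappa> \<and> arrow (c, d) z then h p else 0"
      show "?u \<in> vecs {\<kappa>} k z" by (auto simp: vecs_def k)
      fix j assume j: "j \<in> J"
      have "h j = 1 \<longleftrightarrow> ?u \<kappa> = 1 \<and> arrow (m j) z \<and> arrow (c, d) z"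
      proof (cases "j = p")
        case True
        show ?thesis using 0 h1 h2 le unfolding dJ True m by (cases z) (auto simp: arrow_def)
      next
        case False
        hence cb: "c \<le> b" "j = q" using j unfolding J by (auto split: if_splits)
        show ?thesis using 0 h1 h2 le cb(1) unfolding dJ cb(2) m(2)[OF cb(1)]
          by (cases z; cases "h p"; cases "h q") (auto simp: arrow_def)
      qed
      thus "h j = dot {\<kappa>} k (m j) z ?u (cc j)"
        unfolding dk[OF j] using bitI[of "h j"] by simp
    next
      fix u assume u: "u \<in> vecs {\<kappa>} k z \<and> (\<forall>j\<in>J. h j = dot {\<kappa>} k (m j) z u (cc j))"
      have "p \<in> J" by (simp add: J)
      hence "h p = of_bool (u \<kappa> = 1 \<and> arrow (a, d) z \<and> arrow (c, d) z)"
        using u dk m by simp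
      moreover have "arrow (c, d) z \<Longrightarrow> arrow (a, d) z" using le by (auto simp: arrow_def)
      ultimately have e: "h p = of_bool (u \<kappa> = 1 \<and> arrow (c, d) z)" by auto
      have U: "s = \<kappa> \<and> arrow (c, d) z" if "u s = 1" for s
        using conjunct1[OF u] that k by (auto simp add: vecs_def)
      have e': "h p = u \<kappa>" using e U[of \<kappa>] by (cases "u \<kappa>") simp_all
      have "u s = (if s = \<kappa> \<and> arrow (c, d) z then h p else 0)" for s
      proof (cases "u s = 1")
        case True
        thus ?thesis using e' U[OF True] by simp
      next
        case False
        thus ?thesis using e' by auto
      qed
      thus "u = (\<lambda>s. if s = \<kappa> \<and> arrow (c, d) z then h p else 0)" by blast
    qed
  qed (auto simp: cc)
qed

lemma ext_stable_if_closed: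
  assumes S: "S \<subseteq> intervals n" and cl: "closed_extensions n (add_of S)"
  shows "ext_stable S"
  unfolding ext_stable_def
proof (intro allI impI)
  fix a b c d assume x: "(a, b) \<in> S" and z: "(c, d) \<in> S" and le: "a < c" "c \<le> b + 1" "b < d"
  have xz: "(a, b) \<in> intervals n" "(c, d) \<in> intervals n" using S x z by auto
  hence bds: "1 \<le> a" "a \<le> b" "c \<le> d" "d \<le> n" by (auto simp: intervals_def)
  define X where "X = {#(a, b)#}"
  define Z where "Z = {#(c, d)#}"
  define Y where "Y = add_mset (a, d) (if c \<le> b then {#(c, b)#} else {#})"
  define f :: mor where "f = (\<lambda>p q. of_bool (q \<in> idx Y \<and> p = ((a, b), 0)))"
  define g :: mor where "g = (\<lambda>q r. of_bool (q \<in> idx Y \<and> r = ((c, d), 0)))"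
  have o: "X \<in> obj n" "Y \<in> obj n" "Z \<in> obj n"
    using xz bds le by (auto simp: X_def Y_def Z_def obj_def intervals_def)
  let ?q1 = "((a, d), 0)" and ?q2 = "((c, b), 0)"
  have iX: "idx X = {((a, b), 0)}" and iZ: "idx Z = {((c, d), 0)}"
    by (simp_all add: X_def Z_def idx_single)
  have ne: "(a, d) \<noteq> (c, b)" using le by auto
  have iY: "idx Y = insert ?q1 (if c \<le> b then {?q2} else {})"
    using ne by (auto simp: Y_def idx_def split: if_splits)
  have arr: "arrow (a, b) (fst q)" "arrow (fst q) (c, d)" if "q \<in> idx Y" for q
    using that le bds unfolding iY by (auto simp: arrow_def split: if_splits)
  have f: "f \<in> hom X Y" and g: "g \<in> hom Y Z"
    unfolding hom_iff f_def g_def iX iZ using arr by auto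
  have cok: "is_cokernel n X Y f Z g"
  proof (rule is_cokernelI[OF o(1,2,3) f])
    show "coker_family (idx X) fst (idx Y) fst f (idx Z) fst g"
      unfolding iX iZ
      by (rule coker_family_short_exact[OF le, where p = ?q1 and q = ?q2])
         (use iY ne in \<open>auto simp: f_def g_def\<close>)
  qed
  have ker: "is_kernel n Y Z g X f"
  proof (rule is_kernelI[OF o(2,3,1) g])
    show "coker_family (idx Z) (reflect n \<circ> fst) (idx Y) (reflect n \<circ> fst) (\<lambda>q p. g p q)
                (idx X) (reflect n \<circ> fst) (\<lambda>p s. f s p)"
      unfolding iX iZ
    proof (rule coker_family_short_exact[where p = ?q1 and q = ?q2])
      show "n + 1 - d < n + 1 - b" "n + 1 - b \<le> n + 1 - c + 1" "n + 1 - c < n + 1 - a" using le bds by auto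
      show "idx Y = insert ?q1 (if n + 1 - b \<le> n + 1 - c then {?q2} else {})"
        unfolding iY using le bds by auto
    qed (use ne in \<open>auto simp: f_def g_def reflect_def\<close>)
  qed
  have "X \<in> add_of S" "Z \<in> add_of S" using x z by (simp_all add: X_def Z_def add_of_def)
  moreover have "short_exact n X f Y g Z" using cok ker by (simp add: short_exact_def)
  ultimately have "Y \<in> add_of S" using cl unfolding closed_extensions_def by blast
  thus "(a, d) \<in> S \<and> (c \<le> b \<longrightarrow> (c, b) \<in> S)" by (auto simp: Y_def add_of_def split: if_splits)
qed

lemma closed_cokernels_extensions_iff:
  assumes S: "S \<subseteq> intervals n"
  shows "closed_cokernels n (add_of S) \<and> closed_extensions n (add_of S) \<longleftrightarrow> coker_stable S \<and> ext_stable S"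
proof
  assume "coker_stable S \<and> ext_stable S"
  thus "closed_cokernels n (add_of S) \<and> closed_extensions n (add_of S)"
    using closed_cokernels_add_of[OF S] closed_extensions_add_of nest_stable_if_ext_stable by blast
qed (use coker_stable_if_closed[OF S] ext_stable_if_closed[OF S] in blast)

lemma num_CK_eq: "num_CK n = card {S. S \<subseteq> intervals n \<and> coker_stable S \<and> ker_stable S}"
  unfolding num_CK_def
  by (rule card_subcategories[where Q = "\<lambda>\<A>. closed_cokernels n \<A> \<and> closed_kernels n \<A>"])
     (rule closed_cokernels_kernels_iff)

lemma num_CE_eq: "num_CE n = card {S. S \<subseteq> intervals n \<and> coker_stable S \<and> ext_stable S}"
  unfolding num_CE_def
  by (rule card_subcategories[where Q = "\<lambda>\<A>. closed_cokernels n \<A> \<and> closed_extensions n \<A>"])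
     (rule closed_cokernels_extensions_iff)

section \<open>Counting by insertion of a leftmost point\<close>

definition edges :: "nat \<Rightarrow> nat \<Rightarrow> (nat \<times> nat) set" where
  "edges s n = {(i, j). s \<le> i \<and> i < j \<and> j \<le> n}"

text \<open>The number of nodes at depth \<open>k\<close> below a node labelled \<open>v\<close> in the tree in which such a node has one
child labelled \<open>v + 1\<close> and, in addition, children labelled \<open>2\<close>, ..., \<open>v + 1\<close>.\<close>

fun descendants :: "nat \<Rightarrow> nat \<Rightarrow> nat" where
  "descendants 0 v = 1"
| "descendants (Suc k) v = descendants k (v + 1) + (\<Sum>r=1..v. descendants k (r + 1))"

lemma finite_edges: "finite (edges s n)"
  by (rule finite_subset[of _ "{..n} \<times> {..n}"]) (auto simp: edges_def)

text \<open>Edge sets on \<open>{s..n}\<close> are the nodes at depth \<open>n + 1 - s\<close> of a tree: the parent arises by deletion of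
the point \<open>s\<close>. The set \<open>V s T\<close> of admissible vertices parametrises the nonempty neighbourhoods \<open>A T l\<close>
that the next point can receive, and its size is the label of the node.\<close>

lemma card_by_leftmost_insertion:
  fixes Q :: "(nat \<times> nat) set \<Rightarrow> bool" and V :: "nat \<Rightarrow> (nat \<times> nat) set \<Rightarrow> nat set"
    and A :: "(nat \<times> nat) set \<Rightarrow> nat \<Rightarrow> nat set"
  assumes Q0: "Q {}" and V0: "V (Suc n) {} = {}"
    and finV: "\<And>s T. finite (V s T)"
    and restrict: "\<And>s T. T \<subseteq> edges s n \<Longrightarrow> Q T \<Longrightarrow> Q (T \<inter> edges (Suc s) n)"
    and extend: "\<And>s T B. s \<le> n \<Longrightarrow> T \<subseteq> edges (Suc s) n \<Longrightarrow> Q T \<Longrightarrow> B \<subseteq> {Suc s..n} \<Longrightarrow>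
        Q (T \<union> {s} \<times> B) \<longleftrightarrow> B = {} \<or> (\<exists>l\<in>V (Suc s) T. B = A T l)"
    and A: "\<And>s T l. s \<le> n \<Longrightarrow> T \<subseteq> edges (Suc s) n \<Longrightarrow> Q T \<Longrightarrow> l \<in> V (Suc s) T \<Longrightarrow> A T l \<noteq> {} \<and> A T l \<subseteq> {Suc s..n}"
    and inj: "\<And>s T. s \<le> n \<Longrightarrow> T \<subseteq> edges (Suc s) n \<Longrightarrow> Q T \<Longrightarrow> inj_on (A T) (V (Suc s) T)"
    and same: "\<And>s T. s \<le> n \<Longrightarrow> T \<subseteq> edges (Suc s) n \<Longrightarrow> Q T \<Longrightarrow> card (V s T) = Suc (card (V (Suc s) T))"
    and new: "\<And>s T. s \<le> n \<Longrightarrow> T \<subseteq> edges (Suc s) n \<Longrightarrow> Q T \<Longrightarrow>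
        bij_betw (\<lambda>l. card (V s (T \<union> {s} \<times> A T l))) (V (Suc s) T) {2..Suc (card (V (Suc s) T))}"
  shows "card {T. T \<subseteq> edges 0 n \<and> Q T} = descendants (Suc n) 0"
proof -
  define fam where "fam s = {T. T \<subseteq> edges s n \<and> Q T}" for s
  have fin: "finite (fam s)" for s
    by (rule finite_subset[of _ "Pow (edges s n)"]) (auto simp: fam_def finite_edges)
  have step: "(\<Sum>T\<in>fam s. descendants k (card (V s T)))
      = (\<Sum>T\<in>fam (Suc s). descendants (Suc k) (card (V (Suc s) T)))" if s: "s \<le> n" for s k
  proof -
    let ?r = "\<lambda>T. T \<inter> edges (Suc s) n" and ?h = "\<lambda>T. descendants k (card (V s T))"
    have im: "?r ` fam s \<subseteq> fam (Suc s)"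
      using restrict by (auto simp: fam_def)
    have fiber: "(\<Sum>T'\<in>{T' \<in> fam s. ?r T' = T}. ?h T') = descendants (Suc k) (card (V (Suc s) T))"
      if T: "T \<in> fam (Suc s)" for T
    proof -
      have TE: "T \<subseteq> edges (Suc s) n" and QT: "Q T" using T by (auto simp: fam_def)
      note a = s TE QT
      have es: "edges (Suc s) n \<subseteq> edges s n" by (auto simp: edges_def)
      have split: "T' = ?r T' \<union> {s} \<times> {x. (s, x) \<in> T'}" if "T' \<subseteq> edges s n" for T'
      proof -
        have "p \<in> edges (Suc s) n \<or> fst p = s" if "p \<in> T'" for p
          using that \<open>T' \<subseteq> edges s n\<close> by (force simp: edges_def)
        thus ?thesis by force
      qed
      have r: "?r (T \<union> {s} \<times> B) = T" "(s, x) \<in> T \<union> {s} \<times> B \<longleftrightarrow> x \<in> B" for B x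
        using TE by (auto simp: edges_def)
      have ext: "T \<union> {s} \<times> A T l \<in> fam s" if "l \<in> V (Suc s) T" for l
      proof -
        have "Q (T \<union> {s} \<times> A T l)" using extend[OF a] A[OF a that] that by blast
        moreover have "{s} \<times> A T l \<subseteq> edges s n" using A[OF a that] by (auto simp: edges_def)
        ultimately show ?thesis using TE es by (auto simp: fam_def)
      qed
      have "{T' \<in> fam s. ?r T' = T} = insert T ((\<lambda>l. T \<union> {s} \<times> A T l) ` V (Suc s) T)"
      proof (intro equalityI subsetI)
        fix T' assume "T' \<in> {T' \<in> fam s. ?r T' = T}"
        hence T': "T' \<subseteq> edges s n" "Q T'" "?r T' = T" by (auto simp: fam_def)
        define B where "B = {x. (s, x) \<in> T'}"
        have eq: "T' = T \<union> {s} \<times> B" using split[OF T'(1)] T'(3) by (simp add: B_def)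
        have "B \<subseteq> {Suc s..n}" using T'(1) by (auto simp: B_def edges_def)
        hence "B = {} \<or> (\<exists>l\<in>V (Suc s) T. B = A T l)" using extend[OF a] T'(2) eq by blast
        thus "T' \<in> insert T ((\<lambda>l. T \<union> {s} \<times> A T l) ` V (Suc s) T)" using eq by auto
      next
        fix T' assume "T' \<in> insert T ((\<lambda>l. T \<union> {s} \<times> A T l) ` V (Suc s) T)"
        then consider "T' = T" | l where "l \<in> V (Suc s) T" "T' = T \<union> {s} \<times> A T l" by blast
        thus "T' \<in> {T' \<in> fam s. ?r T' = T}"
        proof cases
          case 1
          thus ?thesis using TE es QT by (simp add: fam_def Int_absorb2)
        next
          case 2
          thus ?thesis using ext[OF 2(1)] r(1) by simp
        qed
      qed
      moreover have "T \<notin> (\<lambda>l. T \<union> {s} \<times> A T l) ` V (Suc s) T"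
      proof
        assume "T \<in> (\<lambda>l. T \<union> {s} \<times> A T l) ` V (Suc s) T"
        then obtain l where l: "l \<in> V (Suc s) T" "T = T \<union> {s} \<times> A T l" by blast
        then obtain x where "(s, x) \<in> T" using A[OF a l(1)] by blast
        thus False using TE by (auto simp: edges_def)
      qed
      moreover have "inj_on (\<lambda>l. T \<union> {s} \<times> A T l) (V (Suc s) T)"
      proof (rule inj_onI)
        fix l l' assume l: "l \<in> V (Suc s) T" "l' \<in> V (Suc s) T" and e: "T \<union> {s} \<times> A T l = T \<union> {s} \<times> A T l'"
        have "A T l = A T l'" using r(2)[of _ "A T l"] r(2)[of _ "A T l'"] unfolding e by blast
        thus "l = l'" using inj[OF a] l by (meson inj_onD)
      qed
      ultimately have "(\<Sum>T'\<in>{T' \<in> fam s. ?r T' = T}. ?h T')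
          = ?h T + (\<Sum>l\<in>V (Suc s) T. ?h (T \<union> {s} \<times> A T l))"
        using finV by (simp add: sum.reindex)
      also have "(\<Sum>l\<in>V (Suc s) T. ?h (T \<union> {s} \<times> A T l)) = (\<Sum>x\<in>{2..Suc (card (V (Suc s) T))}. descendants k x)"
        by (rule sum.reindex_bij_betw[OF new[OF a], of "descendants k"])
      also have "\<dots> = (\<Sum>r=1..card (V (Suc s) T). descendants k (r + 1))"
        using sum.shift_bounds_cl_Suc_ivl[of "descendants k" 1 "card (V (Suc s) T)"]
        by (simp add: numeral_2_eq_2)
      also have "?h T = descendants k (card (V (Suc s) T) + 1)" using same[OF a] by simp
      finally show ?thesis by simp
    qed
    have "sum ?h (fam s) = (\<Sum>T\<in>fam (Suc s). \<Sum>T'\<in>{T' \<in> fam s. ?r T' = T}. ?h T')"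
      by (rule sum.group[OF fin fin im, symmetric])
    also have "\<dots> = (\<Sum>T\<in>fam (Suc s). descendants (Suc k) (card (V (Suc s) T)))"
      by (rule sum.cong[OF refl fiber])
    finally show ?thesis .
  qed
  have "(\<Sum>T\<in>fam 0. descendants 0 (card (V 0 T))) = (\<Sum>T\<in>fam m. descendants m (card (V m T)))"
    if "m \<le> Suc n" for m
    using that
  proof (induction m)
    case (Suc m)
    thus ?case using step[of m m] by simp
  qed simp
  from this[of "Suc n"] have "card (fam 0) = (\<Sum>T\<in>fam (Suc n). descendants (Suc n) (card (V (Suc n) T)))"
    by simp
  moreover have "fam (Suc n) = {{}}" using Q0 by (auto simp: fam_def edges_def)
  ultimately show ?thesis using V0 by (simp add: fam_def)
qed

lemma bij_betw_rank:
  assumes fin: "finite V"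
    and refl: "\<And>x. x \<in> V \<Longrightarrow> le x x"
    and trans: "\<And>x y z. x \<in> V \<Longrightarrow> y \<in> V \<Longrightarrow> z \<in> V \<Longrightarrow> le x y \<Longrightarrow> le y z \<Longrightarrow> le x z"
    and antisym: "\<And>x y. x \<in> V \<Longrightarrow> y \<in> V \<Longrightarrow> le x y \<Longrightarrow> le y x \<Longrightarrow> x = y"
    and total: "\<And>x y. x \<in> V \<Longrightarrow> y \<in> V \<Longrightarrow> le x y \<or> le y x"
  shows "bij_betw (\<lambda>x. Suc (card {v \<in> V. le v x})) V {2..Suc (card V)}"
proof -
  let ?r = "\<lambda>x. card {v \<in> V. le v x}"
  have less: "?r x < ?r y" if "x \<in> V" "y \<in> V" "le x y" "x \<noteq> y" for x y
  proof (rule psubset_card_mono)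
    have "y \<notin> {v \<in> V. le v x}" "y \<in> {v \<in> V. le v y}" using that refl antisym by auto
    moreover have "{v \<in> V. le v x} \<subseteq> {v \<in> V. le v y}" using that trans by blast
    ultimately show "{v \<in> V. le v x} \<subset> {v \<in> V. le v y}" by blast
  qed (use fin in simp)
  have inj: "inj_on (\<lambda>x. Suc (?r x)) V"
  proof (rule inj_onI, rule ccontr)
    fix x y assume "x \<in> V" "y \<in> V" "Suc (?r x) = Suc (?r y)" "x \<noteq> y"
    thus False using less[of x y] less[of y x] total[of x y] by auto
  qed
  have "(\<lambda>x. Suc (?r x)) ` V \<subseteq> {2..Suc (card V)}"
  proof
    fix k assume "k \<in> (\<lambda>x. Suc (?r x)) ` V"
    then obtain x where x: "x \<in> V" "k = Suc (?r x)" by blast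
    have "x \<in> {v \<in> V. le v x}" using x refl by simp
    hence "?r x \<noteq> 0" using fin by (auto simp: card_eq_0_iff)
    moreover have "?r x \<le> card V" using fin by (auto intro: card_mono)
    ultimately show "k \<in> {2..Suc (card V)}" using x by simp
  qed
  moreover have "card ((\<lambda>x. Suc (?r x)) ` V) = card {2..Suc (card V)}"
    using card_image[OF inj] by simp
  ultimately have "(\<lambda>x. Suc (?r x)) ` V = {2..Suc (card V)}"
    by (intro card_subset_eq) auto
  thus ?thesis using inj by (simp add: bij_betw_def)
qed

text \<open>With the interval \<open>[a,b]\<close> drawn as the edge from \<open>a-1\<close> to \<open>b\<close>, the cokernel, kernel and extension
conditions on intervals become conditions on edges that share an endpoint or cross.\<close>

definition cok_edges :: "(nat \<times> nat) set \<Rightarrow> bool" where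
  "cok_edges T \<longleftrightarrow> (\<forall>i j k l. (i, j) \<in> T \<longrightarrow> (k, l) \<in> T \<longrightarrow> i \<le> k \<longrightarrow> k < j \<longrightarrow> j < l \<longrightarrow> (j, l) \<in> T)"

definition ker_edges :: "(nat \<times> nat) set \<Rightarrow> bool" where
  "ker_edges T \<longleftrightarrow> (\<forall>i j k l. (i, j) \<in> T \<longrightarrow> (k, l) \<in> T \<longrightarrow> i < k \<longrightarrow> k < j \<longrightarrow> j \<le> l \<longrightarrow> (i, k) \<in> T)"

definition ext_edges :: "(nat \<times> nat) set \<Rightarrow> bool" where
  "ext_edges T \<longleftrightarrow> (\<forall>i j k l. (i, j) \<in> T \<longrightarrow> (k, l) \<in> T \<longrightarrow> i < k \<longrightarrow> k \<le> j \<longrightarrow> j < l \<longrightarrow>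
     (i, l) \<in> T \<and> (k < j \<longrightarrow> (k, j) \<in> T))"

lemma cok_edgesD:
  assumes "cok_edges T" "(i, j) \<in> T" "(k, l) \<in> T" "i \<le> k" "k < j" "j < l"
  shows "(j, l) \<in> T"
  using assms(1)[unfolded cok_edges_def, rule_format, OF assms(2-)] .

lemma ker_edgesD:
  assumes "ker_edges T" "(i, j) \<in> T" "(k, l) \<in> T" "i < k" "k < j" "j \<le> l"
  shows "(i, k) \<in> T"
  using assms(1)[unfolded ker_edges_def, rule_format, OF assms(2-)] .

lemma ext_edgesD:
  assumes "ext_edges T" "(i, j) \<in> T" "(k, l) \<in> T" "i < k" "k \<le> j" "j < l"
  shows "(i, l) \<in> T" "k < j \<Longrightarrow> (k, j) \<in> T"
  using assms(1)[unfolded ext_edges_def, rule_format, OF assms(2-)] by blast+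

lemma cok_edges_restrict:
  assumes "cok_edges T"
  shows "cok_edges (T \<inter> edges t n)"
  unfolding cok_edges_def
proof (intro allI impI)
  fix i j k l assume "(i, j) \<in> T \<inter> edges t n" "(k, l) \<in> T \<inter> edges t n" "i \<le> k" "k < j" "j < l"
  thus "(j, l) \<in> T \<inter> edges t n"
    using cok_edgesD[OF assms, of i j k l] by (simp add: edges_def)
qed

lemma ker_edges_restrict:
  assumes "ker_edges T"
  shows "ker_edges (T \<inter> edges t n)"
  unfolding ker_edges_def
proof (intro allI impI)
  fix i j k l assume "(i, j) \<in> T \<inter> edges t n" "(k, l) \<in> T \<inter> edges t n" "i < k" "k < j" "j \<le> l"
  thus "(i, k) \<in> T \<inter> edges t n"
    using ker_edgesD[OF assms, of i j k l] by (simp add: edges_def)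
qed

lemma ext_edges_restrict:
  assumes "ext_edges T"
  shows "ext_edges (T \<inter> edges t n)"
  unfolding ext_edges_def
proof (intro allI impI)
  fix i j k l assume "(i, j) \<in> T \<inter> edges t n" "(k, l) \<in> T \<inter> edges t n" "i < k" "k \<le> j" "j < l"
  thus "(i, l) \<in> T \<inter> edges t n \<and> (k < j \<longrightarrow> (k, j) \<in> T \<inter> edges t n)"
    using ext_edgesD[OF assms, of i j k l] by (simp add: edges_def)
qed

text \<open>If a new leftmost point \<open>s\<close> gets neighbours, then the smallest neighbour \<open>j\<close> determines the others:
they are the right neighbours of \<open>j\<close>, by the cokernel condition for edges that begin at \<open>s\<close> and by the
extension condition for edges that meet end to end. A vertex can be this \<open>j\<close> exactly if every edge
that passes over it is split by it into two edges. After the insertion, \<open>s\<close> is admissible, and an old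
admissible vertex remains so exactly if it is at least \<open>j\<close>: the new edge from \<open>s\<close> to \<open>j\<close> is not split
by any vertex below \<open>j\<close>.\<close>

lemma card_cok_ext_edges:
  "card {T. T \<subseteq> edges 0 n \<and> cok_edges T \<and> ext_edges T} = descendants (Suc n) 0"
proof -
  define A where "A T j = insert j {m. (j, m) \<in> T}" for T :: "(nat \<times> nat) set" and j
  define V where "V s T = {j \<in> {s..n}. \<forall>k l. (k, l) \<in> T \<longrightarrow> k < j \<longrightarrow> j < l \<longrightarrow> (k, j) \<in> T \<and> (j, l) \<in> T}"
    for s and T :: "(nat \<times> nat) set"
  have VD: "(k, j) \<in> T" "(j, l) \<in> T" if "j \<in> V s T" "(k, l) \<in> T" "k < j" "j < l" for s T j k l
    using that unfolding V_def by blast+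
  have Vr: "s \<le> j \<and> j \<le> n" if "j \<in> V s T" for s T j using that by (simp add: V_def)
  have Ar: "A T j \<subseteq> {j..n}" if "T \<subseteq> edges s n" "j \<le> n" for s T j
    using that by (auto simp: A_def edges_def)
  have Vnew: "V s (T \<union> {s} \<times> A T j) = insert s {v \<in> V (Suc s) T. j \<le> v}"
    if s: "s \<le> n" and T: "T \<subseteq> edges (Suc s) n" and Q: "cok_edges T" "ext_edges T" and j: "j \<in> V (Suc s) T" for s T j
  proof (intro equalityI subsetI)
    have TE: "Suc s \<le> x" if "(x, y) \<in> T" for x y using T that by (auto simp: edges_def)
    fix v assume v: "v \<in> V s (T \<union> {s} \<times> A T j)"
    show "v \<in> insert s {v \<in> V (Suc s) T. j \<le> v}"
    proof (cases "v = s")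
      case False
      hence sv: "Suc s \<le> v" "v \<le> n" using Vr[OF v] by auto
      have "v \<in> V (Suc s) T"
        unfolding V_def
      proof (intro CollectI conjI allI impI)
        fix k l assume kl: "(k, l) \<in> T" "k < v" "v < l"
        thus "(k, v) \<in> T" "(v, l) \<in> T" using VD[OF v, of k l] TE[OF kl(1)] sv by auto
      qed (use sv in simp)
      moreover have "j \<le> v"
      proof (rule ccontr)
        assume "\<not> j \<le> v"
        hence "(s, v) \<in> T \<union> {s} \<times> A T j" using VD(1)[OF v, of s j] sv by (auto simp: A_def)
        hence "v \<in> A T j" using TE by fastforce
        thus False using Ar[OF T, of j] Vr[OF j] \<open>\<not> j \<le> v\<close> by auto
      qed
      ultimately show ?thesis by simp
    qed simp
  next
    have TE: "Suc s \<le> x" if "(x, y) \<in> T" for x y using T that by (auto simp: edges_def)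
    fix v assume v: "v \<in> insert s {v \<in> V (Suc s) T. j \<le> v}"
    show "v \<in> V s (T \<union> {s} \<times> A T j)"
      unfolding V_def
    proof (intro CollectI conjI allI impI)
      show "v \<in> {s..n}" using v s Vr[of v "Suc s" T] by auto
      fix k l assume kl: "(k, l) \<in> T \<union> {s} \<times> A T j" "k < v" "v < l"
      have v': "v \<in> V (Suc s) T" "j \<le> v" using v kl TE by fastforce+
      have "(k, v) \<in> T \<union> {s} \<times> A T j \<and> (v, l) \<in> T \<union> {s} \<times> A T j"
      proof (cases "(k, l) \<in> T")
        case True
        thus ?thesis using VD[OF v'(1)] kl by auto
      next
        case False
        hence k: "k = s" "l \<in> A T j" using kl by auto
        hence jl: "(j, l) \<in> T" using v' kl by (auto simp: A_def)
        show ?thesis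
        proof (cases "v = j")
          case True
          thus ?thesis using k jl by (auto simp: A_def)
        next
          case False
          thus ?thesis using k VD[OF v'(1) jl] v'(2) kl by (auto simp: A_def)
        qed
      qed
      thus "(k, v) \<in> T \<union> {s} \<times> A T j" "(v, l) \<in> T \<union> {s} \<times> A T j" by auto
    qed
  qed
  show ?thesis
  proof (rule card_by_leftmost_insertion[where V = V and A = A])
    show "cok_edges {} \<and> ext_edges {}" by (simp add: cok_edges_def ext_edges_def)
    show "V (Suc n) {} = {}" by (simp add: V_def)
    show "finite (V s T)" for s T by (simp add: V_def)
  next
    fix s T assume T: "T \<subseteq> edges s n" and Q: "cok_edges T \<and> ext_edges T"
    show "cok_edges (T \<inter> edges (Suc s) n) \<and> ext_edges (T \<inter> edges (Suc s) n)"
      using Q cok_edges_restrict ext_edges_restrict by blast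
  next
    fix s T B assume s: "s \<le> n" and T: "T \<subseteq> edges (Suc s) n" and Q: "cok_edges T \<and> ext_edges T"
      and B: "B \<subseteq> {Suc s..n}"
    let ?T = "T \<union> {s} \<times> B"
    have TE: "Suc s \<le> x \<and> x < y" if "(x, y) \<in> T" for x y using T that by (auto simp: edges_def)
    note C = cok_edgesD[OF conjunct1[OF Q]] and E = ext_edgesD[OF conjunct2[OF Q]]
    show "cok_edges ?T \<and> ext_edges ?T \<longleftrightarrow> B = {} \<or> (\<exists>l\<in>V (Suc s) T. B = A T l)"
    proof
      assume Q': "cok_edges ?T \<and> ext_edges ?T"
      note C' = cok_edgesD[OF conjunct1[OF Q']] and E' = ext_edgesD[OF conjunct2[OF Q']]
      have inT: "(x, y) \<in> T" if "(x, y) \<in> ?T" "s < x" for x y using that by auto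
      show "B = {} \<or> (\<exists>l\<in>V (Suc s) T. B = A T l)"
      proof (cases "B = {}")
        case False
        have finB: "finite B" using B finite_subset by blast
        define j where "j = Min B"
        have j: "j \<in> B" "\<And>m. m \<in> B \<Longrightarrow> j \<le> m" using finB False by (auto simp: j_def)
        have js: "s < j" "j \<le> n" using j(1) B by auto
        have "j \<in> V (Suc s) T"
          unfolding V_def
        proof (intro CollectI conjI allI impI)
          fix k l assume kl: "(k, l) \<in> T" "k < j" "j < l"
          show "(j, l) \<in> T" using C'[of s j k l] kl j(1) js TE[OF kl(1)] inT by auto
          show "(k, j) \<in> T" using E'(2)[of s j k l] kl j(1) js TE[OF kl(1)] inT by auto
        qed (use js in simp)
        moreover have "B = A T j"
        proof (intro equalityI subsetI)
          fix m assume m: "m \<in> B"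
          show "m \<in> A T j"
          proof (cases "m = j")
            case False
            hence "j < m" using j(2)[OF m] by simp
            thus ?thesis using C'[of s j s m] m j(1) js inT[of j m] by (simp add: A_def)
          qed (simp add: A_def)
        next
          fix m assume "m \<in> A T j"
          then consider "m = j" | "(j, m) \<in> T" by (auto simp: A_def)
          thus "m \<in> B"
          proof cases
            case 2
            hence "(s, m) \<in> ?T" using E'(1)[of s j j m] j(1) js TE[OF 2] by auto
            thus ?thesis using TE by fastforce
          qed (use j in simp)
        qed
        ultimately show ?thesis by blast
      qed simp
    next
      assume "B = {} \<or> (\<exists>l\<in>V (Suc s) T. B = A T l)"
      thus "cok_edges ?T \<and> ext_edges ?T"
      proof
        assume "B = {}" thus ?thesis using Q by simp
      next
        assume "\<exists>l\<in>V (Suc s) T. B = A T l"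
        then obtain j where j: "j \<in> V (Suc s) T" and B: "B = A T j" by blast
        \<comment> \<open>Old edges that pass over a neighbour \<open>m\<close> of \<open>s\<close>: the case \<open>m = j\<close>, which is admissibility, implies the others.\<close>
        have cross: "l \<in> B \<and> (k, m) \<in> T \<and> (m, l) \<in> T" if m: "m \<in> B" and kl: "(k, l) \<in> T" "k < m" "m < l" for m k l
        proof (cases "m = j")
          case True
          thus ?thesis using VD[OF j kl(1)] kl by (auto simp: B A_def)
        next
          case False
          hence jm: "(j, m) \<in> T" using m by (auto simp: B A_def)
          hence jm': "j < m" using TE by auto
          consider "k < j" | "k = j" | "j < k" by linarith
          thus ?thesis
          proof cases
            case 1
            hence "(k, j) \<in> T" "(j, l) \<in> T" using VD[OF j kl(1)] jm' kl by auto
            thus ?thesis using C[OF jm, of j l] E(1)[of k j j m] 1 jm jm' kl by (auto simp: B A_def)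
          next
            case 2
            thus ?thesis using C[OF jm, of j l] jm jm' kl by (auto simp: B A_def)
          next
            case 3
            thus ?thesis using C[OF jm kl(1)] E[OF jm kl(1)] kl by (auto simp: B A_def)
          qed
        qed
        have pair: "(m, l) \<in> T" if "m \<in> B" "l \<in> B" "m < l" for m l
        proof -
          have "j \<le> m" using \<open>m \<in> B\<close> TE unfolding B A_def by (auto simp: less_imp_le)
          hence jl: "(j, l) \<in> T" using that by (auto simp: B A_def)
          show ?thesis
          proof (cases "m = j")
            case False
            hence "(j, m) \<in> T" using that by (auto simp: B A_def)
            thus ?thesis using C[of j m j l] jl that TE by auto
          qed (use jl in simp)
        qed
        have trans: "l \<in> B" if "m \<in> B" "(m, l) \<in> T" for m l
        proof (cases "m = j")
          case False
          hence "(j, m) \<in> T" using that by (auto simp: B A_def)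
          hence "(j, l) \<in> T" using E(1)[of j m m l] that TE by auto
          thus ?thesis by (simp add: B A_def)
        qed (use that in \<open>simp add: B A_def\<close>)
        show ?thesis
        proof
          show "cok_edges ?T"
            unfolding cok_edges_def
          proof (intro allI impI)
            fix i m k l assume "(i, m) \<in> ?T" "(k, l) \<in> ?T" "i \<le> k" "k < m" "m < l"
            thus "(m, l) \<in> ?T" using C[of i m k l] cross[of m k l] pair[of m l] TE by fastforce
          qed
          show "ext_edges ?T"
            unfolding ext_edges_def
          proof (intro allI impI)
            fix i m k l assume 1: "(i, m) \<in> ?T" "(k, l) \<in> ?T" "i < k" "k \<le> m" "m < l"
            hence kl: "(k, l) \<in> T" using TE by fastforce
            show "(i, l) \<in> ?T \<and> (k < m \<longrightarrow> (k, m) \<in> ?T)"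
            proof (cases "(i, m) \<in> T")
              case True
              thus ?thesis using E[OF True kl] 1 by auto
            next
              case False
              hence "i = s" "m \<in> B" using 1 by auto
              thus ?thesis using cross[of m k l] trans[of m l] kl 1 by (cases "k = m") auto
            qed
          qed
        qed
      qed
    qed
  next
    fix s T l assume s: "s \<le> n" and T: "T \<subseteq> edges (Suc s) n" and l: "l \<in> V (Suc s) T"
    show "A T l \<noteq> {} \<and> A T l \<subseteq> {Suc s..n}"
      using Ar[OF T, of l] Vr[OF l] by (auto simp: A_def)
  next
    fix s T assume s: "s \<le> n" and T: "T \<subseteq> edges (Suc s) n" and Q: "cok_edges T \<and> ext_edges T"
    show "inj_on (A T) (V (Suc s) T)"
    proof (rule inj_onI)
      fix x y assume xy: "x \<in> V (Suc s) T" "y \<in> V (Suc s) T" "A T x = A T y"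
      have "x \<in> A T y" "y \<in> A T x" using xy(3) by (auto simp: A_def)
      thus "x = y" using Ar[OF T, of x] Ar[OF T, of y] Vr xy by (meson atLeastAtMost_iff order_antisym subsetD)
    qed
    have "V s T = insert s (V (Suc s) T)"
      using T s by (fastforce simp: V_def edges_def le_Suc_eq not_less_eq_eq)
    moreover have "s \<notin> V (Suc s) T" "finite (V (Suc s) T)" by (auto simp: V_def)
    ultimately show "card (V s T) = Suc (card (V (Suc s) T))" by simp
    have c: "card (V s (T \<union> {s} \<times> A T l)) = Suc (card {v \<in> V (Suc s) T. l \<le> v})" if "l \<in> V (Suc s) T" for l
    proof -
      have "s \<notin> {v \<in> V (Suc s) T. l \<le> v}" "finite {v \<in> V (Suc s) T. l \<le> v}" by (auto simp: V_def)
      thus ?thesis using Vnew[OF s T conjunct1[OF Q] conjunct2[OF Q] that] by simp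
    qed
    have "bij_betw (\<lambda>l. Suc (card {v \<in> V (Suc s) T. l \<le> v})) (V (Suc s) T) {2..Suc (card (V (Suc s) T))}"
      by (rule bij_betw_rank[where le = "\<lambda>x y. y \<le> x"]) (auto simp: V_def)
    thus "bij_betw (\<lambda>l. card (V s (T \<union> {s} \<times> A T l))) (V (Suc s) T) {2..Suc (card (V (Suc s) T))}"
      using c by (simp cong: bij_betw_cong)
  qed
qed

text \<open>If a new leftmost point \<open>s\<close> gets neighbours, then the largest neighbour \<open>l\<close> determines the others:
they are the left neighbours of \<open>l\<close>, by the cokernel condition for edges that begin at \<open>s\<close> and by the
kernel condition for edges that end at \<open>l\<close>. Write \<open>A T l\<close> for the resulting neighbourhood, which
includes \<open>l\<close>. The vertex \<open>l\<close> is admissible if crossings of old edges with the new ones violate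
nothing. After the insertion, \<open>s\<close> is admissible, and an old admissible vertex \<open>v\<close> remains so exactly
if it lies in \<open>A T l\<close> or if all of \<open>A T v\<close> lies to the right of \<open>l\<close>. This relation between \<open>v\<close> and
\<open>l\<close> is a total order on the admissible vertices: it compares the smallest elements of \<open>A T v\<close> and
\<open>A T l\<close>, larger ones coming first, and in case of equality it compares \<open>v\<close> with \<open>l\<close>.\<close>

lemma card_cok_ker_edges:
  "card {T. T \<subseteq> edges 0 n \<and> cok_edges T \<and> ker_edges T} = descendants (Suc n) 0"
proof -
  define A where "A T l = insert l {k. (k, l) \<in> T}" for T :: "(nat \<times> nat) set" and l
  define V where "V s T = {l \<in> {s..n}. \<forall>m\<in>A T l. \<forall>k l'. (k, l') \<in> T \<longrightarrow> k < m \<longrightarrow> m \<le> l' \<longrightarrow>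
      k \<in> A T l \<and> (m < l' \<longrightarrow> (m, l') \<in> T)}" for s and T :: "(nat \<times> nat) set"
  have VD: "k \<in> A T l" "m < l' \<Longrightarrow> (m, l') \<in> T"
    if "l \<in> V s T" "m \<in> A T l" "(k, l') \<in> T" "k < m" "m \<le> l'" for s T l m k l'
    using that unfolding V_def by blast+
  have Vr: "s \<le> j \<and> j \<le> n" if "j \<in> V s T" for s T j using that by (simp add: V_def)
  have Ar: "m = l \<or> (s \<le> m \<and> m < l)" if "T \<subseteq> edges s n" "m \<in> A T l" for s T m l
    using that by (auto simp: A_def edges_def)
  have Aself: "l \<in> A T l" for T l by (simp add: A_def)
  have Amem: "m \<in> A T l \<longleftrightarrow> m = l \<or> (m, l) \<in> T" for m T l by (auto simp: A_def)
  have Atrans: "A T v \<subseteq> A T l" if T: "T \<subseteq> edges s n" and l: "l \<in> V t T" and v: "v \<in> A T l" for s t T v l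
  proof
    fix m assume m: "m \<in> A T v"
    show "m \<in> A T l"
    proof (cases "m = v")
      case False
      hence "(m, v) \<in> T" using m by (simp add: Amem)
      thus ?thesis using VD(1)[OF l v, of m v] T by (auto simp: edges_def)
    qed (use v in simp)
  qed
  define le where "le T v l \<longleftrightarrow> v \<in> A T l \<or> (\<forall>m\<in>A T v. l < m)" for T v l
  have Vnew: "V s (T \<union> {s} \<times> A T l) = insert s {v \<in> V (Suc s) T. le T v l}"
    if s: "s \<le> n" and T: "T \<subseteq> edges (Suc s) n" and Q: "cok_edges T" "ker_edges T" and l: "l \<in> V (Suc s) T" for s T l
  proof -
    let ?T = "T \<union> {s} \<times> A T l"
    have TE: "Suc s \<le> x \<and> x < y" if "(x, y) \<in> T" for x y using T that by (auto simp: edges_def)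
    have sT: "(s, x) \<in> ?T \<longleftrightarrow> x \<in> A T l" for x using TE by fastforce
    have kT: "(k, x) \<in> ?T \<longleftrightarrow> (k, x) \<in> T" if "k \<noteq> s" for k x using that by auto
    have ge: "s \<le> k" if "(k, x) \<in> ?T" for k x using that TE by fastforce
    have As: "s \<notin> A T v" if "v \<noteq> s" for v using that TE by (fastforce simp: Amem)
    have A': "A ?T v = A T v \<union> (if v \<in> A T l then {s} else {})" for v
      unfolding A_def[of ?T] using sT by (auto simp: A_def)
    have Al: "m \<le> l" if "m \<in> A T l" for m using Ar[OF T that] by auto
    have pair: "(m, l') \<in> T" if "m \<in> A T l" "l' \<in> A T l" "m < l'" for m l'
    proof (cases "l' = l")
      case True
      thus ?thesis using that by (simp add: Amem)
    next
      case False
      hence "(m, l) \<in> T" "(l', l) \<in> T" using that Al[of l'] by (auto simp: Amem)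
      thus ?thesis using ker_edgesD[OF Q(2), of m l l' l] that TE by blast
    qed
    show ?thesis
    proof (intro equalityI subsetI)
      fix v assume v: "v \<in> V s ?T"
      show "v \<in> insert s {v \<in> V (Suc s) T. le T v l}"
      proof (cases "v = s")
        case False
        hence sv: "Suc s \<le> v" "v \<le> n" using Vr[OF v] by auto
        have "v \<in> V (Suc s) T"
          unfolding V_def
        proof (intro CollectI conjI ballI allI impI)
          fix m k l' assume kl: "m \<in> A T v" "(k, l') \<in> T" "k < m" "m \<le> l'"
          have m: "m \<in> A ?T v" using kl A' by simp
          have ks: "s < k" using TE[OF kl(2)] by simp
          show "k \<in> A T v" using VD(1)[OF v m, of k l'] kl ks A'[of v] by (auto split: if_splits)
          show "(m, l') \<in> T" if "m < l'" using VD(2)[OF v m, of k l'] kl ks that kT[of m l'] by auto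
        qed (use sv in simp)
        moreover have "le T v l"
        proof (cases "\<forall>m\<in>A T v. l < m")
          case False
          then obtain m where m: "m \<in> A T v" "m \<le> l" by force
          have "s < m" using Ar[OF T m(1)] sv by auto
          hence "s \<in> A ?T v" using VD(1)[OF v, of m s l] m A'[of v] sT[of l] Aself by auto
          hence "v \<in> A T l" using As[OF \<open>v \<noteq> s\<close>] A'[of v] by (simp split: if_splits)
          thus ?thesis by (simp add: le_def)
        qed (simp add: le_def)
        ultimately show ?thesis by simp
      qed simp
    next
      fix v assume v: "v \<in> insert s {v \<in> V (Suc s) T. le T v l}"
      show "v \<in> V s ?T"
      proof (cases "v = s")
        case True
        have "A ?T s = {s}"
          using A'[of s] Vr[OF l] Ar[OF T, of s l] Ar[OF T, of _ s] Aself by fastforce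
        thus ?thesis unfolding V_def using s ge True by fastforce
      next
        case False
        hence v: "v \<in> V (Suc s) T" "le T v l" using v by auto
        have vs: "s < v" using Vr[OF v(1)] by auto
        show ?thesis
          unfolding V_def
        proof (intro CollectI conjI ballI allI impI)
          show "v \<in> {s..n}" using Vr[OF v(1)] by simp
          fix m k l' assume kl: "m \<in> A ?T v" "(k, l') \<in> ?T" "k < m" "m \<le> l'"
          have "s \<le> k" using ge[OF kl(2)] .
          hence m: "m \<in> A T v" using kl A'[of v] by (auto split: if_splits)
          have sm: "m \<noteq> s" using \<open>s \<le> k\<close> kl by simp
          have "k \<in> A ?T v \<and> (m < l' \<longrightarrow> (m, l') \<in> T)"
          proof (cases "k = s")
            case True
            hence l': "l' \<in> A T l" using kl sT by simp
            have vl: "v \<in> A T l"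
            proof (rule ccontr)
              assume "v \<notin> A T l"
              hence "l < m" using v(2) m by (simp add: le_def)
              thus False using kl(4) Al[OF l'] by simp
            qed
            hence "m \<in> A T l" using Atrans[OF T l vl] m by blast
            thus ?thesis using pair[OF _ l'] A'[of v] vl True by simp
          next
            case False
            hence "(k, l') \<in> T" using kl(2) kT by simp
            thus ?thesis using VD[OF v(1) m, of k l'] kl A'[of v] by simp
          qed
          thus "k \<in> A ?T v" "m < l' \<Longrightarrow> (m, l') \<in> ?T" by auto
        qed
      qed
    qed
  qed
  show ?thesis
  proof (rule card_by_leftmost_insertion[where V = V and A = A])
    show "cok_edges {} \<and> ker_edges {}" by (simp add: cok_edges_def ker_edges_def)
    show "V (Suc n) {} = {}" by (simp add: V_def)
    show "finite (V s T)" for s T by (simp add: V_def)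
  next
    fix s T assume "cok_edges T \<and> ker_edges T"
    thus "cok_edges (T \<inter> edges (Suc s) n) \<and> ker_edges (T \<inter> edges (Suc s) n)"
      using cok_edges_restrict ker_edges_restrict by blast
  next
    fix s T B assume s: "s \<le> n" and T: "T \<subseteq> edges (Suc s) n" and Q: "cok_edges T \<and> ker_edges T"
      and B: "B \<subseteq> {Suc s..n}"
    let ?T = "T \<union> {s} \<times> B"
    have TE: "Suc s \<le> x \<and> x < y" if "(x, y) \<in> T" for x y using T that by (auto simp: edges_def)
    note C = cok_edgesD[OF conjunct1[OF Q]] and K = ker_edgesD[OF conjunct2[OF Q]]
    have sB: "(s, x) \<in> ?T \<longleftrightarrow> x \<in> B" for x using TE by fastforce
    have kT: "(k, x) \<in> ?T \<longleftrightarrow> (k, x) \<in> T" if "k \<noteq> s" for k x using that by auto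
    have ge: "s \<le> k" if "(k, x) \<in> ?T" for k x using that TE by fastforce
    have Bs: "s < x" if "x \<in> B" for x using B that by auto
    show "cok_edges ?T \<and> ker_edges ?T \<longleftrightarrow> B = {} \<or> (\<exists>l\<in>V (Suc s) T. B = A T l)"
    proof
      assume Q': "cok_edges ?T \<and> ker_edges ?T"
      note C' = cok_edgesD[OF conjunct1[OF Q']] and K' = ker_edgesD[OF conjunct2[OF Q']]
      show "B = {} \<or> (\<exists>l\<in>V (Suc s) T. B = A T l)"
      proof (cases "B = {}")
        case False
        have finB: "finite B" using B finite_subset by blast
        define l where "l = Max B"
        have l: "l \<in> B" "\<And>m. m \<in> B \<Longrightarrow> m \<le> l" using finB False by (auto simp: l_def)
        have BA: "B = A T l"
        proof (intro equalityI subsetI)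
          fix m assume m: "m \<in> B"
          show "m \<in> A T l"
          proof (cases "m = l")
            case False
            hence "m < l" using l(2)[OF m] by simp
            thus ?thesis using C'[of s m s l] m l(1) Bs[OF m] sB kT[of m l] by (simp add: Amem)
          qed (simp add: Amem)
        next
          fix m assume "m \<in> A T l"
          then consider "m = l" | "(m, l) \<in> T" by (auto simp: Amem)
          thus "m \<in> B"
          proof cases
            case 2
            thus ?thesis using K'[of s l m l] l(1) TE[OF 2] sB by auto
          qed (use l in simp)
        qed
        have "l \<in> V (Suc s) T"
          unfolding V_def
        proof (intro CollectI conjI ballI allI impI)
          show "l \<in> {Suc s..n}" using B l(1) by auto
          fix m k l' assume 1: "m \<in> A T l" "(k, l') \<in> T" "k < m" "m \<le> l'"
          have m: "m \<in> B" using 1 BA by simp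
          have k: "s < k" using TE[OF 1(2)] by simp
          show "k \<in> A T l" using K'[of s m k l'] 1 m k sB BA by auto
          show "(m, l') \<in> T" if "m < l'" using C'[of s m k l'] 1 m k that sB kT[of m l'] Bs[OF m] by auto
        qed
        thus ?thesis using BA by blast
      qed simp
    next
      assume "B = {} \<or> (\<exists>l\<in>V (Suc s) T. B = A T l)"
      thus "cok_edges ?T \<and> ker_edges ?T"
      proof
        assume "B = {}" thus ?thesis using Q by simp
      next
        assume "\<exists>l\<in>V (Suc s) T. B = A T l"
        then obtain l where l: "l \<in> V (Suc s) T" and BA: "B = A T l" by blast
        have pair: "(m, l') \<in> T" if m: "m \<in> B" "l' \<in> B" "m < l'" for m l'
        proof (cases "l' = l")
          case True
          thus ?thesis using m by (simp add: BA Amem)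
        next
          case False
          hence l'l: "(l', l) \<in> T" using m by (simp add: BA Amem)
          hence "(m, l) \<in> T" using m TE[OF l'l] by (auto simp: BA Amem)
          thus ?thesis using K[of m l l' l] l'l m TE[OF l'l] by simp
        qed
        show ?thesis
        proof
          show "cok_edges ?T"
            unfolding cok_edges_def
          proof (intro allI impI)
            fix i m k l' assume 1: "(i, m) \<in> ?T" "(k, l') \<in> ?T" "i \<le> k" "k < m" "m < l'"
            show "(m, l') \<in> ?T"
            proof (cases "i = s")
              case False
              hence "k \<noteq> s" using ge[OF 1(1)] 1(3) by simp
              thus ?thesis using C[of i m k l'] 1 False kT by simp
            next
              case True
              hence m: "m \<in> B" using 1 sB by simp
              show ?thesis
              proof (cases "k = s")
                case True
                thus ?thesis using pair[OF m, of l'] 1 sB by simp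
              next
                case False
                hence "(k, l') \<in> T" using 1 kT by simp
                thus ?thesis using VD(2)[OF l, of m k l'] m 1 by (simp add: BA)
              qed
            qed
          qed
          show "ker_edges ?T"
            unfolding ker_edges_def
          proof (intro allI impI)
            fix i m k l' assume 1: "(i, m) \<in> ?T" "(k, l') \<in> ?T" "i < k" "k < m" "m \<le> l'"
            have k: "k \<noteq> s" using ge[OF 1(1)] 1(3) by simp
            hence kl: "(k, l') \<in> T" using 1 kT by simp
            show "(i, k) \<in> ?T"
            proof (cases "i = s")
              case False
              thus ?thesis using K[of i m k l'] kl 1 kT by simp
            next
              case True
              hence "m \<in> B" using 1 sB by simp
              thus ?thesis using VD(1)[OF l, of m k l'] kl 1 True by (simp add: BA)
            qed
          qed
        qed
      qed
    qed
  next
    fix s T l assume s: "s \<le> n" and T: "T \<subseteq> edges (Suc s) n" and l: "l \<in> V (Suc s) T"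
    show "A T l \<noteq> {} \<and> A T l \<subseteq> {Suc s..n}"
      using Ar[OF T, of _ l] Vr[OF l] Aself[of l T] by fastforce
  next
    fix s T assume s: "s \<le> n" and T: "T \<subseteq> edges (Suc s) n" and Q: "cok_edges T \<and> ker_edges T"
    have TE: "Suc s \<le> x \<and> x < y" if "(x, y) \<in> T" for x y using T that by (auto simp: edges_def)
    note C = cok_edgesD[OF conjunct1[OF Q]]
    have Al: "m \<le> l" if "m \<in> A T l" for m l using Ar[OF T that] by auto
    show "inj_on (A T) (V (Suc s) T)"
    proof (rule inj_onI)
      fix x y assume "A T x = A T y"
      hence "x \<in> A T y" "y \<in> A T x" using Aself by auto
      thus "x = y" using Al by (meson order_antisym)
    qed
    have As: "A T s = {s}" using TE by (fastforce simp: A_def)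
    have "\<not> k < s" if "(k, l') \<in> T" for k l' using TE[OF that] by simp
    hence "s \<in> V s T" unfolding V_def using s by (auto simp: As dest: less_le_trans)
    moreover have "{s..n} = insert s {Suc s..n}" using s by (simp add: atLeastAtMost_insertL)
    ultimately have "V s T = insert s (V (Suc s) T)" unfolding V_def by blast
    moreover have "s \<notin> V (Suc s) T" "finite (V (Suc s) T)" by (auto simp: V_def)
    ultimately show "card (V s T) = Suc (card (V (Suc s) T))" by simp
    have c: "card (V s (T \<union> {s} \<times> A T l)) = Suc (card {v \<in> V (Suc s) T. le T v l})" if "l \<in> V (Suc s) T" for l
    proof -
      have "s \<notin> {v \<in> V (Suc s) T. le T v l}" "finite {v \<in> V (Suc s) T. le T v l}" by (auto simp: V_def)
      thus ?thesis using Vnew[OF s T conjunct1[OF Q] conjunct2[OF Q] that] by simp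
    qed
    have "bij_betw (\<lambda>l. Suc (card {v \<in> V (Suc s) T. le T v l})) (V (Suc s) T) {2..Suc (card (V (Suc s) T))}"
    proof (rule bij_betw_rank)
      show "finite (V (Suc s) T)" by (simp add: V_def)
      show "le T x x" for x using Aself by (simp add: le_def)
    next
      fix u v w assume V: "u \<in> V (Suc s) T" "v \<in> V (Suc s) T" "w \<in> V (Suc s) T" and uv: "le T u v" and vw: "le T v w"
      show "le T u w"
      proof (cases "u \<in> A T v")
        case True
        thus ?thesis using vw Atrans[OF T V(3), of v] Atrans[OF T V(2) True] unfolding le_def by blast
      next
        case False
        hence u: "\<And>m. m \<in> A T u \<Longrightarrow> v < m" using uv by (simp add: le_def)
        show ?thesis
        proof (cases "v \<in> A T w")
          case False
          hence "w < v" using vw Aself[of v T] by (simp add: le_def)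
          thus ?thesis using u unfolding le_def by (meson less_trans)
        next
          case True
          have "w < m" if m: "m \<in> A T u" for m
          proof (rule ccontr)
            assume "\<not> w < m"
            hence "m \<le> w" by simp
            hence "(v, w) \<in> T" using True u[OF m] by (auto simp: Amem)
            hence "v \<in> A T u" using VD(1)[OF V(1) m, of v w] u[OF m] \<open>m \<le> w\<close> by simp
            thus False using u by blast
          qed
          thus ?thesis by (simp add: le_def)
        qed
      qed
    next
      fix x y assume V: "x \<in> V (Suc s) T" "y \<in> V (Suc s) T" and xy: "le T x y" and yx: "le T y x"
      have "x \<le> y" "y \<le> x"
        using xy yx Al[of x y] Al[of y x] Aself[of x T] Aself[of y T] unfolding le_def by force+
      thus "x = y" by simp
    next
      have main: "le T x y \<or> le T y x"
        if V: "x \<in> V (Suc s) T" "y \<in> V (Suc s) T" and "x < y" for x y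
      proof (rule ccontr)
        assume n: "\<not> (le T x y \<or> le T y x)"
        have finA: "finite (A T x)" for x
          by (rule finite_subset[of _ "{..x}"]) (use Al in auto)
        define p where "p = Min (A T x)"
        define q where "q = Min (A T y)"
        have p: "p \<in> A T x" "\<And>m. m \<in> A T x \<Longrightarrow> p \<le> m"
          unfolding p_def using Min_in[OF finA] Min_le[OF finA] Aself by blast+
        have q: "q \<in> A T y" "\<And>m. m \<in> A T y \<Longrightarrow> q \<le> m"
          unfolding q_def using Min_in[OF finA] Min_le[OF finA] Aself by blast+
        have qx: "q \<le> x" using n q by (force simp: le_def)
        \<comment> \<open>Otherwise the left neighbour on the far side of the other vertex violates admissibility.\<close>
        have "p = q"
        proof (rule ccontr)
          assume "p \<noteq> q"
          then consider "p < q" | "q < p" by linarith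
          thus False
          proof cases
            case 1
            hence "(p, x) \<in> T" using p(1) qx by (auto simp: Amem)
            hence "p \<in> A T y" using VD(1)[OF V(2) q(1), of p x] 1 qx by simp
            thus False using q(2)[of p] 1 by simp
          next
            case 2
            have "p \<le> x" using Al[OF p(1)] .
            hence "(q, y) \<in> T" using q(1) \<open>x < y\<close> qx by (auto simp: Amem)
            hence "q \<in> A T x" using VD(1)[OF V(1) p(1), of q y] 2 \<open>p \<le> x\<close> \<open>x < y\<close> by simp
            thus False using p(2)[of q] 2 by simp
          qed
        qed
        have qy: "(q, y) \<in> T" using q(1) qx \<open>x < y\<close> by (auto simp: Amem)
        \<comment> \<open>Both vertices are right neighbours of \<open>q\<close> (or \<open>x = q\<close>), so the cokernel condition joins them.\<close>
        have "x \<in> A T y"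
        proof (cases "q = x")
          case False
          hence qx': "(q, x) \<in> T" using p(1) \<open>p = q\<close> by (simp add: Amem)
          thus ?thesis using C[of q x q y] qy TE[OF qx'] \<open>x < y\<close> by (simp add: Amem)
        qed (use q in simp)
        thus False using n by (simp add: le_def)
      qed
      show "le T x y \<or> le T y x" if "x \<in> V (Suc s) T" "y \<in> V (Suc s) T" for x y
        using main[of x y] main[of y x] that Aself[of x T] by (cases x y rule: linorder_cases) (auto simp: le_def)
    qed
    thus "bij_betw (\<lambda>l. card (V s (T \<union> {s} \<times> A T l))) (V (Suc s) T) {2..Suc (card (V (Suc s) T))}"
      using c by (simp cong: bij_betw_cong)
  qed
qed

section \<open>Large Schroeder numbers\<close>

unbundle fps_syntax

definition catalan_fps :: "real fps" where
  "catalan_fps = Abs_fps (\<lambda>n. real ((2 * n) choose n) / real (n + 1))"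

lemma central_binomial_Suc:
  "real (n + 1) * real ((2 * (n + 1)) choose (n + 1)) = (4 * real n + 2) * real ((2 * n) choose n)"
proof -
  define f F :: real where "f = fact n" and "F = fact (2 * n)"
  have f: "f \<noteq> 0" by (simp add: f_def)
  have "real ((2 * (n + 1)) choose (n + 1)) = fact (2 * n + 2) / (fact (n + 1) * fact (n + 1))"
    by (subst binomial_fact) simp_all
  also have "fact (2 * n + 2) = (2 * real n + 2) * (2 * real n + 1) * F"
    by (simp add: F_def algebra_simps)
  also have "fact (n + 1) = (real n + 1) * f"
    by (simp add: f_def algebra_simps)
  finally have 1: "real ((2 * (n + 1)) choose (n + 1)) =
      (2 * real n + 2) * (2 * real n + 1) * F / ((real n + 1) * f * ((real n + 1) * f))" .
  have 2: "real ((2 * n) choose n) = F / (f * f)"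
    unfolding f_def F_def by (subst binomial_fact) (simp_all add: mult_2)
  have "real n + 1 \<noteq> 0" by linarith
  thus ?thesis unfolding 1 2 using f by (simp add: divide_simps) (simp add: algebra_simps)
qed

text \<open>The series \<open>B\<close> of the central binomial coefficients satisfies \<open>(1 - 4x) B' = 2 B\<close>, so that
\<open>(1 - 4x) B^2\<close> has derivative zero and equals 1. Since \<open>B\<close> is the derivative of \<open>x C\<close> for the Catalan
series \<open>C\<close>, one also has \<open>1 - 2 x C = (1 - 4x) B\<close>. Squaring this gives the equation.\<close>

lemma catalan_fps_eq: "catalan_fps = 1 + fps_X * catalan_fps\<^sup>2"
proof -
  define B :: "real fps" where "B = Abs_fps (\<lambda>n. real ((2 * n) choose n))"
  let ?q = "1 - 4 * fps_X :: real fps"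
  have B0: "B $ 0 = 1" by (simp add: B_def)
  have ode: "?q * fps_deriv B = 2 * B"
  proof (rule fps_ext)
    fix n
    have 4: "(4 * fps_X * fps_deriv B) $ n = 4 * (real n * B $ n)"
      by (cases n) (simp_all add: mult.assoc numeral_fps_const)
    have "real (n + 1) * B $ (n + 1) = (4 * real n + 2) * B $ n"
      unfolding B_def using central_binomial_Suc[of n] by simp
    thus "(?q * fps_deriv B) $ n = (2 * B) $ n"
      using 4 by (simp add: left_diff_distrib numeral_fps_const algebra_simps)
  qed
  have dq: "fps_deriv ?q = -4" by (simp add: numeral_fps_const)
  have "fps_deriv (B\<^sup>2 * ?q) = 0"
  proof -
    have "fps_deriv (B\<^sup>2 * ?q) = 2 * B * (?q * fps_deriv B) - 4 * B\<^sup>2"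
      unfolding fps_deriv_mult dq power2_eq_square by (simp add: algebra_simps)
    thus ?thesis unfolding ode by (simp add: power2_eq_square)
  qed
  hence "B\<^sup>2 * ?q = fps_const ((B\<^sup>2 * ?q) $ 0)" by (simp only: fps_deriv_eq_0_iff)
  hence B2: "B\<^sup>2 * ?q = 1" using B0 by (simp add: power2_eq_square)
  have XC: "fps_deriv (fps_X * catalan_fps) = B"
    by (rule fps_ext) (simp add: catalan_fps_def B_def fps_deriv_nth del: fps_deriv_mult)
  have "fps_deriv (1 - 2 * (fps_X * catalan_fps)) = fps_deriv (?q * B)"
  proof -
    have "fps_deriv (1 - 2 * (fps_X * catalan_fps)) = - 2 * B"
      by (simp only: fps_deriv_sub fps_deriv_mult[of 2] XC)
        (simp add: numeral_fps_const fps_const_neg[symmetric] del: fps_const_neg)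
    also have "\<dots> = fps_deriv (?q * B)"
      unfolding fps_deriv_mult dq ode by simp
    finally show ?thesis .
  qed
  hence "1 - 2 * (fps_X * catalan_fps) = ?q * B"
    unfolding fps_deriv_eq_iff using B0 by simp
  hence "(1 - 2 * (fps_X * catalan_fps))\<^sup>2 = ?q * (B\<^sup>2 * ?q)"
    by (simp only: power2_eq_square mult_ac)
  hence "(1 - 2 * (fps_X * catalan_fps))\<^sup>2 = ?q" unfolding B2 by simp
  hence "4 * fps_X * (1 + fps_X * catalan_fps\<^sup>2 - catalan_fps) = 0"
    by (simp add: power2_eq_square algebra_simps)
  hence "1 + fps_X * catalan_fps\<^sup>2 - catalan_fps = 0" by simp
  thus ?thesis by simp
qed

definition geometric_fps :: "real fps" where
  "geometric_fps = Abs_fps (\<lambda>_. 1)"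

lemma geometric_fps_eq: "(1 - fps_X) * geometric_fps = 1"
  unfolding geometric_fps_def by (rule fps_ext) (simp add: left_diff_distrib)

lemma geometric_fps_power:
  "geometric_fps ^ Suc m = Abs_fps (\<lambda>k. real ((k + m) choose m))"
proof (induction m)
  case 0
  show ?case by (simp add: geometric_fps_def)
next
  case (Suc m)
  have "(1 - fps_X) * Abs_fps (\<lambda>k. real ((k + Suc m) choose Suc m)) = Abs_fps (\<lambda>k. real ((k + m) choose m))"
  proof (rule fps_ext)
    fix k show "((1 - fps_X) * Abs_fps (\<lambda>k. real ((k + Suc m) choose Suc m))) $ k =
        Abs_fps (\<lambda>k. real ((k + m) choose m)) $ k"
      by (cases k) (simp_all add: left_diff_distrib)
  qed
  hence "geometric_fps * ((1 - fps_X) * Abs_fps (\<lambda>k. real ((k + Suc m) choose Suc m))) = geometric_fps ^ Suc (Suc m)"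
    unfolding Suc.IH[symmetric] by simp
  moreover have "geometric_fps * ((1 - fps_X) * f) = f" for f
    using geometric_fps_eq by (metis mult.assoc mult.commute mult_1)
  ultimately show ?case by metis
qed

definition schroeder_fps :: "real fps" where
  "schroeder_fps = Abs_fps schroeder"

text \<open>The coefficient of \<open>x^n\<close> in \<open>x^i / (1 - x)^(2i+1)\<close> is \<open>n + i\<close> choose \<open>2 i\<close>, and its product with the
Catalan number of \<open>i\<close> is the summand in the definition of the Schroeder numbers.\<close>

lemma schroeder_fps_catalan:
  "schroeder_fps = (catalan_fps oo (fps_X * geometric_fps\<^sup>2)) * geometric_fps"
proof (rule fps_ext)
  fix n
  let ?T = "fps_X * geometric_fps\<^sup>2"
  have T0: "?T $ 0 = 0" by simp
  have "((catalan_fps oo ?T) * geometric_fps) $ n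
      = (\<Sum>k=0..n. \<Sum>i=0..n. catalan_fps $ i * (?T ^ i $ k * geometric_fps $ (n - k)))"
    unfolding fps_mult_nth
  proof (rule sum.cong[OF refl])
    fix k assume k: "k \<in> {0..n}"
    have "(catalan_fps oo ?T) $ k = (\<Sum>i=0..n. catalan_fps $ i * ?T ^ i $ k)"
      unfolding fps_compose_nth
      by (rule sum.mono_neutral_left) (use k startsby_zero_power_prefix[OF T0] in auto)
    thus "(catalan_fps oo ?T) $ k * geometric_fps $ (n - k)
        = (\<Sum>i=0..n. catalan_fps $ i * (?T ^ i $ k * geometric_fps $ (n - k)))"
      by (simp add: sum_distrib_right mult.assoc)
  qed
  also have "\<dots> = (\<Sum>i=0..n. catalan_fps $ i * (?T ^ i * geometric_fps) $ n)"
    by (subst sum.swap) (simp add: fps_mult_nth sum_distrib_left)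
  also have "\<dots> = (\<Sum>i=0..n. 1 / (real i + 1) * real (n choose i) * real ((n + i) choose i))"
  proof (rule sum.cong[OF refl])
    fix i assume i: "i \<in> {0..n}"
    have "?T ^ i * geometric_fps = fps_X ^ i * geometric_fps ^ Suc (2 * i)"
      by (simp add: power_mult_distrib mult_ac flip: power_mult)
    hence "(?T ^ i * geometric_fps) $ n = real ((n + i) choose (2 * i))"
      using i unfolding geometric_fps_power by (simp add: fps_X_power_mult_nth add.commute)
    moreover have "((n + i) choose (2 * i)) * ((2 * i) choose i) = ((n + i) choose i) * (n choose i)"
      using choose_mult[of i "2 * i" "n + i"] i by (simp add: mult_2)
    hence "real ((n + i) choose (2 * i)) * real ((2 * i) choose i) = real ((n + i) choose i) * real (n choose i)"
      by (metis of_nat_mult)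
    ultimately show "catalan_fps $ i * (?T ^ i * geometric_fps) $ n
        = 1 / (real i + 1) * real (n choose i) * real ((n + i) choose i)"
      by (simp add: catalan_fps_def field_simps)
  qed
  finally show "schroeder_fps $ n = ((catalan_fps oo ?T) * geometric_fps) $ n"
    by (simp add: schroeder_fps_def schroeder_def)
qed

lemma schroeder_fps_eq: "schroeder_fps = 1 + fps_X * schroeder_fps + fps_X * schroeder_fps\<^sup>2"
proof -
  let ?T = "fps_X * geometric_fps\<^sup>2" and ?G = geometric_fps and ?S = schroeder_fps
  define c where "c = catalan_fps oo ?T"
  have T0: "?T $ 0 = 0" by simp
  have "c = (1 + fps_X * catalan_fps\<^sup>2) oo ?T" unfolding c_def using catalan_fps_eq by metis
  also have "\<dots> = 1 + ?T * c\<^sup>2"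
    by (simp only: power2_eq_square[of catalan_fps] power2_eq_square[of "_ oo _"] c_def fps_compose_add_distrib
        fps_compose_mult_distrib[OF T0] fps_X_fps_compose_startby0[OF T0] fps_compose_1)
  finally have c: "c = 1 + ?T * c\<^sup>2" .
  have S: "?S = c * ?G" unfolding schroeder_fps_catalan c_def ..
  have "?S = (1 + ?T * c\<^sup>2) * ?G" unfolding S using c by simp
  also have "\<dots> = ?G + fps_X * ?G * ?S\<^sup>2"
    unfolding S by (simp add: power2_eq_square algebra_simps)
  finally have "(1 - fps_X) * ?S = (1 - fps_X) * (?G + fps_X * ?G * ?S\<^sup>2)" by simp
  also have "\<dots> = ((1 - fps_X) * ?G) * (1 + fps_X * ?S\<^sup>2)" by (simp add: algebra_simps)
  finally have "(1 - fps_X) * ?S = 1 + fps_X * ?S\<^sup>2" unfolding geometric_fps_eq by simp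
  thus ?thesis by (simp add: algebra_simps)
qed

text \<open>With \<open>\<mu> = 1 / (1 - x S)\<close> one has \<open>S = 2 \<mu> - 1\<close> and \<open>\<mu> - 1 = x \<mu> (2 \<mu> - 1)\<close>. The latter is what makes
the series \<open>S \<mu>^v\<close> satisfy the recursion of the tree, because the difference of the recursions for two
consecutive labels involves three consecutive powers of \<open>\<mu>\<close> only.\<close>

lemma descendants_schroeder: "real (descendants n 1) = schroeder n"
proof -
  let ?S = schroeder_fps
  define \<mu> where "\<mu> = inverse (1 - fps_X * ?S)"
  have "(1 - fps_X * ?S) $ 0 \<noteq> 0" by simp
  hence \<mu>: "\<mu> * (1 - fps_X * ?S) = 1" unfolding \<mu>_def by (rule inverse_mult_eq_1)
  hence \<mu>1: "\<mu> = 1 + fps_X * ?S * \<mu>" by (simp add: algebra_simps)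
  have "?S = \<mu> * ((1 - fps_X * ?S) * ?S)" using \<mu> by (simp add: mult.assoc[symmetric])
  also have "(1 - fps_X * ?S) * ?S = (1 - fps_X * ?S) + 2 * (fps_X * ?S)"
    using schroeder_fps_eq by (simp add: power2_eq_square algebra_simps)
  also have "\<mu> * \<dots> = 1 + 2 * (fps_X * ?S * \<mu>)"
    unfolding distrib_left \<mu> by (simp add: algebra_simps)
  finally have S1: "?S = 1 + 2 * (fps_X * ?S * \<mu>)" .
  have S2: "\<mu> - 1 = fps_X * \<mu> * (2 * \<mu> - 1)"
  proof -
    obtain t where t: "fps_X * ?S * \<mu> = t" by simp
    have "?S = 1 + 2 * t" "\<mu> = 1 + t" using S1 \<mu>1 unfolding t by simp_all
    hence S: "?S = 2 * \<mu> - 1" by (simp add: algebra_simps)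
    have "\<mu> - 1 = fps_X * ?S * \<mu>" using \<mu>1 by (metis add_diff_cancel_left')
    also have "\<dots> = fps_X * \<mu> * (2 * \<mu> - 1)" unfolding S by (simp only: mult_ac)
    finally show ?thesis .
  qed
  have rec: "?S * \<mu> ^ v = 1 + fps_X * (?S * \<mu> ^ Suc v + (\<Sum>r=1..Suc v. ?S * \<mu> ^ r))" for v
  proof (induction v)
    case 0
    show ?case using S1 by (simp add: algebra_simps)
  next
    case (Suc v)
    have "?S * \<mu> ^ Suc v - ?S * \<mu> ^ v = ?S * \<mu> ^ v * (\<mu> - 1)" by (simp add: algebra_simps)
    also have "\<dots> = fps_X * (2 * (?S * \<mu> ^ Suc (Suc v)) - ?S * \<mu> ^ Suc v)"
      unfolding S2 by (simp add: algebra_simps)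
    finally show ?case using Suc.IH by (simp add: algebra_simps)
  qed
  have S0: "?S $ 0 = 1" and \<mu>0: "\<mu> $ 0 = 1"
    by (simp_all add: schroeder_fps_def schroeder_def \<mu>_def)
  have "real (descendants k (v + 1)) = (?S * \<mu> ^ v) $ k" for k v
  proof (induction k arbitrary: v)
    case 0
    show ?case using S0 \<mu>0 by (simp add: fps_power_zeroth)
  next
    case (Suc k)
    have "(?S * \<mu> ^ v) $ Suc k = (?S * \<mu> ^ Suc v) $ k + (\<Sum>r=1..Suc v. (?S * \<mu> ^ r) $ k)"
    proof -
      have nth: "(1 + fps_X * (P + Q)) $ Suc k = P $ k + Q $ k" for P Q :: "real fps" by simp
      show ?thesis unfolding rec[of v] nth fps_sum_nth ..
    qed
    also have "\<dots> = real (descendants k (Suc v + 1)) + (\<Sum>r=1..Suc v. real (descendants k (r + 1)))"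
      using Suc.IH by simp
    finally show ?case by simp
  qed
  from this[of n 0] show ?thesis by (simp add: schroeder_fps_def)
qed

section \<open>Intervals as edges between cut points\<close>

definition interval_of_edge :: "nat \<times> nat \<Rightarrow> interval" where
  "interval_of_edge = map_prod Suc id"

lemma interval_of_edge_image_iff: "(a, b) \<in> interval_of_edge ` T \<longleftrightarrow> (\<exists>i. a = Suc i \<and> (i, b) \<in> T)"
  by (force simp: interval_of_edge_def)

lemma coker_stable_edges: "coker_stable (interval_of_edge ` T) \<longleftrightarrow> cok_edges T"
proof
  assume S: "coker_stable (interval_of_edge ` T)"
  show "cok_edges T"
    unfolding cok_edges_def
  proof (intro allI impI)
    fix i j k l assume 1: "(i, j) \<in> T" "(k, l) \<in> T" "i \<le> k" "k < j" "j < l"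
    hence "(j + 1, l) \<in> interval_of_edge ` T"
      by (intro coker_stableD[OF S, of "Suc i" j "Suc k"]) (auto simp: interval_of_edge_image_iff)
    thus "(j, l) \<in> T" by (auto simp: interval_of_edge_image_iff)
  qed
next
  assume T: "cok_edges T"
  show "coker_stable (interval_of_edge ` T)"
    unfolding coker_stable_def
  proof (intro allI impI)
    fix a b c d assume 1: "(a, b) \<in> interval_of_edge ` T" "(c, d) \<in> interval_of_edge ` T" "a \<le> c" "c \<le> b" "b < d"
    then obtain i k where "a = Suc i" "c = Suc k" "(i, b) \<in> T" "(k, d) \<in> T"
      by (auto simp: interval_of_edge_image_iff)
    thus "(b + 1, d) \<in> interval_of_edge ` T"
      using cok_edgesD[OF T, of i b k d] 1 by (auto simp: interval_of_edge_image_iff)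
  qed
qed

lemma ker_stable_edges: "ker_stable (interval_of_edge ` T) \<longleftrightarrow> ker_edges T"
proof
  assume S: "ker_stable (interval_of_edge ` T)"
  show "ker_edges T"
    unfolding ker_edges_def
  proof (intro allI impI)
    fix i j k l assume 1: "(i, j) \<in> T" "(k, l) \<in> T" "i < k" "k < j" "j \<le> l"
    hence "(Suc i, Suc k - 1) \<in> interval_of_edge ` T"
      by (intro ker_stableD[OF S, of _ j "Suc k" l]) (auto simp: interval_of_edge_image_iff)
    thus "(i, k) \<in> T" by (auto simp: interval_of_edge_image_iff)
  qed
next
  assume T: "ker_edges T"
  show "ker_stable (interval_of_edge ` T)"
    unfolding ker_stable_def
  proof (intro allI impI)
    fix a b c d assume 1: "(a, b) \<in> interval_of_edge ` T" "(c, d) \<in> interval_of_edge ` T" "a < c" "c \<le> b" "b \<le> d"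
    then obtain i k where "a = Suc i" "c = Suc k" "(i, b) \<in> T" "(k, d) \<in> T"
      by (auto simp: interval_of_edge_image_iff)
    thus "(a, c - 1) \<in> interval_of_edge ` T"
      using ker_edgesD[OF T, of i b k d] 1 by (auto simp: interval_of_edge_image_iff)
  qed
qed

lemma ext_stable_edges: "ext_stable (interval_of_edge ` T) \<longleftrightarrow> ext_edges T"
proof
  assume S: "ext_stable (interval_of_edge ` T)"
  show "ext_edges T"
    unfolding ext_edges_def
  proof (intro allI impI)
    fix i j k l assume 1: "(i, j) \<in> T" "(k, l) \<in> T" "i < k" "k \<le> j" "j < l"
    hence "(Suc i, j) \<in> interval_of_edge ` T" "(Suc k, l) \<in> interval_of_edge ` T"
      by (auto simp: interval_of_edge_image_iff)
    from ext_stableD[OF S this] 1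
    have "(Suc i, l) \<in> interval_of_edge ` T" "k < j \<Longrightarrow> (Suc k, j) \<in> interval_of_edge ` T" by auto
    thus "(i, l) \<in> T \<and> (k < j \<longrightarrow> (k, j) \<in> T)" by (auto simp: interval_of_edge_image_iff)
  qed
next
  assume T: "ext_edges T"
  show "ext_stable (interval_of_edge ` T)"
    unfolding ext_stable_def
  proof (intro allI impI)
    fix a b c d assume 1: "(a, b) \<in> interval_of_edge ` T" "(c, d) \<in> interval_of_edge ` T" "a < c" "c \<le> b + 1" "b < d"
    then obtain i k where "a = Suc i" "c = Suc k" "(i, b) \<in> T" "(k, d) \<in> T"
      by (auto simp: interval_of_edge_image_iff)
    thus "(a, d) \<in> interval_of_edge ` T \<and> (c \<le> b \<longrightarrow> (c, b) \<in> interval_of_edge ` T)"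
      using ext_edgesD[OF T, of i b k d] 1 by (auto simp: interval_of_edge_image_iff)
  qed
qed

lemma card_interval_sets:
  assumes "\<And>T. P (interval_of_edge ` T) \<longleftrightarrow> Q T"
  shows "card {S. S \<subseteq> intervals n \<and> P S} = card {T. T \<subseteq> edges 0 n \<and> Q T}"
proof -
  have int: "intervals n = interval_of_edge ` edges 0 n"
  proof (intro set_eqI)
    fix x show "x \<in> intervals n \<longleftrightarrow> x \<in> interval_of_edge ` edges 0 n"
      by (cases x; cases "fst x") (auto simp: interval_of_edge_image_iff intervals_def edges_def)
  qed
  have inj: "inj interval_of_edge" by (auto simp: interval_of_edge_def inj_def)
  have "{S. S \<subseteq> intervals n \<and> P S} = (`) interval_of_edge ` {T. T \<subseteq> edges 0 n \<and> Q T}"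
  proof (intro set_eqI iffI)
    fix S assume "S \<in> {S. S \<subseteq> intervals n \<and> P S}"
    then obtain T where "T \<subseteq> edges 0 n" "S = interval_of_edge ` T" "P S"
      unfolding int by (auto simp: subset_image_iff)
    thus "S \<in> (`) interval_of_edge ` {T. T \<subseteq> edges 0 n \<and> Q T}" using assms by blast
  qed (use assms int in auto)
  moreover have "inj_on ((`) interval_of_edge) {T. T \<subseteq> edges 0 n \<and> Q T}"
    using inj by (auto simp: inj_on_def inj_image_eq_iff)
  ultimately show ?thesis by (simp add: card_image)
qed

theorem corollary12:
  fixes n :: nat
  assumes "n \<ge> 1"
  shows "real (num_CK n) = schroeder n \<and> schroeder n = real (num_CE n)"
proof -
  have "num_CK n = descendants (Suc n) 0"
    unfolding num_CK_eq card_cok_ker_edges[symmetric]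
    by (rule card_interval_sets) (simp add: coker_stable_edges ker_stable_edges)
  moreover have "num_CE n = descendants (Suc n) 0"
    unfolding num_CE_eq card_cok_ext_edges[symmetric]
    by (rule card_interval_sets) (simp add: coker_stable_edges ext_stable_edges)
  moreover have "real (descendants (Suc n) 0) = schroeder n"
    using descendants_schroeder[of n] by simp
  ultimately show ?thesis by simp
qed

end
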